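(* Let $\mathcal{C}$ be a finitely complete category. The following are equivalent: (i) $\mathcal{C}$ is diexact; (ii) $\mathcal{C}$ is Barr-exact and adhesive; (iii) $\mathcal{C}$ is Barr-exact and amalgamable.
   Context: A span $f \colon A \leftarrow C \rightarrow B \colon g$ in a finitely complete category is called a Mal'cev span if it is jointly monic and there exists a morphism $m \colon C \times_B C \times_A C \to C$ with $f m = f\pi_1$ and $g m = g \pi_3$. Here $C \times_B C \times_A C$ is the limit object whose generalized elements are triples $(c_1,c_2,c_3)$ of generalized elements of $C$ with $g c_1 = g c_2$ and $f c_2 = f c_3$, and $\pi_1, \pi_3$ are its first and third projections to $C$. A pushout square with vertex $D$ is stable (under pullback) if, for every morphism $X \to D$, the square obtained by pulling back the whole square along $X \to D$ is again a pushout. A finitely complete category is: - diexact if every Mal'cev span in it admits a pushout, and every such pushout square (a pushout of a Mal'cev span) is stable under pullback and is itself a pullback square; - adhesive if every span at least one of whose legs is a monomorphism admits a pushout, and every such pushout square is stable under pullback and is itself a pullback square; - amalgamable if every span both of whose legs are monomorphisms admits a pushout which is stable under pullback and is itself a pullback square; - Barr-exact if it is regular and every equivalence relation in it is a kernel-pair. *)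

theory Defs
  imports Main
begin

section \<open>Categories\<close>

record ('o, 'a) cat =
  Obj :: "'o set"
  Arr :: "'a set"
  Dom :: "'a \<Rightarrow> 'o"
  Cod :: "'a \<Rightarrow> 'o"
  Ide :: "'o \<Rightarrow> 'a"
  Comp :: "'a \<Rightarrow> 'a \<Rightarrow> 'a" (infixl "\<cdot>\<index>" 70)

text \<open>Composition is written in applicative order: \<open>g \<cdot>\<^bsub>C\<^esub> f\<close> is \<open>f\<close> followed by \<open>g\<close>.\<close>

definition hom :: "('o, 'a) cat \<Rightarrow> 'o \<Rightarrow> 'o \<Rightarrow> 'a set" where
  "hom C a b = {f \<in> Arr C. Dom C f = a \<and> Cod C f = b}"

locale category =
  fixes C :: "('o, 'a) cat" (structure)
  assumes Dom_Obj: "f \<in> Arr C \<Longrightarrow> Dom C f \<in> Obj C"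
    and Cod_Obj: "f \<in> Arr C \<Longrightarrow> Cod C f \<in> Obj C"
    and Ide_hom: "a \<in> Obj C \<Longrightarrow> Ide C a \<in> hom C a a"
    and Comp_hom: "\<lbrakk>f \<in> hom C a b; g \<in> hom C b c\<rbrakk> \<Longrightarrow> g \<cdot> f \<in> hom C a c"
    and Comp_Ide_left: "f \<in> hom C a b \<Longrightarrow> Ide C b \<cdot> f = f"
    and Comp_Ide_right: "f \<in> hom C a b \<Longrightarrow> f \<cdot> Ide C a = f"
    and Comp_assoc: "\<lbrakk>f \<in> hom C a b; g \<in> hom C b c; h \<in> hom C c d\<rbrakk>
      \<Longrightarrow> (h \<cdot> g) \<cdot> f = h \<cdot> (g \<cdot> f)"


section \<open>Finite limits\<close>

definition is_functor ::
  "('i, 'j) cat \<Rightarrow> ('o, 'a) cat \<Rightarrow> ('i \<Rightarrow> 'o) \<Rightarrow> ('j \<Rightarrow> 'a) \<Rightarrow> bool" where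
  "is_functor J C Fo Fa \<longleftrightarrow>
     (\<forall>i \<in> Obj J. Fo i \<in> Obj C) \<and>
     (\<forall>u \<in> Arr J. Fa u \<in> hom C (Fo (Dom J u)) (Fo (Cod J u))) \<and>
     (\<forall>i \<in> Obj J. Fa (Ide J i) = Ide C (Fo i)) \<and>
     (\<forall>u \<in> Arr J. \<forall>v \<in> Arr J. Dom J v = Cod J u \<longrightarrow> Fa (v \<cdot>\<^bsub>J\<^esub> u) = Fa v \<cdot>\<^bsub>C\<^esub> Fa u)"

definition is_cone ::
  "('i, 'j) cat \<Rightarrow> ('o, 'a) cat \<Rightarrow> ('i \<Rightarrow> 'o) \<Rightarrow> ('j \<Rightarrow> 'a) \<Rightarrow> 'o \<Rightarrow> ('i \<Rightarrow> 'a) \<Rightarrow> bool" where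
  "is_cone J C Fo Fa X x \<longleftrightarrow>
     X \<in> Obj C \<and>
     (\<forall>i \<in> Obj J. x i \<in> hom C X (Fo i)) \<and>
     (\<forall>u \<in> Arr J. Fa u \<cdot>\<^bsub>C\<^esub> x (Dom J u) = x (Cod J u))"

definition is_limit ::
  "('i, 'j) cat \<Rightarrow> ('o, 'a) cat \<Rightarrow> ('i \<Rightarrow> 'o) \<Rightarrow> ('j \<Rightarrow> 'a) \<Rightarrow> 'o \<Rightarrow> ('i \<Rightarrow> 'a) \<Rightarrow> bool" where
  "is_limit J C Fo Fa L l \<longleftrightarrow>
     is_cone J C Fo Fa L l \<and>
     (\<forall>X x. is_cone J C Fo Fa X x \<longrightarrow>
        (\<exists>!t \<in> hom C X L. \<forall>i \<in> Obj J. l i \<cdot>\<^bsub>C\<^esub> t = x i))"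

text \<open>
  Every finite category is isomorphic to one whose objects and arrows are natural numbers,
  so it is no restriction to let the index category range over the type \<open>(nat, nat) cat\<close>.
\<close>

definition finitely_complete :: "('o, 'a) cat \<Rightarrow> bool" where
  "finitely_complete C \<longleftrightarrow>
     (\<forall>(J :: (nat, nat) cat) Fo Fa.
        category J \<and> finite (Obj J) \<and> finite (Arr J) \<and> is_functor J C Fo Fa \<longrightarrow>
        (\<exists>L l. is_limit J C Fo Fa L l))"


section \<open>Squares\<close>

text \<open>
  In all predicates on squares the two legs of the span come first, followed by the two legs of
  the cospan: \<open>commuting_square C f g p q\<close> says that \<open>p \<cdot>\<^bsub>C\<^esub> f = q \<cdot>\<^bsub>C\<^esub> g\<close>, with
  \<open>f\<close> opposite \<open>q\<close> and \<open>g\<close> opposite \<open>p\<close>.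
\<close>

definition span :: "('o, 'a) cat \<Rightarrow> 'a \<Rightarrow> 'a \<Rightarrow> bool" where
  "span C f g \<longleftrightarrow> f \<in> Arr C \<and> g \<in> Arr C \<and> Dom C f = Dom C g"

definition commuting_square :: "('o, 'a) cat \<Rightarrow> 'a \<Rightarrow> 'a \<Rightarrow> 'a \<Rightarrow> 'a \<Rightarrow> bool" where
  "commuting_square C f g p q \<longleftrightarrow>
     span C f g \<and> p \<in> Arr C \<and> q \<in> Arr C \<and>
     Dom C p = Cod C f \<and> Dom C q = Cod C g \<and> Cod C p = Cod C q \<and>
     p \<cdot>\<^bsub>C\<^esub> f = q \<cdot>\<^bsub>C\<^esub> g"

definition is_pullback :: "('o, 'a) cat \<Rightarrow> 'a \<Rightarrow> 'a \<Rightarrow> 'a \<Rightarrow> 'a \<Rightarrow> bool" where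
  "is_pullback C f g p q \<longleftrightarrow>
     commuting_square C f g p q \<and>
     (\<forall>x y. commuting_square C x y p q \<longrightarrow>
        (\<exists>!t \<in> hom C (Dom C x) (Dom C f). f \<cdot>\<^bsub>C\<^esub> t = x \<and> g \<cdot>\<^bsub>C\<^esub> t = y))"

definition is_pushout :: "('o, 'a) cat \<Rightarrow> 'a \<Rightarrow> 'a \<Rightarrow> 'a \<Rightarrow> 'a \<Rightarrow> bool" where
  "is_pushout C f g p q \<longleftrightarrow>
     commuting_square C f g p q \<and>
     (\<forall>x y. commuting_square C f g x y \<longrightarrow>
        (\<exists>!t \<in> hom C (Cod C p) (Cod C x). t \<cdot>\<^bsub>C\<^esub> p = x \<and> t \<cdot>\<^bsub>C\<^esub> q = y))"

text \<open>
  Let \<open>p \<cdot>\<^bsub>C\<^esub> f = q \<cdot>\<^bsub>C\<^esub> g\<close> be a square with vertex \<open>D\<close>, and let \<open>h : X \<rightarrow> D\<close>.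
  The arrows \<open>a\<close>, \<open>b\<close>, \<open>c\<close> below project the pullbacks along \<open>h\<close> of the three
  objects \<open>Cod f\<close>, \<open>Cod g\<close>, \<open>Dom f\<close> over \<open>D\<close> to these objects; \<open>p'\<close>, \<open>q'\<close>, \<open>r\<close>
  are the projections to \<open>X\<close>; and \<open>f'\<close>, \<open>g'\<close> are the induced arrows.
\<close>

definition stable_pushout :: "('o, 'a) cat \<Rightarrow> 'a \<Rightarrow> 'a \<Rightarrow> 'a \<Rightarrow> 'a \<Rightarrow> bool" where
  "stable_pushout C f g p q \<longleftrightarrow>
     is_pushout C f g p q \<and>
     (\<forall>h a b c p' q' r f' g'.
        is_pullback C a p' p h \<and>
        is_pullback C b q' q h \<and>
        is_pullback C c r (p \<cdot>\<^bsub>C\<^esub> f) h \<and>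
        f' \<in> hom C (Dom C c) (Dom C a) \<and> a \<cdot>\<^bsub>C\<^esub> f' = f \<cdot>\<^bsub>C\<^esub> c \<and> p' \<cdot>\<^bsub>C\<^esub> f' = r \<and>
        g' \<in> hom C (Dom C c) (Dom C b) \<and> b \<cdot>\<^bsub>C\<^esub> g' = g \<cdot>\<^bsub>C\<^esub> c \<and> q' \<cdot>\<^bsub>C\<^esub> g' = r \<longrightarrow>
        is_pushout C f' g' p' q')"


section \<open>Monomorphisms and Mal'cev spans\<close>

definition monic :: "('o, 'a) cat \<Rightarrow> 'a \<Rightarrow> bool" where
  "monic C f \<longleftrightarrow>
     f \<in> Arr C \<and>
     (\<forall>X. \<forall>x \<in> hom C X (Dom C f). \<forall>y \<in> hom C X (Dom C f).
        f \<cdot>\<^bsub>C\<^esub> x = f \<cdot>\<^bsub>C\<^esub> y \<longrightarrow> x = y)"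

definition jointly_monic :: "('o, 'a) cat \<Rightarrow> 'a \<Rightarrow> 'a \<Rightarrow> bool" where
  "jointly_monic C f g \<longleftrightarrow>
     span C f g \<and>
     (\<forall>X. \<forall>x \<in> hom C X (Dom C f). \<forall>y \<in> hom C X (Dom C f).
        f \<cdot>\<^bsub>C\<^esub> x = f \<cdot>\<^bsub>C\<^esub> y \<and> g \<cdot>\<^bsub>C\<^esub> x = g \<cdot>\<^bsub>C\<^esub> y \<longrightarrow> x = y)"

definition composable_triple ::
  "('o, 'a) cat \<Rightarrow> 'a \<Rightarrow> 'a \<Rightarrow> 'o \<Rightarrow> 'a \<Rightarrow> 'a \<Rightarrow> 'a \<Rightarrow> bool" where
  "composable_triple C f g X x\<^sub>1 x\<^sub>2 x\<^sub>3 \<longleftrightarrow>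
     x\<^sub>1 \<in> hom C X (Dom C f) \<and> x\<^sub>2 \<in> hom C X (Dom C f) \<and> x\<^sub>3 \<in> hom C X (Dom C f) \<and>
     g \<cdot>\<^bsub>C\<^esub> x\<^sub>1 = g \<cdot>\<^bsub>C\<^esub> x\<^sub>2 \<and> f \<cdot>\<^bsub>C\<^esub> x\<^sub>2 = f \<cdot>\<^bsub>C\<^esub> x\<^sub>3"

text \<open>For a span \<open>f : A \<leftarrow> S \<rightarrow> B : g\<close>, the object \<open>P\<close> with projections
  \<open>\<pi>\<^sub>1\<close>, \<open>\<pi>\<^sub>2\<close>, \<open>\<pi>\<^sub>3\<close> is the limit \<open>S \<times>\<^sub>B S \<times>\<^sub>A S\<close>.\<close>

definition is_triple_product ::
  "('o, 'a) cat \<Rightarrow> 'a \<Rightarrow> 'a \<Rightarrow> 'o \<Rightarrow> 'a \<Rightarrow> 'a \<Rightarrow> 'a \<Rightarrow> bool" where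
  "is_triple_product C f g P \<pi>\<^sub>1 \<pi>\<^sub>2 \<pi>\<^sub>3 \<longleftrightarrow>
     composable_triple C f g P \<pi>\<^sub>1 \<pi>\<^sub>2 \<pi>\<^sub>3 \<and>
     (\<forall>X x\<^sub>1 x\<^sub>2 x\<^sub>3. composable_triple C f g X x\<^sub>1 x\<^sub>2 x\<^sub>3 \<longrightarrow>
        (\<exists>!t \<in> hom C X P. \<pi>\<^sub>1 \<cdot>\<^bsub>C\<^esub> t = x\<^sub>1 \<and> \<pi>\<^sub>2 \<cdot>\<^bsub>C\<^esub> t = x\<^sub>2 \<and> \<pi>\<^sub>3 \<cdot>\<^bsub>C\<^esub> t = x\<^sub>3))"

definition malcev_span :: "('o, 'a) cat \<Rightarrow> 'a \<Rightarrow> 'a \<Rightarrow> bool" where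
  "malcev_span C f g \<longleftrightarrow>
     jointly_monic C f g \<and>
     (\<exists>P \<pi>\<^sub>1 \<pi>\<^sub>2 \<pi>\<^sub>3. is_triple_product C f g P \<pi>\<^sub>1 \<pi>\<^sub>2 \<pi>\<^sub>3 \<and>
        (\<exists>m \<in> hom C P (Dom C f). f \<cdot>\<^bsub>C\<^esub> m = f \<cdot>\<^bsub>C\<^esub> \<pi>\<^sub>1 \<and> g \<cdot>\<^bsub>C\<^esub> m = g \<cdot>\<^bsub>C\<^esub> \<pi>\<^sub>3))"


section \<open>Diexact, adhesive and amalgamable categories\<close>

definition diexact :: "('o, 'a) cat \<Rightarrow> bool" where
  "diexact C \<longleftrightarrow>
     finitely_complete C \<and>
     (\<forall>f g. malcev_span C f g \<longrightarrow>
        (\<exists>p q. is_pushout C f g p q) \<and>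
        (\<forall>p q. is_pushout C f g p q \<longrightarrow> stable_pushout C f g p q \<and> is_pullback C f g p q))"

definition adhesive :: "('o, 'a) cat \<Rightarrow> bool" where
  "adhesive C \<longleftrightarrow>
     finitely_complete C \<and>
     (\<forall>f g. span C f g \<and> (monic C f \<or> monic C g) \<longrightarrow>
        (\<exists>p q. is_pushout C f g p q) \<and>
        (\<forall>p q. is_pushout C f g p q \<longrightarrow> stable_pushout C f g p q \<and> is_pullback C f g p q))"

definition amalgamable :: "('o, 'a) cat \<Rightarrow> bool" where
  "amalgamable C \<longleftrightarrow>
     finitely_complete C \<and>
     (\<forall>f g. span C f g \<and> monic C f \<and> monic C g \<longrightarrow>
        (\<exists>p q. stable_pushout C f g p q \<and> is_pullback C f g p q))"


section \<open>Barr-exact categories\<close>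

definition is_coequalizer :: "('o, 'a) cat \<Rightarrow> 'a \<Rightarrow> 'a \<Rightarrow> 'a \<Rightarrow> bool" where
  "is_coequalizer C u v e \<longleftrightarrow>
     span C u v \<and> Cod C u = Cod C v \<and>
     e \<in> Arr C \<and> Dom C e = Cod C u \<and> e \<cdot>\<^bsub>C\<^esub> u = e \<cdot>\<^bsub>C\<^esub> v \<and>
     (\<forall>x \<in> Arr C. Dom C x = Cod C u \<and> x \<cdot>\<^bsub>C\<^esub> u = x \<cdot>\<^bsub>C\<^esub> v \<longrightarrow>
        (\<exists>!t \<in> hom C (Cod C e) (Cod C x). t \<cdot>\<^bsub>C\<^esub> e = x))"

definition regular_epi :: "('o, 'a) cat \<Rightarrow> 'a \<Rightarrow> bool" where
  "regular_epi C e \<longleftrightarrow> (\<exists>u v. is_coequalizer C u v e)"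

definition is_kernel_pair :: "('o, 'a) cat \<Rightarrow> 'a \<Rightarrow> 'a \<Rightarrow> 'a \<Rightarrow> bool" where
  "is_kernel_pair C u v h \<longleftrightarrow> is_pullback C u v h h"

definition regular :: "('o, 'a) cat \<Rightarrow> bool" where
  "regular C \<longleftrightarrow>
     finitely_complete C \<and>
     (\<forall>h u v. is_kernel_pair C u v h \<longrightarrow> (\<exists>e. is_coequalizer C u v e)) \<and>
     (\<forall>e h k e'. regular_epi C e \<and> is_pullback C k e' e h \<longrightarrow> regular_epi C e')"

definition equivalence_relation :: "('o, 'a) cat \<Rightarrow> 'a \<Rightarrow> 'a \<Rightarrow> bool" where
  "equivalence_relation C s t \<longleftrightarrow>
     jointly_monic C s t \<and> Cod C s = Cod C t \<and>
     (\<exists>\<rho> \<in> hom C (Cod C s) (Dom C s).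
        s \<cdot>\<^bsub>C\<^esub> \<rho> = Ide C (Cod C s) \<and> t \<cdot>\<^bsub>C\<^esub> \<rho> = Ide C (Cod C s)) \<and>
     (\<exists>\<sigma> \<in> hom C (Dom C s) (Dom C s). s \<cdot>\<^bsub>C\<^esub> \<sigma> = t \<and> t \<cdot>\<^bsub>C\<^esub> \<sigma> = s) \<and>
     (\<exists>\<pi>\<^sub>1 \<pi>\<^sub>2. is_pullback C \<pi>\<^sub>1 \<pi>\<^sub>2 t s \<and>
        (\<exists>\<tau> \<in> hom C (Dom C \<pi>\<^sub>1) (Dom C s).
           s \<cdot>\<^bsub>C\<^esub> \<tau> = s \<cdot>\<^bsub>C\<^esub> \<pi>\<^sub>1 \<and> t \<cdot>\<^bsub>C\<^esub> \<tau> = t \<cdot>\<^bsub>C\<^esub> \<pi>\<^sub>2))"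

definition Barr_exact :: "('o, 'a) cat \<Rightarrow> bool" where
  "Barr_exact C \<longleftrightarrow>
     regular C \<and>
     (\<forall>s t. equivalence_relation C s t \<longrightarrow> (\<exists>h. is_kernel_pair C s t h))"

end

theory Submission
  imports Defs
begin

text \<open>
  Spans with a monic leg and equivalence relations are Mal'cev spans. Hence a diexact category is
  adhesive, and since the pushout of a reflexive pair is its coequalizer, it is also Barr-exact.
  An adhesive category is amalgamable.

  Conversely, let \<open>f\<close>, \<open>g\<close> be a Mal'cev span in an amalgamable Barr-exact category. Factor
  \<open>f = m \<cdot> e\<close> and \<open>g = n \<cdot> d\<close> into regular epimorphisms followed by monomorphisms. The triple product
  of the Mal'cev span \<open>e\<close>, \<open>d\<close> with its outer projections is an equivalence relation, whose quotient
  is a pushout of \<open>e\<close> and \<open>d\<close>. Given a monomorphism \<open>m : I \<rightarrow> A\<close> and a regular epimorphism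
  \<open>q : I \<rightarrow> Q\<close> with kernel pair \<open>R\<close>, the pushout of \<open>R \<leftarrow> I \<rightarrow> A\<close> is an equivalence relation on \<open>A\<close>,
  whose quotient is a pushout of \<open>m\<close> and \<open>q\<close>, and the arrow from \<open>Q\<close> to it is monic. A pushout of
  \<open>f\<close> and \<open>g\<close> is pasted from one square of the first kind, two of the second kind, and an amalgam of
  two monomorphisms. Squares of the first two kinds are pullbacks and satisfy a condition that can be
  verified locally on generalized elements; this makes them stable.
\<close>

section \<open>Squares\<close>

text \<open>Stable coproducts are not at hand, so two arrows that jointly cover an object cannot be
  merged into one regular epimorphism. This is why every local argument runs over a pair
  \<open>k\<close>, \<open>l\<close>: stability of an amalgam turns its two legs into such a pair
  over any generalized element of its vertex. The main obstacle is stability, since being a pushout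
  quantifies over all cocones and says nothing about elements. In both kinds of quotient square, two
  elements identified by \<open>p\<close> are, locally, equal or joined by one single link, never by
  a longer zigzag. For the square of a Mal'cev span this holds because the Mal'cev operation
  contracts zigzags; for the square of a monomorphism \<open>m\<close> because two links meeting at
  an element pass through the same preimage under \<open>m\<close>. Diexactness speaks of all
  pushouts of a span, whereas amalgams and quotients construct a particular one; uniqueness up to
  isomorphism bridges the gap.\<close>

context category
begin

section \<open>Typing and reassociation of composites\<close>

lemma hom_iff: "f \<in> hom C a b \<longleftrightarrow> f \<in> Arr C \<and> Dom C f = a \<and> Cod C f = b"
  by (simp add: hom_def)

lemma homD: "f \<in> hom C a b \<Longrightarrow> f \<in> Arr C \<and> Dom C f = a \<and> Cod C f = b"
  by (simp add: hom_def)

lemma homI: "f \<in> Arr C \<Longrightarrow> f \<in> hom C (Dom C f) (Cod C f)"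
  by (simp add: hom_def)

lemma comp_typing [simp]:
  assumes "f \<in> Arr C" "g \<in> Arr C" "Dom C g = Cod C f"
  shows "g \<cdot> f \<in> Arr C" "Dom C (g \<cdot> f) = Dom C f" "Cod C (g \<cdot> f) = Cod C g"
  using Comp_hom[of f "Dom C f" "Cod C f" g "Cod C g"] assms by (auto simp: hom_iff)

lemma comp_assoc [simp]:
  assumes "f \<in> Arr C" "g \<in> Arr C" "h \<in> Arr C" "Dom C g = Cod C f" "Dom C h = Cod C g"
  shows "(h \<cdot> g) \<cdot> f = h \<cdot> (g \<cdot> f)"
  using Comp_assoc[of f "Dom C f" "Cod C f" g "Cod C g" h "Cod C h"] assms by (auto simp: hom_iff)

lemma ide_typing [simp]:
  assumes "a \<in> Obj C"
  shows "Ide C a \<in> Arr C" "Dom C (Ide C a) = a" "Cod C (Ide C a) = a"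
  using Ide_hom[OF assms] by (auto simp: hom_iff)

lemma obj_of_arr [simp]: "f \<in> Arr C \<Longrightarrow> Dom C f \<in> Obj C" "f \<in> Arr C \<Longrightarrow> Cod C f \<in> Obj C"
  by (rule Dom_Obj Cod_Obj, assumption)+

lemma hom_obj: "f \<in> hom C a b \<Longrightarrow> a \<in> Obj C \<and> b \<in> Obj C"
  by (auto simp: hom_iff)

lemma comp_ide [simp]:
  assumes "f \<in> Arr C"
  shows "Cod C f = b \<Longrightarrow> Ide C b \<cdot> f = f" "Dom C f = a \<Longrightarrow> f \<cdot> Ide C a = f"
  using Comp_Ide_left[of f a b] Comp_Ide_right[of f a b] assms
    Comp_Ide_left[OF homI] Comp_Ide_right[OF homI] by auto

lemma comp_hom: "g \<in> hom C b c \<Longrightarrow> f \<in> hom C a b \<Longrightarrow> g \<cdot> f \<in> hom C a c"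
  by (rule Comp_hom)

text \<open>The simplifier reassociates composites to the right, which hides
  \<open>g \<cdot> f\<close> inside \<open>g \<cdot> (f \<cdot> z)\<close>. Equations used under
  further composition are therefore supplied in this form as well.\<close>

lemma comp_extend:
  assumes "g \<cdot> f = k" "f \<in> Arr C" "g \<in> Arr C" "Dom C g = Cod C f" "z \<in> Arr C" "Cod C z = Dom C f"
  shows "g \<cdot> (f \<cdot> z) = k \<cdot> z"
  using assms comp_assoc[of z f g] by simp

lemma monicI:
  assumes "m \<in> hom C a b"
    and "\<And>X x y. x \<in> hom C X a \<Longrightarrow> y \<in> hom C X a \<Longrightarrow> m \<cdot> x = m \<cdot> y \<Longrightarrow> x = y"
  shows "monic C m"
  using assms unfolding monic_def by (auto simp: homD)

lemma monicD:
  assumes "monic C m" "m \<in> hom C a b" "x \<in> hom C X a" "y \<in> hom C X a" "m \<cdot> x = m \<cdot> y"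
  shows "x = y"
  using assms unfolding monic_def by (auto simp: homD)

lemma jointly_monicI:
  assumes "s \<in> hom C r a" "t \<in> hom C r b"
    and "\<And>X x y. x \<in> hom C X r \<Longrightarrow> y \<in> hom C X r \<Longrightarrow> s \<cdot> x = s \<cdot> y \<Longrightarrow> t \<cdot> x = t \<cdot> y \<Longrightarrow> x = y"
  shows "jointly_monic C s t"
  using assms unfolding jointly_monic_def span_def by (auto simp: homD)

lemma jointly_monicD:
  assumes "jointly_monic C s t" "s \<in> hom C r a" "x \<in> hom C X r" "y \<in> hom C X r"
    "s \<cdot> x = s \<cdot> y" "t \<cdot> x = t \<cdot> y"
  shows "x = y"
  using assms unfolding jointly_monic_def by (auto simp: homD)

lemma jointly_monicE:
  assumes "jointly_monic C s t"
  obtains r a b where "s \<in> hom C r a" "t \<in> hom C r b"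
  using assms unfolding jointly_monic_def span_def by (auto simp: hom_iff)

lemma monic_jointly_monic: "monic C m \<Longrightarrow> jointly_monic C m m"
  unfolding monic_def jointly_monic_def span_def by auto

section \<open>Pullbacks and pushouts through elements and cocones\<close>

lemma commuting_squareI:
  assumes "f \<in> hom C c a" "g \<in> hom C c b" "p \<in> hom C a d" "q \<in> hom C b d" "p \<cdot> f = q \<cdot> g"
  shows "commuting_square C f g p q"
  using assms unfolding commuting_square_def span_def by (auto simp: hom_iff)

lemma commuting_squareE:
  assumes "commuting_square C f g p q"
  obtains a b c d where "f \<in> hom C c a" "g \<in> hom C c b" "p \<in> hom C a d" "q \<in> hom C b d"
    "p \<cdot> f = q \<cdot> g"
  using assms unfolding commuting_square_def span_def by (auto simp: hom_iff)

lemma pullbackE: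
  assumes "is_pullback C f g p q"
  obtains a b c d where "f \<in> hom C c a" "g \<in> hom C c b" "p \<in> hom C a d" "q \<in> hom C b d"
    "p \<cdot> f = q \<cdot> g"
  using assms unfolding is_pullback_def by (auto elim: commuting_squareE)

lemma pullbackE_left:
  assumes "is_pullback C f g p q" "p \<in> hom C a d"
  obtains b c where "f \<in> hom C c a" "g \<in> hom C c b" "q \<in> hom C b d" "p \<cdot> f = q \<cdot> g"
  using assms unfolding is_pullback_def commuting_square_def span_def by (auto simp: hom_iff)

lemma pullbackE_cospan:
  assumes "is_pullback C f g p q" "p \<in> hom C a d" "q \<in> hom C b d"
  obtains c where "f \<in> hom C c a" "g \<in> hom C c b" "p \<cdot> f = q \<cdot> g"
  using assms unfolding is_pullback_def commuting_square_def span_def by (auto simp: hom_iff)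

lemma pullback_lift:
  assumes "is_pullback C f g p q" "f \<in> hom C c a" "g \<in> hom C c b"
    "x \<in> hom C X a" "y \<in> hom C X b" "p \<cdot> x = q \<cdot> y"
  obtains t where "t \<in> hom C X c" "f \<cdot> t = x" "g \<cdot> t = y"
proof -
  have "commuting_square C x y p q"
    using assms(1) assms(2-6) unfolding is_pullback_def
    by (auto simp: hom_iff commuting_square_def span_def)
  then have "\<exists>!t. t \<in> hom C (Dom C x) (Dom C f) \<and> f \<cdot> t = x \<and> g \<cdot> t = y"
    using assms unfolding is_pullback_def by blast
  then show ?thesis
    using assms that by (auto simp: homD)
qed

lemma pullback_jointly_monic: "is_pullback C f g p q \<Longrightarrow> jointly_monic C f g"
proof -
  assume pb: "is_pullback C f g p q"
  obtain a b c d where H: "f \<in> hom C c a" "g \<in> hom C c b" "p \<in> hom C a d" "q \<in> hom C b d"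
    and e: "p \<cdot> f = q \<cdot> g"
    using pb by (rule pullbackE)
  note [simp] = H[THEN homD]
  show ?thesis
  proof (rule jointly_monicI[OF H(1,2)])
    fix X x y
    assume K: "x \<in> hom C X c" "y \<in> hom C X c" and "f \<cdot> x = f \<cdot> y" "g \<cdot> x = g \<cdot> y"
    note [simp] = K[THEN homD]
    have "commuting_square C (f \<cdot> x) (g \<cdot> x) p q"
      by (rule commuting_squareI[where c = X]) (auto simp: hom_iff comp_extend[OF e])
    then have "\<exists>!t. t \<in> hom C (Dom C (f \<cdot> x)) (Dom C f) \<and> f \<cdot> t = f \<cdot> x \<and> g \<cdot> t = g \<cdot> x"
      using pb unfolding is_pullback_def by blast
    then have "\<exists>!t. t \<in> hom C X c \<and> f \<cdot> t = f \<cdot> x \<and> g \<cdot> t = g \<cdot> x"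
      by simp
    then show "x = y"
      using K \<open>f \<cdot> x = f \<cdot> y\<close> \<open>g \<cdot> x = g \<cdot> y\<close> by metis
  qed
qed

text \<open>Uniqueness of the comparison arrow is split off as joint monicity of the span, which
  mentions no cone. For a span already known to be jointly monic only the lifting remains.\<close>

lemma pullbackI:
  assumes H: "f \<in> hom C c a" "g \<in> hom C c b" "p \<in> hom C a d" "q \<in> hom C b d"
    and e: "p \<cdot> f = q \<cdot> g"
    and mono: "jointly_monic C f g"
    and lift: "\<And>X x y. x \<in> hom C X a \<Longrightarrow> y \<in> hom C X b \<Longrightarrow> p \<cdot> x = q \<cdot> y \<Longrightarrow>
      \<exists>t \<in> hom C X c. f \<cdot> t = x \<and> g \<cdot> t = y"
  shows "is_pullback C f g p q"
  unfolding is_pullback_def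
proof (intro conjI allI impI)
  show "commuting_square C f g p q"
    using H e by (rule commuting_squareI)
  note [simp] = H[THEN homD]
  fix x y assume "commuting_square C x y p q"
  then obtain X where xy: "x \<in> hom C X a" "y \<in> hom C X b" "p \<cdot> x = q \<cdot> y"
    by (rule commuting_squareE) (auto simp: hom_iff)
  obtain t where t: "t \<in> hom C X c" "f \<cdot> t = x" "g \<cdot> t = y"
    using lift[OF xy] by auto
  show "\<exists>!t. t \<in> hom C (Dom C x) (Dom C f) \<and> f \<cdot> t = x \<and> g \<cdot> t = y"
  proof (rule ex1I[of _ t])
    show "t \<in> hom C (Dom C x) (Dom C f) \<and> f \<cdot> t = x \<and> g \<cdot> t = y"
      using t xy by (simp add: hom_iff)
    fix u assume u: "u \<in> hom C (Dom C x) (Dom C f) \<and> f \<cdot> u = x \<and> g \<cdot> u = y"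
    then show "u = t"
      using jointly_monicD[OF mono H(1), of u X t] t xy by (simp add: hom_iff)
  qed
qed

lemma pushoutE:
  assumes "is_pushout C f g p q"
  obtains a b c d where "f \<in> hom C c a" "g \<in> hom C c b" "p \<in> hom C a d" "q \<in> hom C b d"
    "p \<cdot> f = q \<cdot> g"
  using assms unfolding is_pushout_def by (auto elim: commuting_squareE)

lemma pushoutE_span:
  assumes "is_pushout C f g p q" "f \<in> hom C c a" "g \<in> hom C c b"
  obtains d where "p \<in> hom C a d" "q \<in> hom C b d" "p \<cdot> f = q \<cdot> g"
  using assms unfolding is_pushout_def commuting_square_def span_def by (auto simp: hom_iff)

lemma pushout_desc:
  assumes "is_pushout C f g p q" "p \<in> hom C a d" "q \<in> hom C b d"
    "x \<in> hom C a X" "y \<in> hom C b X" "x \<cdot> f = y \<cdot> g"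
  obtains t where "t \<in> hom C d X" "t \<cdot> p = x" "t \<cdot> q = y"
proof -
  have "commuting_square C f g x y"
    using assms(1) assms(2-6) unfolding is_pushout_def
    by (auto simp: hom_iff commuting_square_def span_def)
  then have "\<exists>!t. t \<in> hom C (Cod C p) (Cod C x) \<and> t \<cdot> p = x \<and> t \<cdot> q = y"
    using assms unfolding is_pushout_def by blast
  then show ?thesis
    using assms that by (auto simp: homD)
qed

lemma pushout_eq:
  assumes po: "is_pushout C f g p q" and pH: "p \<in> hom C a d"
    and K: "x \<in> hom C d X" "y \<in> hom C d X"
    and xy: "x \<cdot> p = y \<cdot> p" "x \<cdot> q = y \<cdot> q"
  shows "x = y"
proof -
  obtain b c where H: "f \<in> hom C c a" "g \<in> hom C c b" "q \<in> hom C b d" and e: "p \<cdot> f = q \<cdot> g"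
    using po by (rule pushoutE) (use pH in \<open>auto simp: hom_iff\<close>)
  note [simp] = H[THEN homD] K[THEN homD] pH[THEN homD]
  have "commuting_square C f g (x \<cdot> p) (x \<cdot> q)"
    by (rule commuting_squareI[where c = c]) (auto simp: hom_iff e)
  then have "\<exists>!t. t \<in> hom C (Cod C p) (Cod C (x \<cdot> p)) \<and> t \<cdot> p = x \<cdot> p \<and> t \<cdot> q = x \<cdot> q"
    using po unfolding is_pushout_def by blast
  then have "\<exists>!t. t \<in> hom C d X \<and> t \<cdot> p = x \<cdot> p \<and> t \<cdot> q = x \<cdot> q"
    by simp
  then show "x = y"
    using K xy by metis
qed

lemma pushoutI:
  assumes H: "f \<in> hom C c a" "g \<in> hom C c b" "p \<in> hom C a d" "q \<in> hom C b d"
    and e: "p \<cdot> f = q \<cdot> g"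
    and epi: "\<And>X x y. x \<in> hom C d X \<Longrightarrow> y \<in> hom C d X \<Longrightarrow> x \<cdot> p = y \<cdot> p \<Longrightarrow> x \<cdot> q = y \<cdot> q \<Longrightarrow> x = y"
    and desc: "\<And>X x y. x \<in> hom C a X \<Longrightarrow> y \<in> hom C b X \<Longrightarrow> x \<cdot> f = y \<cdot> g \<Longrightarrow>
      \<exists>t \<in> hom C d X. t \<cdot> p = x \<and> t \<cdot> q = y"
  shows "is_pushout C f g p q"
  unfolding is_pushout_def
proof (intro conjI allI impI)
  show "commuting_square C f g p q"
    using H e by (rule commuting_squareI)
  note [simp] = H[THEN homD]
  fix x y assume "commuting_square C f g x y"
  then obtain X where xy: "x \<in> hom C a X" "y \<in> hom C b X" "x \<cdot> f = y \<cdot> g"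
    by (rule commuting_squareE) (auto simp: hom_iff)
  obtain t where t: "t \<in> hom C d X" "t \<cdot> p = x" "t \<cdot> q = y"
    using desc[OF xy] by auto
  show "\<exists>!t. t \<in> hom C (Cod C p) (Cod C x) \<and> t \<cdot> p = x \<and> t \<cdot> q = y"
  proof (rule ex1I[of _ t])
    show "t \<in> hom C (Cod C p) (Cod C x) \<and> t \<cdot> p = x \<and> t \<cdot> q = y"
      using t xy by (simp add: hom_iff)
    fix u assume u: "u \<in> hom C (Cod C p) (Cod C x) \<and> u \<cdot> p = x \<and> u \<cdot> q = y"
    then show "u = t"
      using epi[of u X t] t xy by (simp add: hom_iff)
  qed
qed

lemma commuting_square_sym: "commuting_square C f g p q \<longleftrightarrow> commuting_square C g f q p"
  unfolding commuting_square_def span_def by auto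

lemma pullback_sym: "is_pullback C f g p q \<Longrightarrow> is_pullback C g f q p"
  unfolding is_pullback_def
  by (smt (verit, ccfv_threshold) commuting_square_sym commuting_square_def span_def)

lemma pushout_sym: "is_pushout C f g p q \<Longrightarrow> is_pushout C g f q p"
  unfolding is_pushout_def
  by (smt (verit, ccfv_threshold) commuting_square_sym commuting_square_def span_def)

lemma stable_pushoutD: "stable_pushout C f g p q \<Longrightarrow> is_pushout C f g p q"
  unfolding stable_pushout_def by simp

lemma stable_pushout_sym:
  assumes "stable_pushout C f g p q"
  shows "stable_pushout C g f q p"
proof -
  have po: "is_pushout C f g p q" using assms by (rule stable_pushoutD)
  then have e: "p \<cdot> f = q \<cdot> g" by (rule pushoutE) 
  show ?thesis
    unfolding stable_pushout_def
  proof (intro conjI allI impI)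
    show "is_pushout C g f q p" using po by (rule pushout_sym)
    fix h a b c p' q' r f' g'
    assume *: "is_pullback C a p' q h \<and> is_pullback C b q' p h \<and> is_pullback C c r (q \<cdot> g) h \<and>
      f' \<in> hom C (Dom C c) (Dom C a) \<and> a \<cdot> f' = g \<cdot> c \<and> p' \<cdot> f' = r \<and>
      g' \<in> hom C (Dom C c) (Dom C b) \<and> b \<cdot> g' = f \<cdot> c \<and> q' \<cdot> g' = r"
    have "is_pushout C g' f' q' p'"
      using assms[unfolded stable_pushout_def, THEN conjunct2, rule_format, of b q' h a p' c r g' f'] * e
      by simp
    then show "is_pushout C f' g' p' q'" by (rule pushout_sym)
  qed
qed

section \<open>Pasting and cancellation of squares\<close>

lemma pullback_paste:
  assumes pb1: "is_pullback C f g p q" and pb2: "is_pullback C k p p2 q2"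
  shows "is_pullback C (k \<cdot> f) g p2 (q2 \<cdot> q)"
proof -
  obtain a b c d where H: "f \<in> hom C c a" "g \<in> hom C c b" "p \<in> hom C a d" "q \<in> hom C b d"
    and e: "p \<cdot> f = q \<cdot> g"
    using pb1 by (rule pullbackE)
  obtain a2 d2 where K: "k \<in> hom C a a2" "p2 \<in> hom C a2 d2" "q2 \<in> hom C d d2"
    and e2: "p2 \<cdot> k = q2 \<cdot> p"
    using pb2 H by (auto elim!: pullbackE simp: hom_iff)
  note [simp] = H[THEN homD] K[THEN homD]
  note E = e e2 comp_extend[OF e] comp_extend[OF e2]
  show ?thesis
  proof (rule pullbackI)
    show "p2 \<cdot> (k \<cdot> f) = q2 \<cdot> q \<cdot> g" by (simp add: E)
    show "jointly_monic C (k \<cdot> f) g"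
    proof (rule jointly_monicI[of _ c a2 _ b])
      fix X x y
      assume xy: "x \<in> hom C X c" "y \<in> hom C X c" and e3: "k \<cdot> f \<cdot> x = k \<cdot> f \<cdot> y" "g \<cdot> x = g \<cdot> y"
      note [simp] = xy[THEN homD]
      have "p \<cdot> (f \<cdot> x) = p \<cdot> (f \<cdot> y)" using e3 by (simp add: E)
      then have "f \<cdot> x = f \<cdot> y"
        using e3 by (auto simp: hom_iff
            intro!: jointly_monicD[OF pullback_jointly_monic[OF pb2] K(1), of "f \<cdot> x" X "f \<cdot> y"])
      then show "x = y"
        using jointly_monicD[OF pullback_jointly_monic[OF pb1] H(1) xy] e3 by blast
    qed (auto simp: hom_iff)
    fix X x y
    assume xy: "x \<in> hom C X a2" "y \<in> hom C X b" and e3: "p2 \<cdot> x = q2 \<cdot> q \<cdot> y"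
    note [simp] = xy[THEN homD]
    obtain u where u: "u \<in> hom C X a" "k \<cdot> u = x" "p \<cdot> u = q \<cdot> y"
      by (rule pullback_lift[OF pb2 K(1) H(3) xy(1), of "q \<cdot> y"]) (use e3 in \<open>auto simp: hom_iff\<close>)
    obtain t where t: "t \<in> hom C X c" "f \<cdot> t = u" "g \<cdot> t = y"
      by (rule pullback_lift[OF pb1 H(1,2) u(1) xy(2) u(3)])
    show "\<exists>t \<in> hom C X c. k \<cdot> f \<cdot> t = x \<and> g \<cdot> t = y"
      using t u by (intro bexI[of _ t]) (auto simp: hom_iff)
  qed (auto simp: hom_iff)
qed

text \<open>This cuts a pulled-back rectangle: once \<open>q2\<close> and the composite
  \<open>q2 \<cdot> p\<close> are pulled back along \<open>h\<close>, the pullback of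
  \<open>p\<close> along \<open>d\<close> is already present. It recognises the faces of the smaller
  cubes in \<open>stable_paste\<close>.\<close>

lemma pullback_cancel:
  assumes pb1: "is_pullback C a (s \<cdot> u) (q2 \<cdot> p) h" and pb2: "is_pullback C d s q2 h"
    and pH: "p \<in> hom C A D" "Dom C q2 = D" "a \<in> hom C A' A"
    and uH: "u \<in> hom C A' (Dom C s)" and e: "d \<cdot> u = p \<cdot> a"
  shows "is_pullback C a u p d"
proof -
  obtain D' D2 X where H: "d \<in> hom C D' D" "s \<in> hom C D' X" "q2 \<in> hom C D D2" "h \<in> hom C X D2"
    and e2: "q2 \<cdot> d = h \<cdot> s"
    using pb2 pH(2) by (auto elim!: pullbackE simp: hom_iff)
  have uH': "u \<in> hom C A' D'" using uH H by (simp add: hom_iff)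
  note [simp] = H[THEN homD] pH(1,3)[THEN homD] uH'[THEN homD]
  note E = e e2 comp_extend[OF e] comp_extend[OF e2]
  show ?thesis
  proof (rule pullbackI)
    show "p \<cdot> a = d \<cdot> u" by (simp add: E)
    show "jointly_monic C a u"
    proof (rule jointly_monicI[of _ A' A _ D'])
      fix Y x y
      assume xy: "x \<in> hom C Y A'" "y \<in> hom C Y A'" and e3: "a \<cdot> x = a \<cdot> y" "u \<cdot> x = u \<cdot> y"
      note [simp] = xy[THEN homD]
      show "x = y"
        by (rule jointly_monicD[OF pullback_jointly_monic[OF pb1] pH(3) xy])
          (use e3 in \<open>auto simp: hom_iff\<close>)
    qed (auto simp: hom_iff)
    fix Y x y
    assume xy: "x \<in> hom C Y A" "y \<in> hom C Y D'" and e3: "p \<cdot> x = d \<cdot> y"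
    note [simp] = xy[THEN homD]
    have "s \<cdot> u \<in> hom C A' X" by (simp add: hom_iff)
    then obtain t where t: "t \<in> hom C Y A'" "a \<cdot> t = x" "s \<cdot> u \<cdot> t = s \<cdot> y"
      by (rule pullback_lift[OF pb1 pH(3) _ xy(1), of _ "s \<cdot> y"])
        (use e3 in \<open>auto simp: hom_iff E\<close>)
    note [simp] = t(1)[THEN homD]
    have "u \<cdot> t = y"
    proof (rule jointly_monicD[OF pullback_jointly_monic[OF pb2] H(1), of _ Y])
      show "d \<cdot> (u \<cdot> t) = d \<cdot> y" using t e3 by (simp add: E)
    qed (use t in \<open>auto simp: hom_iff\<close>)
    then show "\<exists>t \<in> hom C Y A'. a \<cdot> t = x \<and> u \<cdot> t = y"
      using t by blast
  qed (auto simp: hom_iff)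
qed

text \<open>The gluing has the shape of \<open>pullback_paste\<close>, so that one grid of squares
  yields both properties of its outer square.\<close>

lemma pushout_paste:
  assumes po1: "is_pushout C f g p q" and po2: "is_pushout C k p p2 q2"
  shows "is_pushout C (k \<cdot> f) g p2 (q2 \<cdot> q)"
proof -
  obtain a b c d where H: "f \<in> hom C c a" "g \<in> hom C c b" "p \<in> hom C a d" "q \<in> hom C b d"
    and e: "p \<cdot> f = q \<cdot> g"
    using po1 by (rule pushoutE)
  obtain a2 d2 where K: "k \<in> hom C a a2" "p2 \<in> hom C a2 d2" "q2 \<in> hom C d d2"
    and e2: "p2 \<cdot> k = q2 \<cdot> p"
    using po2 H by (auto elim!: pushoutE simp: hom_iff)
  note [simp] = H[THEN homD] K[THEN homD]
  note E = e e2 comp_extend[OF e] comp_extend[OF e2]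
  show ?thesis
  proof (rule pushoutI)
    show "p2 \<cdot> (k \<cdot> f) = q2 \<cdot> q \<cdot> g" by (simp add: E)
    fix X x y
    assume xy: "x \<in> hom C d2 X" "y \<in> hom C d2 X" and e3: "x \<cdot> p2 = y \<cdot> p2" "x \<cdot> (q2 \<cdot> q) = y \<cdot> (q2 \<cdot> q)"
    note [simp] = xy[THEN homD]
    have "x \<cdot> q2 \<cdot> p = y \<cdot> q2 \<cdot> p"
      using e2 comp_extend[OF e3(1), of k] by simp
    then have "x \<cdot> q2 = y \<cdot> q2"
      using e3 by (auto simp: hom_iff intro!: pushout_eq[OF po1 H(3), of "x \<cdot> q2" X "y \<cdot> q2"])
    then show "x = y"
      using pushout_eq[OF po2 K(2) xy] e3 by blast
  next
    fix X x y
    assume xy: "x \<in> hom C a2 X" "y \<in> hom C b X" and e3: "x \<cdot> (k \<cdot> f) = y \<cdot> g"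
    note [simp] = xy[THEN homD]
    obtain u where u: "u \<in> hom C d X" "u \<cdot> p = x \<cdot> k" "u \<cdot> q = y"
      by (rule pushout_desc[OF po1 H(3,4) _ xy(2), of "x \<cdot> k"]) (use e3 in \<open>auto simp: hom_iff\<close>)
    obtain t where t: "t \<in> hom C d2 X" "t \<cdot> p2 = x" "t \<cdot> q2 = u"
      by (rule pushout_desc[OF po2 K(2,3) xy(1) u(1) u(2)[symmetric]])
    show "\<exists>t \<in> hom C d2 X. t \<cdot> p2 = x \<and> t \<cdot> (q2 \<cdot> q) = y"
      using t u by (intro bexI[of _ t]) (auto simp: hom_iff comp_extend[OF t(3)])
  qed (auto simp: hom_iff)
qed

text \<open>The hypotheses describe the cube occurring in \<^const>\<open>stable_pushout\<close>.\<close>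

lemma pullback_cube:
  assumes pb: "is_pullback C f g p q"
    and a: "is_pullback C a p' p h" and b: "is_pullback C b q' q h"
    and c: "is_pullback C c r (p \<cdot> f) h"
    and f': "f' \<in> hom C (Dom C c) (Dom C a)" "a \<cdot> f' = f \<cdot> c" "p' \<cdot> f' = r"
    and g': "g' \<in> hom C (Dom C c) (Dom C b)" "b \<cdot> g' = g \<cdot> c" "q' \<cdot> g' = r"
  shows "is_pullback C f' g' p' q'"
proof -
  obtain X0 A B D where H: "f \<in> hom C X0 A" "g \<in> hom C X0 B" "p \<in> hom C A D" "q \<in> hom C B D"
    and e: "p \<cdot> f = q \<cdot> g"
    using pb by (rule pullbackE)
  obtain A' X where Ha: "a \<in> hom C A' A" "p' \<in> hom C A' X" "h \<in> hom C X D" and ea: "p \<cdot> a = h \<cdot> p'"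
    using a H(3) by (rule pullbackE_left)
  obtain B' where Hb: "b \<in> hom C B' B" "q' \<in> hom C B' X" and eb: "q \<cdot> b = h \<cdot> q'"
    using b H(4) Ha(3) by (rule pullbackE_cospan)
  obtain X0' where Hc: "c \<in> hom C X0' X0" "r \<in> hom C X0' X" and ec: "p \<cdot> f \<cdot> c = h \<cdot> r"
    using c comp_hom[OF H(3,1)] Ha(3) by (rule pullbackE_cospan)
  have K: "f' \<in> hom C X0' A'" "g' \<in> hom C X0' B'"
    using f' g' Ha Hb Hc by (auto simp: hom_iff)
  note [simp] = H[THEN homD] Ha[THEN homD] Hb[THEN homD] Hc[THEN homD] K[THEN homD]
  note E = e ea eb comp_extend[OF e] comp_extend[OF ea] comp_extend[OF eb]
  note F = f'(2,3) g'(2,3) comp_extend[OF f'(2)] comp_extend[OF f'(3)] comp_extend[OF g'(2)]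
    comp_extend[OF g'(3)]
  show ?thesis
  proof (rule pullbackI[OF K Ha(2) Hb(2)])
    show "p' \<cdot> f' = q' \<cdot> g'" by (simp add: F)
    show "jointly_monic C f' g'"
    proof (rule jointly_monicI[OF K])
      fix Y x y
      assume xy: "x \<in> hom C Y X0'" "y \<in> hom C Y X0'" and e3: "f' \<cdot> x = f' \<cdot> y" "g' \<cdot> x = g' \<cdot> y"
      note [simp] = xy[THEN homD]
      have "f \<cdot> (c \<cdot> x) = a \<cdot> (f' \<cdot> x)" "f \<cdot> (c \<cdot> y) = a \<cdot> (f' \<cdot> y)"
        "g \<cdot> (c \<cdot> x) = b \<cdot> (g' \<cdot> x)" "g \<cdot> (c \<cdot> y) = b \<cdot> (g' \<cdot> y)"
        "r \<cdot> x = p' \<cdot> (f' \<cdot> x)" "r \<cdot> y = p' \<cdot> (f' \<cdot> y)"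
        by (simp_all add: F)
      then have e4: "f \<cdot> (c \<cdot> x) = f \<cdot> (c \<cdot> y)" "g \<cdot> (c \<cdot> x) = g \<cdot> (c \<cdot> y)" "r \<cdot> x = r \<cdot> y"
        using e3 by simp_all
      have "c \<cdot> x = c \<cdot> y"
        by (rule jointly_monicD[OF pullback_jointly_monic[OF pb] H(1), of _ Y])
          (use e4 in \<open>auto simp: hom_iff\<close>)
      then show "x = y"
        using jointly_monicD[OF pullback_jointly_monic[OF c] Hc(1) xy] e4 by blast
    qed
    fix Y x y
    assume xy: "x \<in> hom C Y A'" "y \<in> hom C Y B'" and e3: "p' \<cdot> x = q' \<cdot> y"
    note [simp] = xy[THEN homD]
    obtain z where z: "z \<in> hom C Y X0" "f \<cdot> z = a \<cdot> x" "g \<cdot> z = b \<cdot> y"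
      by (rule pullback_lift[OF pb H(1,2), of "a \<cdot> x" Y "b \<cdot> y"])
        (use e3 in \<open>auto simp: hom_iff E\<close>)
    note [simp] = z(1)[THEN homD]
    obtain w where w: "w \<in> hom C Y X0'" "c \<cdot> w = z" "r \<cdot> w = p' \<cdot> x"
    proof (rule pullback_lift[OF c Hc z(1), of "p' \<cdot> x"])
      have "p \<cdot> f \<cdot> z = p \<cdot> (f \<cdot> z)" by simp
      also have "\<dots> = h \<cdot> (p' \<cdot> x)" unfolding z(2) by (simp add: E)
      finally show "p \<cdot> f \<cdot> z = h \<cdot> (p' \<cdot> x)" .
    qed (auto simp: hom_iff)
    note [simp] = w(1)[THEN homD]
    have "f' \<cdot> w = x"
      by (rule jointly_monicD[OF pullback_jointly_monic[OF a] Ha(1), of _ Y])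
        (auto simp: hom_iff F w z)
    moreover have "g' \<cdot> w = y"
      by (rule jointly_monicD[OF pullback_jointly_monic[OF b] Hb(1), of _ Y])
        (auto simp: hom_iff F w z e3)
    ultimately show "\<exists>t \<in> hom C Y X0'. f' \<cdot> t = x \<and> g' \<cdot> t = y"
      using w by blast
  qed
qed

end

text \<open>Finite limits enter the argument through pullbacks:
  \<open>finitely_complete_pullback\<close> obtains them as limits of cospans, and triple products
  are built from two of them.\<close>

locale pullback_category = category +
  assumes pullback_ex: "p \<in> hom C a d \<Longrightarrow> q \<in> hom C b d \<Longrightarrow> \<exists>f g. is_pullback C f g p q"
begin

lemma obtain_pullback:
  assumes "p \<in> hom C a d" "q \<in> hom C b d"
  obtains f g c where "is_pullback C f g p q" "f \<in> hom C c a" "g \<in> hom C c b" "p \<cdot> f = q \<cdot> g"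
proof -
  obtain f g where pb: "is_pullback C f g p q" using pullback_ex[OF assms] by blast
  show ?thesis by (rule pullbackE_cospan[OF pb assms]) (rule that[OF pb])
qed

text \<open>Pulling back the objects \<open>A\<close> and \<open>D\<close> of the shared edge
  \<open>p\<close> cuts the pulled-back rectangle in two. The second part is its square pulled back
  along \<open>h\<close>; the first is its square pulled back along the projection \<open>d\<close>
  to \<open>D\<close>, as \<open>pullback_cancel\<close> shows. Both are pushouts by stability and
  can be pasted.\<close>

lemma stable_paste:
  assumes st1: "stable_pushout C f g p q" and st2: "stable_pushout C k p p2 q2"
  shows "stable_pushout C (k \<cdot> f) g p2 (q2 \<cdot> q)"
  unfolding stable_pushout_def
proof (intro conjI allI impI)
  note po1 = stable_pushoutD[OF st1] and po2 = stable_pushoutD[OF st2]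
  show "is_pushout C (k \<cdot> f) g p2 (q2 \<cdot> q)" using po1 po2 by (rule pushout_paste)
  obtain A B X0 D where H: "f \<in> hom C X0 A" "g \<in> hom C X0 B" "p \<in> hom C A D" "q \<in> hom C B D"
    and e: "p \<cdot> f = q \<cdot> g"
    using po1 by (rule pushoutE)
  obtain A2 where k: "k \<in> hom C A A2"
    using po2 H(3) unfolding is_pushout_def commuting_square_def span_def by (auto simp: hom_iff)
  obtain D2 where K: "p2 \<in> hom C A2 D2" "q2 \<in> hom C D D2" and e2: "p2 \<cdot> k = q2 \<cdot> p"
    using po2 k H(3) by (rule pushoutE_span)
  note [simp] = H[THEN homD] k[THEN homD] K[THEN homD]
  fix h a b c p' q' r f' g'
  assume "is_pullback C a p' p2 h \<and> is_pullback C b q' (q2 \<cdot> q) h \<and>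
      is_pullback C c r (p2 \<cdot> (k \<cdot> f)) h \<and>
      f' \<in> hom C (Dom C c) (Dom C a) \<and> a \<cdot> f' = k \<cdot> f \<cdot> c \<and> p' \<cdot> f' = r \<and>
      g' \<in> hom C (Dom C c) (Dom C b) \<and> b \<cdot> g' = g \<cdot> c \<and> q' \<cdot> g' = r"
  then have a: "is_pullback C a p' p2 h" and b: "is_pullback C b q' (q2 \<cdot> q) h"
    and c: "is_pullback C c r (p2 \<cdot> (k \<cdot> f)) h"
    and f': "f' \<in> hom C (Dom C c) (Dom C a)" "a \<cdot> f' = k \<cdot> f \<cdot> c" "p' \<cdot> f' = r"
    and g': "g' \<in> hom C (Dom C c) (Dom C b)" "b \<cdot> g' = g \<cdot> c" "q' \<cdot> g' = r"
    by blast+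
  obtain A2' X where Ha: "a \<in> hom C A2' A2" "p' \<in> hom C A2' X" "h \<in> hom C X D2"
    and ea: "p2 \<cdot> a = h \<cdot> p'"
    using a K(1) by (rule pullbackE_left)
  obtain B' where Hb: "b \<in> hom C B' B" "q' \<in> hom C B' X" and eb: "q2 \<cdot> q \<cdot> b = h \<cdot> q'"
    using b comp_hom[OF K(2) H(4)] Ha(3) by (rule pullbackE_cospan)
  obtain X0' where Hc: "c \<in> hom C X0' X0" "r \<in> hom C X0' X" and ec: "p2 \<cdot> (k \<cdot> f) \<cdot> c = h \<cdot> r"
    using c comp_hom[OF K(1) comp_hom[OF k H(1)]] Ha(3) by (rule pullbackE_cospan)
  have F: "f' \<in> hom C X0' A2'" "g' \<in> hom C X0' B'"
    using f' g' Ha Hb Hc by (auto simp: hom_iff)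
  obtain a1 r1 A' where pa1: "is_pullback C a1 r1 (p2 \<cdot> k) h"
    and H1: "a1 \<in> hom C A' A" "r1 \<in> hom C A' X" and e1: "p2 \<cdot> k \<cdot> a1 = h \<cdot> r1"
    by (rule obtain_pullback[OF comp_hom[OF K(1) k] Ha(3)])
  obtain d s D' where pd: "is_pullback C d s q2 h"
    and H2: "d \<in> hom C D' D" "s \<in> hom C D' X" and ed: "q2 \<cdot> d = h \<cdot> s"
    by (rule obtain_pullback[OF K(2) Ha(3)])
  note [simp] = Ha[THEN homD] Hb[THEN homD] Hc[THEN homD] F[THEN homD] H1[THEN homD] H2[THEN homD]
  have E: "p2 \<cdot> (k \<cdot> a1) = h \<cdot> r1" "p2 \<cdot> (k \<cdot> (f \<cdot> c)) = h \<cdot> r" "q2 \<cdot> (q \<cdot> b) = h \<cdot> q'"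
    using e1 eb ec by simp_all
  have E2: "q2 \<cdot> (p \<cdot> a1) = h \<cdot> r1"
    using E(1) comp_extend[OF e2, of a1] by simp
  obtain f1 where f1: "f1 \<in> hom C X0' A'" "a1 \<cdot> f1 = f \<cdot> c" "r1 \<cdot> f1 = r"
    by (rule pullback_lift[OF pa1 H1, of "f \<cdot> c" X0' r]) (auto simp: hom_iff E)
  obtain k' where k': "k' \<in> hom C A' A2'" "a \<cdot> k' = k \<cdot> a1" "p' \<cdot> k' = r1"
    by (rule pullback_lift[OF a Ha(1,2), of "k \<cdot> a1" A' r1]) (auto simp: hom_iff E)
  obtain p1 where p1: "p1 \<in> hom C A' D'" "d \<cdot> p1 = p \<cdot> a1" "s \<cdot> p1 = r1"
    by (rule pullback_lift[OF pd H2, of "p \<cdot> a1" A' r1]) (auto simp: hom_iff E2)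
  obtain q1 where q1: "q1 \<in> hom C B' D'" "d \<cdot> q1 = q \<cdot> b" "s \<cdot> q1 = q'"
    by (rule pullback_lift[OF pd H2, of "q \<cdot> b" B' q']) (auto simp: hom_iff E)
  note [simp] = f1(1)[THEN homD] k'(1)[THEN homD] p1(1)[THEN homD] q1(1)[THEN homD]
  note Fs = f'(2,3) g'(2,3) f1(2,3) k'(2,3) p1(2,3) q1(2,3)
  note Fs2 = Fs[THEN comp_extend]
  have kf: "k' \<cdot> f1 = f'"
    by (rule jointly_monicD[OF pullback_jointly_monic[OF a] Ha(1), of _ X0'])
      (auto simp: hom_iff Fs Fs2)
  have pf: "p1 \<cdot> f1 = q1 \<cdot> g'"
  proof (rule jointly_monicD[OF pullback_jointly_monic[OF pd] H2(1), of _ X0'])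
    have "d \<cdot> (p1 \<cdot> f1) = p \<cdot> (f \<cdot> c)" by (simp add: Fs Fs2)
    also have "\<dots> = q \<cdot> (g \<cdot> c)" using comp_extend[OF e, of c] by simp
    also have "\<dots> = d \<cdot> (q1 \<cdot> g')" by (simp add: Fs Fs2)
    finally show "d \<cdot> (p1 \<cdot> f1) = d \<cdot> (q1 \<cdot> g')" .
  qed (auto simp: hom_iff Fs Fs2)
  have "is_pushout C f1 g' p1 q1"
  proof (rule st1[unfolded stable_pushout_def, THEN conjunct2, rule_format, of a1 p1 d b q1 c "p1 \<cdot> f1"],
      intro conjI)
    show "is_pullback C a1 p1 p d"
      by (rule pullback_cancel[OF _ pd H(3) _ H1(1)]) (use pa1 in \<open>auto simp: hom_iff Fs e2\<close>)
    show "is_pullback C b q1 q d"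
      by (rule pullback_cancel[OF _ pd H(4) _ Hb(1)]) (use b in \<open>auto simp: hom_iff Fs\<close>)
    show "is_pullback C c (p1 \<cdot> f1) (p \<cdot> f) d"
    proof (rule pullback_cancel[OF _ pd _ _ Hc(1)])
      have "q2 \<cdot> (p \<cdot> f) = p2 \<cdot> (k \<cdot> f)" using comp_extend[OF e2, of f] by simp
      moreover have "s \<cdot> (p1 \<cdot> f1) = r" by (simp add: Fs Fs2)
      ultimately show "is_pullback C c (s \<cdot> (p1 \<cdot> f1)) (q2 \<cdot> (p \<cdot> f)) h" using c by simp
    qed (auto simp: hom_iff Fs Fs2)
  qed (auto simp: hom_iff Fs pf)
  moreover have "is_pushout C k' p1 p' s"
    by (rule st2[unfolded stable_pushout_def, THEN conjunct2, rule_format, of a p' h d s a1 r1])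
      (use a pd pa1 in \<open>auto simp: hom_iff Fs\<close>)
  ultimately have "is_pushout C (k' \<cdot> f1) g' p' (s \<cdot> q1)" by (rule pushout_paste)
  then show "is_pushout C f' g' p' q'" by (simp add: kf Fs)
qed

end

section \<open>Coequalizers and covers\<close>

context category
begin

section \<open>Coequalizers and regular epimorphisms\<close>

lemma coequalizerE:
  assumes "is_coequalizer C u v e"
  obtains r a d where "u \<in> hom C r a" "v \<in> hom C r a" "e \<in> hom C a d" "e \<cdot> u = e \<cdot> v"
  using assms unfolding is_coequalizer_def span_def by (auto simp: hom_iff)

lemma coequalizerE_dom:
  assumes "is_coequalizer C u v e" "e \<in> hom C a d"
  obtains r where "u \<in> hom C r a" "v \<in> hom C r a" "e \<cdot> u = e \<cdot> v"
  using assms unfolding is_coequalizer_def span_def by (auto simp: hom_iff)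

lemma coequalizer_desc:
  assumes "is_coequalizer C u v e" "e \<in> hom C a d" "x \<in> hom C a X" "x \<cdot> u = x \<cdot> v"
  obtains t where "t \<in> hom C d X" "t \<cdot> e = x"
proof -
  note [simp] = assms(2,3)[THEN homD]
  have "Dom C x = Cod C u"
    using assms(1) unfolding is_coequalizer_def by simp
  then have "\<exists>!t. t \<in> hom C (Cod C e) (Cod C x) \<and> t \<cdot> e = x"
    using assms(1,3,4)[unfolded is_coequalizer_def] homD[OF assms(3)] by blast
  then show ?thesis
    using that by auto
qed

lemma coequalizer_epi:
  assumes co: "is_coequalizer C u v e" and e: "e \<in> hom C a d"
    and xy: "x \<in> hom C d X" "y \<in> hom C d X" "x \<cdot> e = y \<cdot> e"
  shows "x = y"
proof -
  obtain r where uv: "u \<in> hom C r a" "v \<in> hom C r a" "e \<cdot> u = e \<cdot> v"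
    using co e by (rule coequalizerE_dom)
  note [simp] = uv(1,2)[THEN homD] xy(1,2)[THEN homD] e[THEN homD]
  have "\<exists>!t. t \<in> hom C (Cod C e) (Cod C (x \<cdot> e)) \<and> t \<cdot> e = x \<cdot> e"
  proof -
    have "x \<cdot> e \<in> Arr C" "Dom C (x \<cdot> e) = Cod C u" "x \<cdot> e \<cdot> u = x \<cdot> e \<cdot> v"
      using uv(3) by simp_all
    then show ?thesis
      using co unfolding is_coequalizer_def by blast
  qed
  then have "\<exists>!t. t \<in> hom C d X \<and> t \<cdot> e = x \<cdot> e"
    by simp
  then show ?thesis
    using xy by metis
qed

lemma coequalizerI:
  assumes uv: "u \<in> hom C r a" "v \<in> hom C r a" and e: "e \<in> hom C a d" "e \<cdot> u = e \<cdot> v"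
    and epi: "\<And>X x y. x \<in> hom C d X \<Longrightarrow> y \<in> hom C d X \<Longrightarrow> x \<cdot> e = y \<cdot> e \<Longrightarrow> x = y"
    and desc: "\<And>X x. x \<in> hom C a X \<Longrightarrow> x \<cdot> u = x \<cdot> v \<Longrightarrow> \<exists>t \<in> hom C d X. t \<cdot> e = x"
  shows "is_coequalizer C u v e"
  unfolding is_coequalizer_def span_def
proof (intro conjI ballI impI)
  note [simp] = uv[THEN homD] e(1)[THEN homD]
  fix x assume x: "x \<in> Arr C" "Dom C x = Cod C u \<and> x \<cdot> u = x \<cdot> v"
  then have "x \<in> hom C a (Cod C x)" by (simp add: hom_iff)
  then obtain t where "t \<in> hom C d (Cod C x)" "t \<cdot> e = x" using desc x by blast
  then show "\<exists>!t. t \<in> hom C (Cod C e) (Cod C x) \<and> t \<cdot> e = x"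
    using epi by (intro ex1I[of _ t]) auto
qed (simp_all add: uv[THEN homD] e(1)[THEN homD] e(2))

lemma regular_epi_epi:
  assumes "regular_epi C e" "e \<in> hom C a d"
    and "x \<in> hom C d X" "y \<in> hom C d X" "x \<cdot> e = y \<cdot> e"
  shows "x = y"
  using assms coequalizer_epi unfolding regular_epi_def by blast

text \<open>The pair \<open>u0\<close>, \<open>v0\<close> whose coequalizer is \<open>e\<close>
  factors through the kernel pair, so an arrow that coequalizes the kernel pair coequalizes
  \<open>u0\<close>, \<open>v0\<close> too.\<close>

lemma regular_epi_coequalizer:
  assumes re: "regular_epi C e" and pb: "is_pullback C u v e e"
  shows "is_coequalizer C u v e"
proof -
  obtain u0 v0 where co: "is_coequalizer C u0 v0 e" using re unfolding regular_epi_def by blast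
  obtain r0 a d where H: "u0 \<in> hom C r0 a" "v0 \<in> hom C r0 a" "e \<in> hom C a d" "e \<cdot> u0 = e \<cdot> v0"
    using co by (rule coequalizerE)
  obtain r where K: "u \<in> hom C r a" "v \<in> hom C r a" "e \<cdot> u = e \<cdot> v"
    using pb H(3) H(3) by (rule pullbackE_cospan)
  obtain w where w: "w \<in> hom C r0 r" "u \<cdot> w = u0" "v \<cdot> w = v0"
    by (rule pullback_lift[OF pb K(1,2) H(1,2,4)])
  note [simp] = H(1-3)[THEN homD] K(1,2)[THEN homD] w(1)[THEN homD]
  show ?thesis
  proof (rule coequalizerI[OF K(1,2) H(3) K(3)])
    fix X x assume x: "x \<in> hom C a X" "x \<cdot> u = x \<cdot> v"
    note [simp] = x(1)[THEN homD]
    have "x \<cdot> u0 = x \<cdot> v0" using comp_extend[OF x(2), of w] w by simp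
    then show "\<exists>t \<in> hom C d X. t \<cdot> e = x"
      using coequalizer_desc[OF co H(3) x(1)] by blast
  qed (rule coequalizer_epi[OF co H(3)])
qed

text \<open>Since \<open>h\<close> factors through \<open>e\<close>, elements identified by
  \<open>e\<close> are identified by \<open>h\<close> and lift to the given pair. A kernel pair of
  some arrow is thus the kernel pair of its own coequalizer.\<close>

lemma kernel_pair_coequalizer:
  assumes pb: "is_pullback C u v h h" and co: "is_coequalizer C u v e"
  shows "is_pullback C u v e e"
proof -
  obtain r a d where H: "u \<in> hom C r a" "v \<in> hom C r a" "e \<in> hom C a d" "e \<cdot> u = e \<cdot> v"
    using co by (rule coequalizerE)
  obtain b where h: "h \<in> hom C a b" "h \<cdot> u = h \<cdot> v"
    using pb H(1) unfolding is_pullback_def commuting_square_def span_def by (auto simp: hom_iff)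
  obtain w where w: "w \<in> hom C d b" "w \<cdot> e = h"
    by (rule coequalizer_desc[OF co H(3) h])
  note [simp] = H(1-3)[THEN homD] h(1)[THEN homD] w(1)[THEN homD]
  show ?thesis
  proof (rule pullbackI[OF H(1,2,3,3,4) pullback_jointly_monic[OF pb]])
    fix X x y assume xy: "x \<in> hom C X a" "y \<in> hom C X a" and e3: "e \<cdot> x = e \<cdot> y"
    note [simp] = xy[THEN homD]
    have "h \<cdot> x = w \<cdot> (e \<cdot> x)" "h \<cdot> y = w \<cdot> (e \<cdot> y)" 
      using comp_extend[OF w(2), of x] comp_extend[OF w(2), of y] by auto
    then have "h \<cdot> x = h \<cdot> y" using e3 by simp
    then show "\<exists>t \<in> hom C X r. u \<cdot> t = x \<and> v \<cdot> t = y"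
      using pullback_lift[OF pb H(1,2) xy] by blast
  qed
qed

text \<open>If \<open>q \<cdot> e\<close> is the coequalizer of \<open>u\<close>, \<open>v\<close>,
  then \<open>q\<close> is the coequalizer of \<open>e \<cdot> u\<close>,
  \<open>e \<cdot> v\<close>: equations about the induced arrow are tested after the epimorphism
  \<open>e\<close>.\<close>

lemma regular_epi_factor:
  assumes re: "regular_epi C (q \<cdot> e)" and ep: "regular_epi C e"
    and H: "e \<in> hom C a b" "q \<in> hom C b d"
  shows "regular_epi C q"
proof -
  note [simp] = H[THEN homD]
  obtain u v where co: "is_coequalizer C u v (q \<cdot> e)" using re unfolding regular_epi_def by blast
  have qe: "q \<cdot> e \<in> hom C a d" by (simp add: hom_iff)
  obtain r where K: "u \<in> hom C r a" "v \<in> hom C r a" "q \<cdot> e \<cdot> u = q \<cdot> e \<cdot> v"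
    using co qe by (rule coequalizerE_dom)
  note [simp] = K(1,2)[THEN homD]
  have "is_coequalizer C (e \<cdot> u) (e \<cdot> v) q"
  proof (rule coequalizerI[of _ r b _ _ d])
    fix X x y
    assume xy: "x \<in> hom C d X" "y \<in> hom C d X" "x \<cdot> q = y \<cdot> q"
    note [simp] = xy(1,2)[THEN homD]
    have "x \<cdot> (q \<cdot> e) = y \<cdot> (q \<cdot> e)" using comp_extend[OF xy(3), of e] by simp
    then show "x = y" using coequalizer_epi[OF co qe xy(1,2)] by simp
  next
    fix X x
    assume x: "x \<in> hom C b X" "x \<cdot> (e \<cdot> u) = x \<cdot> (e \<cdot> v)"
    note [simp] = x(1)[THEN homD]
    obtain t where t: "t \<in> hom C d X" "t \<cdot> (q \<cdot> e) = x \<cdot> e"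
      by (rule coequalizer_desc[OF co qe, of "x \<cdot> e" X]) (use x(2) in \<open>auto simp: hom_iff\<close>)
    note [simp] = t(1)[THEN homD]
    have "t \<cdot> q = x"
      by (rule regular_epi_epi[OF ep H(1), of _ X]) (use t(2) in \<open>auto simp: hom_iff\<close>)
    then show "\<exists>t \<in> hom C d X. t \<cdot> q = x" using t by blast
  qed (simp_all add: hom_iff K(3)[simplified])
  then show ?thesis unfolding regular_epi_def by blast
qed

text \<open>The last clause allows one to check membership in a relation locally. A single covering
  arrow is treated as the pair consisting of two copies of it.\<close>

definition cover :: "'a \<Rightarrow> 'a \<Rightarrow> bool" where
  "cover k l \<longleftrightarrow> k \<in> Arr C \<and> l \<in> Arr C \<and> Cod C k = Cod C l \<and>
    (\<forall>Z. \<forall>u \<in> hom C (Cod C k) Z. \<forall>v \<in> hom C (Cod C k) Z. u \<cdot> k = v \<cdot> k \<and> u \<cdot> l = v \<cdot> l \<longrightarrow> u = v) \<and>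
    (\<forall>s t x y. jointly_monic C s t \<and> x \<in> hom C (Cod C k) (Cod C s) \<and> y \<in> hom C (Cod C k) (Cod C t) \<and>
      (\<exists>u \<in> hom C (Dom C k) (Dom C s). s \<cdot> u = x \<cdot> k \<and> t \<cdot> u = y \<cdot> k) \<and>
      (\<exists>u \<in> hom C (Dom C l) (Dom C s). s \<cdot> u = x \<cdot> l \<and> t \<cdot> u = y \<cdot> l) \<longrightarrow>
      (\<exists>u \<in> hom C (Cod C k) (Dom C s). s \<cdot> u = x \<and> t \<cdot> u = y))"

section \<open>Local arguments along covering pairs\<close>

lemma coverE:
  assumes "cover k l" "Cod C k = X"
  obtains K L where "k \<in> hom C K X" "l \<in> hom C L X"
  using assms unfolding cover_def by (auto simp: hom_iff)

lemma cover_epi: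
  assumes "cover k l" "k \<in> hom C K X" "u \<in> hom C X Z" "v \<in> hom C X Z"
    "u \<cdot> k = v \<cdot> k" "u \<cdot> l = v \<cdot> l"
  shows "u = v"
  using assms(1,3-6) homD[OF assms(2)] unfolding cover_def by blast

lemma cover_descent:
  assumes "cover k l" "k \<in> hom C K X" "l \<in> hom C L X"
    "jointly_monic C s t" "s \<in> hom C r a" "t \<in> hom C r b" "x \<in> hom C X a" "y \<in> hom C X b"
    "u \<in> hom C K r" "s \<cdot> u = x \<cdot> k" "t \<cdot> u = y \<cdot> k"
    "v \<in> hom C L r" "s \<cdot> v = x \<cdot> l" "t \<cdot> v = y \<cdot> l"
  obtains w where "w \<in> hom C X r" "s \<cdot> w = x" "t \<cdot> w = y"
proof -
  note ty = assms(2,3,5,6)[THEN homD]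
  have "x \<in> hom C (Cod C k) (Cod C s)" "y \<in> hom C (Cod C k) (Cod C t)"
    "u \<in> hom C (Dom C k) (Dom C s)" "v \<in> hom C (Dom C l) (Dom C s)"
    using assms ty by simp_all
  then have "\<exists>w \<in> hom C (Cod C k) (Dom C s). s \<cdot> w = x \<and> t \<cdot> w = y"
    using assms(1,4,10,11,13,14) unfolding cover_def by blast
  then show ?thesis
    using that ty by auto
qed

text \<open>Lifts \<open>u\<close>, \<open>v\<close> found on the two legs satisfy
  \<open>u \<cdot> f = v \<cdot> g\<close> automatically, because both sides have the same
  composites with the jointly monic \<open>s\<close>, \<open>t\<close>. Hence they glue along the
  pushout, and \<open>cover\<close> contains no compatibility condition.\<close>

lemma pushout_cover:
  assumes po: "is_pushout C f g p q"
  shows "cover p q"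
proof -
  obtain a b c d where H: "f \<in> hom C c a" "g \<in> hom C c b" "p \<in> hom C a d" "q \<in> hom C b d"
    and e: "p \<cdot> f = q \<cdot> g"
    using po by (rule pushoutE)
  note [simp] = H[THEN homD]
  show ?thesis
    unfolding cover_def
  proof (intro conjI allI ballI impI; (elim conjE bexE)?)
    fix Z u v assume "u \<in> hom C (Cod C p) Z" "v \<in> hom C (Cod C p) Z" "u \<cdot> p = v \<cdot> p" "u \<cdot> q = v \<cdot> q"
    then show "u = v" using pushout_eq[OF po H(3), of u Z v] by simp
  next
    fix s t x y u v
    assume jm: "jointly_monic C s t"
      and x: "x \<in> hom C (Cod C p) (Cod C s)" and y: "y \<in> hom C (Cod C p) (Cod C t)"
      and u: "u \<in> hom C (Dom C p) (Dom C s)" "s \<cdot> u = x \<cdot> p" "t \<cdot> u = y \<cdot> p"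
      and v: "v \<in> hom C (Dom C q) (Dom C s)" "s \<cdot> v = x \<cdot> q" "t \<cdot> v = y \<cdot> q"
    obtain r i j where st: "s \<in> hom C r i" "t \<in> hom C r j" using jm by (rule jointly_monicE)
    note [simp] = st[THEN homD] x[THEN homD] y[THEN homD] u(1)[THEN homD] v(1)[THEN homD]
    have "u \<cdot> f = v \<cdot> g"
    proof (rule jointly_monicD[OF jm st(1), of _ c])
      show "s \<cdot> (u \<cdot> f) = s \<cdot> (v \<cdot> g)"
        using comp_extend[OF u(2), of f] comp_extend[OF v(2), of g] by (simp add: e)
      show "t \<cdot> (u \<cdot> f) = t \<cdot> (v \<cdot> g)"
        using comp_extend[OF u(3), of f] comp_extend[OF v(3), of g] by (simp add: e)
    qed (simp_all add: hom_iff)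
    then obtain w where w: "w \<in> hom C d r" "w \<cdot> p = u" "w \<cdot> q = v"
      by (rule pushout_desc[OF po H(3,4), of u r v, rotated 2]) (auto simp: hom_iff)
    note [simp] = w(1)[THEN homD]
    have "s \<cdot> w = x"
      by (rule pushout_eq[OF po H(3), of _ i]) (simp_all add: hom_iff w u v)
    moreover have "t \<cdot> w = y"
      by (rule pushout_eq[OF po H(3), of _ j]) (simp_all add: hom_iff w u v)
    ultimately show "\<exists>w \<in> hom C (Cod C p) (Dom C s). s \<cdot> w = x \<and> t \<cdot> w = y"
      using w by (intro bexI[of _ w]) (auto simp: hom_iff)
  qed simp_all
qed

lemma regular_epi_cover:
  assumes re: "regular_epi C e"
  shows "cover e e"
proof -
  obtain m n where co: "is_coequalizer C m n e" using re unfolding regular_epi_def by blast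
  obtain c a d where H: "m \<in> hom C c a" "n \<in> hom C c a" "e \<in> hom C a d"
    and e: "e \<cdot> m = e \<cdot> n"
    using co by (rule coequalizerE)
  note [simp] = H[THEN homD]
  show ?thesis
    unfolding cover_def
  proof (intro conjI allI ballI impI; (elim conjE bexE)?)
    fix Z u v assume "u \<in> hom C (Cod C e) Z" "v \<in> hom C (Cod C e) Z" "u \<cdot> e = v \<cdot> e"
    then show "u = v" using coequalizer_epi[OF co H(3), of u Z v] by simp
  next
    fix s t x y u v
    assume jm: "jointly_monic C s t"
      and x: "x \<in> hom C (Cod C e) (Cod C s)" and y: "y \<in> hom C (Cod C e) (Cod C t)"
      and u: "u \<in> hom C (Dom C e) (Dom C s)" "s \<cdot> u = x \<cdot> e" "t \<cdot> u = y \<cdot> e"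
    obtain r i j where st: "s \<in> hom C r i" "t \<in> hom C r j" using jm by (rule jointly_monicE)
    note [simp] = st[THEN homD] x[THEN homD] y[THEN homD] u(1)[THEN homD]
    have uH: "u \<in> hom C a r" by (simp add: hom_iff)
    have "u \<cdot> m = u \<cdot> n"
    proof (rule jointly_monicD[OF jm st(1), of _ c])
      show "s \<cdot> (u \<cdot> m) = s \<cdot> (u \<cdot> n)"
        using comp_extend[OF u(2), of m] comp_extend[OF u(2), of n] by (simp add: e)
      show "t \<cdot> (u \<cdot> m) = t \<cdot> (u \<cdot> n)"
        using comp_extend[OF u(3), of m] comp_extend[OF u(3), of n] by (simp add: e)
    qed (simp_all add: hom_iff)
    then obtain w where w: "w \<in> hom C d r" "w \<cdot> e = u"
      by (rule coequalizer_desc[OF co H(3) uH])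
    note [simp] = w(1)[THEN homD]
    have "s \<cdot> w = x"
      by (rule coequalizer_epi[OF co H(3), of _ i]) (simp_all add: hom_iff w u)
    moreover have "t \<cdot> w = y"
      by (rule coequalizer_epi[OF co H(3), of _ j]) (simp_all add: hom_iff w u)
    ultimately show "\<exists>w \<in> hom C (Cod C e) (Dom C s). s \<cdot> w = x \<and> t \<cdot> w = y"
      using w by (intro bexI[of _ w]) (auto simp: hom_iff)
  qed simp_all
qed

text \<open>\<open>linked f g x y\<close> is an evident reason for \<open>x\<close> and \<open>y\<close> to become equal in a pushout of
  \<open>f\<close> and \<open>g\<close>.\<close>

definition linked :: "'a \<Rightarrow> 'a \<Rightarrow> 'a \<Rightarrow> 'a \<Rightarrow> bool" where
  "linked f g x y \<longleftrightarrow> x = y \<or>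
    (\<exists>z \<in> hom C (Dom C x) (Dom C f). \<exists>w \<in> hom C (Dom C x) (Dom C f).
      f \<cdot> z = x \<and> f \<cdot> w = y \<and> g \<cdot> z = g \<cdot> w)"

lemma linked_cases:
  assumes "linked f g x y" "x \<in> hom C X a" "f \<in> hom C c a"
  obtains "x = y" | z w where "z \<in> hom C X c" "w \<in> hom C X c" "f \<cdot> z = x" "f \<cdot> w = y" "g \<cdot> z = g \<cdot> w"
  using assms(1) homD[OF assms(2)] homD[OF assms(3)] unfolding linked_def by auto

lemma linkedI:
  assumes "f \<in> hom C c a" "z \<in> hom C X c" "w \<in> hom C X c" "f \<cdot> z = x" "f \<cdot> w = y" "g \<cdot> z = g \<cdot> w"
  shows "linked f g x y"
proof -
  note [simp] = assms(1-3)[THEN homD]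
  have "Dom C x = X" unfolding assms(4)[symmetric] by simp
  then show ?thesis
    using assms unfolding linked_def by auto
qed

text \<open>Two covering arrows occur because an element of an amalgam lies in the first piece on
  one of them and in the second piece on the other. The disjunction in \<open>linked\<close> may be
  decided differently on the two.\<close>

definition locally_linked :: "'a \<Rightarrow> 'a \<Rightarrow> 'a \<Rightarrow> 'a \<Rightarrow> bool" where
  "locally_linked f g x y \<longleftrightarrow>
    (\<exists>k l. cover k l \<and> Cod C k = Dom C x \<and> linked f g (x \<cdot> k) (y \<cdot> k) \<and> linked f g (x \<cdot> l) (y \<cdot> l))"

text \<open>In contrast to being a pushout, this is a condition on generalized elements, and
  therefore it is inherited by pulled back squares.\<close>

definition quotient_square :: "'a \<Rightarrow> 'a \<Rightarrow> 'a \<Rightarrow> 'a \<Rightarrow> bool" where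
  "quotient_square f g p q \<longleftrightarrow> is_pullback C f g p q \<and> regular_epi C p \<and>
    (\<forall>X. \<forall>x \<in> hom C X (Dom C p). \<forall>y \<in> hom C X (Dom C p). p \<cdot> x = p \<cdot> y \<longrightarrow> locally_linked f g x y)"

lemma quotient_squareD:
  assumes "quotient_square f g p q"
  shows "is_pullback C f g p q" "regular_epi C p"
    "p \<in> hom C a d \<Longrightarrow> x \<in> hom C X a \<Longrightarrow> y \<in> hom C X a \<Longrightarrow> p \<cdot> x = p \<cdot> y \<Longrightarrow> locally_linked f g x y"
  using assms unfolding quotient_square_def by (auto dest: homD)

lemma locally_linkedE:
  assumes "locally_linked f g x y" "x \<in> hom C X a"
  obtains k l K L where "cover k l" "k \<in> hom C K X" "l \<in> hom C L X"
    "linked f g (x \<cdot> k) (y \<cdot> k)" "linked f g (x \<cdot> l) (y \<cdot> l)"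
proof -
  obtain k l where kl: "cover k l" "Cod C k = X" "linked f g (x \<cdot> k) (y \<cdot> k)" "linked f g (x \<cdot> l) (y \<cdot> l)"
    using assms(1) homD[OF assms(2)] unfolding locally_linked_def by auto
  show ?thesis by (rule coverE[OF kl(1,2)]) (use that kl in blast)
qed

lemma locally_linkedI:
  assumes "cover k l" "k \<in> hom C K X" "x \<in> hom C X a"
    "linked f g (x \<cdot> k) (y \<cdot> k)" "linked f g (x \<cdot> l) (y \<cdot> l)"
  shows "locally_linked f g x y"
  using assms(1,4,5) homD[OF assms(2)] homD[OF assms(3)] unfolding locally_linked_def by metis

end

context pullback_category
begin

lemma obtain_kernel_pair:
  assumes "h \<in> hom C a d"
  obtains u v r where "is_pullback C u v h h" "u \<in> hom C r a" "v \<in> hom C r a" "h \<cdot> u = h \<cdot> v"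
  using obtain_pullback[OF assms assms] .

text \<open>Pulling \<open>p\<close> and \<open>q\<close> back along \<open>h\<close> gives, by
  stability, a pushout with vertex \<open>X\<close>, whose legs \<open>k\<close>, \<open>l\<close>
  form a cover. An element of the vertex thus comes from \<open>a\<close> on \<open>k\<close> and
  from \<open>b\<close> on \<open>l\<close>.\<close>

lemma stable_pushout_local:
  assumes st: "stable_pushout C f g p q" and pq: "p \<in> hom C a d" "q \<in> hom C b d" and h: "h \<in> hom C X d"
  obtains k l x y K L where "cover k l" "k \<in> hom C K X" "l \<in> hom C L X"
    "x \<in> hom C K a" "y \<in> hom C L b" "h \<cdot> k = p \<cdot> x" "h \<cdot> l = q \<cdot> y"
proof -
  note po = stable_pushoutD[OF st]
  obtain c where fg: "f \<in> hom C c a" "g \<in> hom C c b" and e: "p \<cdot> f = q \<cdot> g"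
    using po pq unfolding is_pushout_def commuting_square_def span_def by (auto simp: hom_iff)
  obtain x k K where px: "is_pullback C x k p h" and H1: "x \<in> hom C K a" "k \<in> hom C K X" "p \<cdot> x = h \<cdot> k"
    by (rule obtain_pullback[OF pq(1) h])
  obtain y l L where py: "is_pullback C y l q h" and H2: "y \<in> hom C L b" "l \<in> hom C L X" "q \<cdot> y = h \<cdot> l"
    by (rule obtain_pullback[OF pq(2) h])
  obtain z r R where pz: "is_pullback C z r (p \<cdot> f) h"
    and H3: "z \<in> hom C R c" "r \<in> hom C R X" "p \<cdot> f \<cdot> z = h \<cdot> r"
    by (rule obtain_pullback[OF comp_hom[OF pq(1) fg(1)] h])
  note [simp] = pq[THEN homD] h[THEN homD] fg[THEN homD] H1(1,2)[THEN homD] H2(1,2)[THEN homD]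
    H3(1,2)[THEN homD]
  have E: "p \<cdot> (f \<cdot> z) = h \<cdot> r" using H3 by simp
  have E2: "q \<cdot> (g \<cdot> z) = h \<cdot> r" using comp_extend[OF e, of z] E by simp
  obtain f' where f': "f' \<in> hom C R K" "x \<cdot> f' = f \<cdot> z" "k \<cdot> f' = r"
    by (rule pullback_lift[OF px H1(1,2), of "f \<cdot> z" R r]) (simp_all add: hom_iff E)
  obtain g' where g': "g' \<in> hom C R L" "y \<cdot> g' = g \<cdot> z" "l \<cdot> g' = r"
    by (rule pullback_lift[OF py H2(1,2), of "g \<cdot> z" R r]) (simp_all add: hom_iff E2)
  have "is_pushout C f' g' k l"
    by (rule st[unfolded stable_pushout_def, THEN conjunct2, rule_format, of x k h y l z r])
      (use px py pz f' g' in simp)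
  then show ?thesis
    using that[OF pushout_cover H1(2) H2(2) H1(1) H2(1)] H1(3) H2(3) by simp
qed

end

locale regular_category = pullback_category +
  assumes kernel_pair_ex_coequalizer: "is_pullback C u v h h \<Longrightarrow> \<exists>e. is_coequalizer C u v e"
    and regular_epi_pullback: "regular_epi C e \<Longrightarrow> is_pullback C k e' e h \<Longrightarrow> regular_epi C e'"
begin

lemma regular_epi_local:
  assumes "regular_epi C e" "e \<in> hom C a d" "h \<in> hom C X d"
  obtains k x K where "cover k k" "regular_epi C k" "k \<in> hom C K X" "x \<in> hom C K a" "h \<cdot> k = e \<cdot> x"
proof -
  obtain x k K where pb: "is_pullback C x k e h" and H: "x \<in> hom C K a" "k \<in> hom C K X" "e \<cdot> x = h \<cdot> k"
    by (rule obtain_pullback[OF assms(2,3)])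
  have "regular_epi C k" using assms(1) pb by (rule regular_epi_pullback)
  then show ?thesis
    using that[of k K x] regular_epi_cover H by simp
qed

text \<open>Here \<open>e\<close> is the coequalizer of the kernel pair of \<open>f\<close>. If
  \<open>m\<close> identifies \<open>x\<close> and \<open>y\<close>, lift both along
  \<open>e\<close> over a common cover; the lifts are identified by \<open>f\<close>, so they form
  an element of the kernel pair and are identified by \<open>e\<close>.\<close>

lemma image_factorization:
  assumes f: "f \<in> hom C c a"
  obtains e m i where "e \<in> hom C c i" "m \<in> hom C i a" "m \<cdot> e = f" "regular_epi C e" "monic C m"
proof -
  obtain u v r where pb: "is_pullback C u v f f" and uv: "u \<in> hom C r c" "v \<in> hom C r c" "f \<cdot> u = f \<cdot> v"
    by (rule obtain_kernel_pair[OF f])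
  obtain e where co: "is_coequalizer C u v e" using kernel_pair_ex_coequalizer[OF pb] by blast
  have re: "regular_epi C e" using co unfolding regular_epi_def by blast
  obtain i where e: "e \<in> hom C c i" "e \<cdot> u = e \<cdot> v"
    using co uv(1) unfolding is_coequalizer_def by (auto simp: hom_iff)
  obtain m where m: "m \<in> hom C i a" "m \<cdot> e = f"
    by (rule coequalizer_desc[OF co e(1) f uv(3)])
  note [simp] = f[THEN homD] uv(1,2)[THEN homD] e(1)[THEN homD] m(1)[THEN homD]
  have "monic C m"
  proof (rule monicI[OF m(1)])
    fix X x y assume xy: "x \<in> hom C X i" "y \<in> hom C X i" "m \<cdot> x = m \<cdot> y"
    obtain k x' K where k: "cover k k" "k \<in> hom C K X" and x': "x' \<in> hom C K c" "x \<cdot> k = e \<cdot> x'"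
      by (rule regular_epi_local[OF re e(1) xy(1)])
    \<comment> \<open>The second lift is taken over the domain of the first cover, so that both
      lifts end up defined on \<open>L\<close>.\<close>
    have "y \<cdot> k \<in> hom C K i" using xy(2) k(2) by (rule comp_hom)
    then obtain l y' L where l: "cover l l" "l \<in> hom C L K" and y': "y' \<in> hom C L c" "y \<cdot> k \<cdot> l = e \<cdot> y'"
      by (rule regular_epi_local[OF re e(1)])
    note [simp] = xy(1,2)[THEN homD] k(2)[THEN homD] x'(1)[THEN homD] l(2)[THEN homD] y'(1)[THEN homD]
    have "f \<cdot> (x' \<cdot> l) = m \<cdot> (x \<cdot> k \<cdot> l)" using comp_extend[OF m(2), of "x' \<cdot> l"] by (simp add: x'(2))
    also have "\<dots> = m \<cdot> (y \<cdot> k \<cdot> l)" using comp_extend[OF xy(3), of "k \<cdot> l"] by simp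
    also have "\<dots> = f \<cdot> y'" using comp_extend[OF m(2), of y'] unfolding y'(2) by simp
    finally have *: "f \<cdot> (x' \<cdot> l) = f \<cdot> y'" .
    have "x' \<cdot> l \<in> hom C L c" by (simp add: hom_iff)
    then obtain w where w: "w \<in> hom C L r" "u \<cdot> w = x' \<cdot> l" "v \<cdot> w = y'"
      using * by (rule pullback_lift[OF pb uv(1,2) _ y'(1)])
    note [simp] = w(1)[THEN homD]
    have "x \<cdot> k \<cdot> l = e \<cdot> (x' \<cdot> l)" by (simp add: x'(2))
    also have "\<dots> = y \<cdot> k \<cdot> l"
      using comp_extend[OF e(2), of w] unfolding y'(2) by (simp add: w)
    finally have "x \<cdot> k = y \<cdot> k"
      using cover_epi[OF l, of "x \<cdot> k" i "y \<cdot> k"] by (simp add: hom_iff)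
    then show "x = y" using cover_epi[OF k xy(1,2)] by simp
  qed
  then show ?thesis using that e(1) m re by blast
qed

text \<open>A cocone \<open>x\<close>, \<open>y\<close> sends linked elements to equal ones, because
  \<open>x \<cdot> f\<close> factors through \<open>g\<close>. At the kernel pair of
  \<open>p\<close>, the universal pair of elements identified by \<open>p\<close>, this makes
  \<open>x\<close> descend along \<open>p\<close>. The triangle with \<open>q\<close> is tested
  after \<open>g\<close>, which is a regular epimorphism as a pullback of \<open>p\<close>.\<close>

lemma quotient_square_pushout:
  assumes qs: "quotient_square f g p q"
  shows "is_pushout C f g p q"
proof -
  note pb = quotient_squareD(1)[OF qs] and rp = quotient_squareD(2)[OF qs]
  note link = quotient_squareD(3)[OF qs]
  obtain a b c d where H: "f \<in> hom C c a" "g \<in> hom C c b" "p \<in> hom C a d" "q \<in> hom C b d"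
    and e: "p \<cdot> f = q \<cdot> g"
    using pb by (rule pullbackE)
  have rg: "regular_epi C g" by (rule regular_epi_pullback[OF rp pb])
  obtain u v r where kp: "is_pullback C u v p p" and uv: "u \<in> hom C r a" "v \<in> hom C r a" "p \<cdot> u = p \<cdot> v"
    by (rule obtain_kernel_pair[OF H(3)])
  note co = regular_epi_coequalizer[OF rp kp]
  note [simp] = H[THEN homD] uv(1,2)[THEN homD]
  show ?thesis
  proof (rule pushoutI[OF H e])
    fix X x y assume "x \<in> hom C d X" "y \<in> hom C d X" "x \<cdot> p = y \<cdot> p"
    then show "x = y" by (rule regular_epi_epi[OF rp H(3)])
  next
    fix X x y assume xy: "x \<in> hom C a X" "y \<in> hom C b X" and e3: "x \<cdot> f = y \<cdot> g"
    note [simp] = xy[THEN homD]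
    obtain k l K L where kl: "cover k l" "k \<in> hom C K r" "l \<in> hom C L r"
      and lk: "linked f g (u \<cdot> k) (v \<cdot> k)" "linked f g (u \<cdot> l) (v \<cdot> l)"
      by (rule locally_linkedE[OF link[OF H(3) uv] uv(1)])
    have *: "x \<cdot> z = x \<cdot> z'" if "z \<in> hom C Z a" "linked f g z z'" for z z' Z
      using that(2,1) H(1)
    proof (cases rule: linked_cases)
      case (2 w w')
      note [simp] = 2(1,2)[THEN homD]
      have "x \<cdot> z = y \<cdot> (g \<cdot> w)" "x \<cdot> z' = y \<cdot> (g \<cdot> w')"
        using comp_extend[OF e3, of w] comp_extend[OF e3, of w'] 2(3,4) by auto
      then show ?thesis using 2(5) by simp
    qed simp
    note [simp] = kl(2,3)[THEN homD]
    have "x \<cdot> u = x \<cdot> v"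
    proof (rule cover_epi[OF kl(1,2), of _ X])
      show "x \<cdot> u \<cdot> k = x \<cdot> v \<cdot> k" using *[OF _ lk(1), of K] by (simp add: hom_iff)
      show "x \<cdot> u \<cdot> l = x \<cdot> v \<cdot> l" using *[OF _ lk(2), of L] by (simp add: hom_iff)
    qed (simp_all add: hom_iff)
    then obtain w where w: "w \<in> hom C d X" "w \<cdot> p = x"
      by (rule coequalizer_desc[OF co H(3) xy(1)])
    note [simp] = w(1)[THEN homD]
    have "w \<cdot> q = y"
    proof (rule regular_epi_epi[OF rg H(2), of _ X])
      have "w \<cdot> q \<cdot> g = x \<cdot> f" using comp_extend[OF w(2), of f] e by simp
      then show "w \<cdot> q \<cdot> g = y \<cdot> g" using e3 by simp
    qed (simp_all add: hom_iff)
    then show "\<exists>t \<in> hom C d X. t \<cdot> p = x \<and> t \<cdot> q = y" using w by blast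
  qed
qed

lemma quotient_square_stable:
  assumes qs: "quotient_square f g p q"
  shows "stable_pushout C f g p q"
  unfolding stable_pushout_def
proof (intro conjI allI impI quotient_square_pushout[OF qs]; (elim conjE)?)
  note pb = quotient_squareD(1)[OF qs] and rp = quotient_squareD(2)[OF qs]
  note link = quotient_squareD(3)[OF qs]
  fix h a b c p' q' r f' g'
  assume a: "is_pullback C a p' p h" and b: "is_pullback C b q' q h"
    and c: "is_pullback C c r (p \<cdot> f) h"
    and f': "f' \<in> hom C (Dom C c) (Dom C a)" "a \<cdot> f' = f \<cdot> c" "p' \<cdot> f' = r"
    and g': "g' \<in> hom C (Dom C c) (Dom C b)" "b \<cdot> g' = g \<cdot> c" "q' \<cdot> g' = r"
  obtain X0 A B D where H: "f \<in> hom C X0 A" "g \<in> hom C X0 B" "p \<in> hom C A D" "q \<in> hom C B D"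
    and e: "p \<cdot> f = q \<cdot> g"
    using pb by (rule pullbackE)
  obtain A' X where Ha: "a \<in> hom C A' A" "p' \<in> hom C A' X" "h \<in> hom C X D" and ea: "p \<cdot> a = h \<cdot> p'"
    using a H(3) by (rule pullbackE_left)
  obtain B' where Hb: "b \<in> hom C B' B" "q' \<in> hom C B' X" and eb: "q \<cdot> b = h \<cdot> q'"
    using b H(4) Ha(3) by (rule pullbackE_cospan)
  obtain X0' where Hc: "c \<in> hom C X0' X0" "r \<in> hom C X0' X" and ec: "p \<cdot> f \<cdot> c = h \<cdot> r"
    using c comp_hom[OF H(3,1)] Ha(3) by (rule pullbackE_cospan)
  have K: "f' \<in> hom C X0' A'" "g' \<in> hom C X0' B'"
    using f'(1) g'(1) Ha(1) Hb(1) Hc(1) by (simp_all add: hom_iff)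
  note [simp] = H[THEN homD] Ha[THEN homD] Hb[THEN homD] Hc[THEN homD] K[THEN homD]
  note F = f'(2,3) g'(2,3) comp_extend[OF f'(2)] comp_extend[OF f'(3)] comp_extend[OF g'(2)]
    comp_extend[OF g'(3)]
  \<comment> \<open>Existence half of the fact that \<open>f'\<close>, \<open>c\<close> exhibit the
    pullback of \<open>f\<close> along \<open>a\<close>.\<close>
  have lift: "\<exists>w \<in> hom C Y X0'. f' \<cdot> w = x \<and> c \<cdot> w = z"
    if xz: "x \<in> hom C Y A'" "z \<in> hom C Y X0" and e3: "f \<cdot> z = a \<cdot> x" for Y x z
  proof -
    note [simp] = xz[THEN homD]
    have "p \<cdot> f \<cdot> z = p \<cdot> (a \<cdot> x)" by (simp add: e3)
    also have "\<dots> = h \<cdot> (p' \<cdot> x)" by (simp add: comp_extend[OF ea])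
    finally obtain w where w: "w \<in> hom C Y X0'" "c \<cdot> w = z" "r \<cdot> w = p' \<cdot> x"
      by (rule pullback_lift[OF c Hc xz(2), of "p' \<cdot> x", rotated]) (simp_all add: hom_iff)
    note [simp] = w(1)[THEN homD]
    have "f' \<cdot> w = x"
      by (rule jointly_monicD[OF pullback_jointly_monic[OF a] Ha(1), of _ Y])
        (simp_all add: hom_iff F w e3)
    then show ?thesis using w by blast
  qed
  \<comment> \<open>The two witnesses of a link lift by \<open>lift\<close>. Their images under
    \<open>g'\<close> agree because \<open>b\<close> sees the original link and \<open>q'\<close>
    sees \<open>p' \<cdot> x = p' \<cdot> y\<close>.\<close>
  have linked_lift: "linked f' g' x y" if xy: "x \<in> hom C Y A'" "y \<in> hom C Y A'" and e3: "p' \<cdot> x = p' \<cdot> y"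
    and lk: "linked f g (a \<cdot> x) (a \<cdot> y)" for Y x y
    using lk comp_hom[OF Ha(1) xy(1)] H(1)
  proof (cases rule: linked_cases)
    case 1
    then have "x = y" using jointly_monicD[OF pullback_jointly_monic[OF a] Ha(1) xy] e3 by blast
    then show ?thesis unfolding linked_def by simp
  next
    case (2 z w)
    obtain z' where z': "z' \<in> hom C Y X0'" "f' \<cdot> z' = x" "c \<cdot> z' = z" using lift[OF xy(1) 2(1,3)] by blast
    obtain w' where w': "w' \<in> hom C Y X0'" "f' \<cdot> w' = y" "c \<cdot> w' = w" using lift[OF xy(2) 2(2,4)] by blast
    note [simp] = z'(1)[THEN homD] w'(1)[THEN homD]
    have "g' \<cdot> z' = g' \<cdot> w'"
    proof (rule jointly_monicD[OF pullback_jointly_monic[OF b] Hb(1), of _ Y])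
      show "b \<cdot> (g' \<cdot> z') = b \<cdot> (g' \<cdot> w')" using 2(5) by (simp add: F z' w')
      have "r \<cdot> z' = p' \<cdot> x" "r \<cdot> w' = p' \<cdot> y"
        using comp_extend[OF f'(3), of z'] comp_extend[OF f'(3), of w'] by (simp_all add: z' w')
      then show "q' \<cdot> (g' \<cdot> z') = q' \<cdot> (g' \<cdot> w')" by (simp add: F e3)
    qed (simp_all add: hom_iff)
    then show ?thesis by (rule linkedI[OF K(1) z'(1) w'(1) z'(2) w'(2)])
  qed
  have "quotient_square f' g' p' q'"
    unfolding quotient_square_def
  proof (intro conjI allI ballI impI)
    show "is_pullback C f' g' p' q'" by (rule pullback_cube[OF pb a b c f' g'])
    show "regular_epi C p'" by (rule regular_epi_pullback[OF rp a])
    fix Y x y assume "x \<in> hom C Y (Dom C p')" "y \<in> hom C Y (Dom C p')" and e3: "p' \<cdot> x = p' \<cdot> y"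
    then have xy: "x \<in> hom C Y A'" "y \<in> hom C Y A'" by simp_all
    note [simp] = xy[THEN homD]
    have axy: "a \<cdot> x \<in> hom C Y A" "a \<cdot> y \<in> hom C Y A" by (simp_all add: hom_iff)
    have "p \<cdot> (a \<cdot> x) = p \<cdot> (a \<cdot> y)" by (simp add: comp_extend[OF ea] e3)
    then obtain k l K L where kl: "cover k l" "k \<in> hom C K Y" "l \<in> hom C L Y"
      and lk: "linked f g (a \<cdot> x \<cdot> k) (a \<cdot> y \<cdot> k)" "linked f g (a \<cdot> x \<cdot> l) (a \<cdot> y \<cdot> l)"
      by (rule locally_linkedE[OF link[OF H(3) axy] axy(1)])
    note [simp] = kl(2,3)[THEN homD]
    have "linked f' g' (x \<cdot> k) (y \<cdot> k)"
      using lk(1) by (intro linked_lift[of _ K]) (simp_all add: hom_iff comp_extend[OF e3])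
    moreover have "linked f' g' (x \<cdot> l) (y \<cdot> l)"
      using lk(2) by (intro linked_lift[of _ L]) (simp_all add: hom_iff comp_extend[OF e3])
    ultimately show "locally_linked f' g' x y"
      by (rule locally_linkedI[OF kl(1,2) xy(1)])
  qed
  then show "is_pushout C f' g' p' q'" by (rule quotient_square_pushout)
qed

end

section \<open>Mal'cev spans and equivalence relations\<close>

context category
begin

lemma equivalence_relation_trans:
  assumes "equivalence_relation C s t" "s \<in> hom C r a" "t \<in> hom C r a"
    "x \<in> hom C X r" "y \<in> hom C X r" "t \<cdot> x = s \<cdot> y"
  obtains z where "z \<in> hom C X r" "s \<cdot> z = s \<cdot> x" "t \<cdot> z = t \<cdot> y"
proof -
  note st = assms(2,3)
  note [simp] = st[THEN homD] assms(4,5)[THEN homD]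
  obtain u v \<tau> where pb: "is_pullback C u v t s" and \<tau>: "\<tau> \<in> hom C (Dom C u) r"
    "s \<cdot> \<tau> = s \<cdot> u" "t \<cdot> \<tau> = t \<cdot> v"
    using assms(1) unfolding equivalence_relation_def by auto
  obtain p where uv: "u \<in> hom C p r" "v \<in> hom C p r" "t \<cdot> u = s \<cdot> v"
    using pb st(2,1) by (rule pullbackE_cospan)
  obtain w where w: "w \<in> hom C X p" "u \<cdot> w = x" "v \<cdot> w = y"
    using assms(4-6) by (rule pullback_lift[OF pb uv(1,2)])
  note [simp] = uv(1,2)[THEN homD] w(1)[THEN homD] \<tau>(1)[THEN homD]
  show ?thesis
    by (rule that[of "\<tau> \<cdot> w"])
      (simp_all add: hom_iff comp_extend[OF \<tau>(2)] comp_extend[OF \<tau>(3)] w)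
qed

lemma triple_productE:
  assumes "is_triple_product C f g P p1 p2 p3" "f \<in> hom C c a"
  shows "p1 \<in> hom C P c" "p2 \<in> hom C P c" "p3 \<in> hom C P c" "g \<cdot> p1 = g \<cdot> p2" "f \<cdot> p2 = f \<cdot> p3"
  using assms unfolding is_triple_product_def composable_triple_def by (auto simp: homD)

lemma triple_product_lift:
  assumes "is_triple_product C f g P p1 p2 p3" "f \<in> hom C c a"
    "x \<in> hom C X c" "y \<in> hom C X c" "z \<in> hom C X c" "g \<cdot> x = g \<cdot> y" "f \<cdot> y = f \<cdot> z"
  obtains t where "t \<in> hom C X P" "p1 \<cdot> t = x" "p2 \<cdot> t = y" "p3 \<cdot> t = z"
proof -
  have "composable_triple C f g X x y z"
    using assms unfolding composable_triple_def by (simp add: homD)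
  then have "\<exists>!t. t \<in> hom C X P \<and> p1 \<cdot> t = x \<and> p2 \<cdot> t = y \<and> p3 \<cdot> t = z"
    using assms(1) unfolding is_triple_product_def by blast
  then show ?thesis using that by blast
qed

lemma triple_product_eq:
  assumes tp: "is_triple_product C f g P p1 p2 p3" and H: "f \<in> hom C c a" "g \<in> hom C c b"
    and xy: "x \<in> hom C X P" "y \<in> hom C X P" "p1 \<cdot> x = p1 \<cdot> y" "p2 \<cdot> x = p2 \<cdot> y" "p3 \<cdot> x = p3 \<cdot> y"
  shows "x = y"
proof -
  note p = triple_productE[OF tp H(1)]
  note [simp] = H[THEN homD] p(1-3)[THEN homD] xy(1,2)[THEN homD]
  have "composable_triple C f g X (p1 \<cdot> x) (p2 \<cdot> x) (p3 \<cdot> x)"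
    unfolding composable_triple_def
    by (simp add: hom_iff comp_extend[OF p(4)] comp_extend[OF p(5)])
  then have "\<exists>!t. t \<in> hom C X P \<and> p1 \<cdot> t = p1 \<cdot> x \<and> p2 \<cdot> t = p2 \<cdot> x \<and> p3 \<cdot> t = p3 \<cdot> x"
    using tp unfolding is_triple_product_def by blast
  then show ?thesis using xy by metis
qed

lemma malcev_spanE:
  assumes mal: "malcev_span C f g" and H: "f \<in> hom C c a" "g \<in> hom C c b"
    and xyz: "x \<in> hom C X c" "y \<in> hom C X c" "z \<in> hom C X c" "g \<cdot> x = g \<cdot> y" "f \<cdot> y = f \<cdot> z"
  obtains w where "w \<in> hom C X c" "f \<cdot> w = f \<cdot> x" "g \<cdot> w = g \<cdot> z"
proof -
  obtain P p1 p2 p3 m where tp: "is_triple_product C f g P p1 p2 p3"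
    and m: "m \<in> hom C P c" "f \<cdot> m = f \<cdot> p1" "g \<cdot> m = g \<cdot> p3"
    using mal homD[OF H(1)] unfolding malcev_span_def by auto
  obtain t where t: "t \<in> hom C X P" "p1 \<cdot> t = x" "p2 \<cdot> t = y" "p3 \<cdot> t = z"
    by (rule triple_product_lift[OF tp H(1) xyz])
  note p = triple_productE[OF tp H(1)]
  note [simp] = H[THEN homD] p(1-3)[THEN homD] m(1)[THEN homD] t(1)[THEN homD]
  show ?thesis
    by (rule that[of "m \<cdot> t"]) (simp_all add: hom_iff comp_extend[OF m(2)] comp_extend[OF m(3)] t)
qed

lemma malcev_span_jointly_monic: "malcev_span C f g \<Longrightarrow> jointly_monic C f g"
  unfolding malcev_span_def by simp

end

context pullback_category
begin

text \<open>The kernel pair of \<open>g\<close> provides the first two components; pulling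
  \<open>f \<cdot> y\<close> back along \<open>f\<close> attaches the third.\<close>

lemma triple_product_ex:
  assumes H: "f \<in> hom C c a" "g \<in> hom C c b"
  obtains P p1 p2 p3 where "is_triple_product C f g P p1 p2 p3"
proof -
  obtain x y Q where xy: "is_pullback C x y g g" and Hx: "x \<in> hom C Q c" "y \<in> hom C Q c" "g \<cdot> x = g \<cdot> y"
    by (rule obtain_kernel_pair[OF H(2)])
  obtain u v P where uv: "is_pullback C u v (f \<cdot> y) f"
    and Hu: "u \<in> hom C P Q" "v \<in> hom C P c" "f \<cdot> y \<cdot> u = f \<cdot> v"
    by (rule obtain_pullback[OF comp_hom[OF H(1) Hx(2)] H(1)])
  note [simp] = H[THEN homD] Hx(1,2)[THEN homD] Hu(1,2)[THEN homD]
  have "is_triple_product C f g P (x \<cdot> u) (y \<cdot> u) v"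
    unfolding is_triple_product_def
  proof (intro conjI allI impI)
    show "composable_triple C f g P (x \<cdot> u) (y \<cdot> u) v"
      unfolding composable_triple_def using Hu(3) by (simp add: hom_iff comp_extend[OF Hx(3)])
    fix X r s t assume "composable_triple C f g X r s t"
    then have rst: "r \<in> hom C X c" "s \<in> hom C X c" "t \<in> hom C X c" "g \<cdot> r = g \<cdot> s" "f \<cdot> s = f \<cdot> t"
      unfolding composable_triple_def by simp_all
    note [simp] = rst(1-3)[THEN homD]
    obtain j where j: "j \<in> hom C X Q" "x \<cdot> j = r" "y \<cdot> j = s"
      by (rule pullback_lift[OF xy Hx(1,2) rst(1,2,4)])
    note [simp] = j(1)[THEN homD]
    have "f \<cdot> y \<cdot> j = f \<cdot> t" by (simp add: j rst)
    then obtain k where k: "k \<in> hom C X P" "u \<cdot> k = j" "v \<cdot> k = t"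
      by (rule pullback_lift[OF uv Hu(1,2) j(1) rst(3)])
    note [simp] = k(1)[THEN homD]
    show "\<exists>!k. k \<in> hom C X P \<and> x \<cdot> u \<cdot> k = r \<and> y \<cdot> u \<cdot> k = s \<and> v \<cdot> k = t"
    proof (rule ex1I[of _ k])
      show "k \<in> hom C X P \<and> x \<cdot> u \<cdot> k = r \<and> y \<cdot> u \<cdot> k = s \<and> v \<cdot> k = t"
        by (simp add: hom_iff j k)
      fix l assume l: "l \<in> hom C X P \<and> x \<cdot> u \<cdot> l = r \<and> y \<cdot> u \<cdot> l = s \<and> v \<cdot> l = t"
      then have lH: "l \<in> hom C X P" by simp
      note [simp] = lH[THEN homD]
      have "u \<cdot> l = u \<cdot> k"
        by (rule jointly_monicD[OF pullback_jointly_monic[OF xy] Hx(1), of _ X])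
          (use l in \<open>simp_all add: hom_iff k j\<close>)
      then show "l = k"
        using jointly_monicD[OF pullback_jointly_monic[OF uv] Hu(1) lH k(1)] l k by simp
    qed
  qed
  then show ?thesis by (rule that)
qed

text \<open>The projections of the triple product form the universal composable triple. The
  hypothesis at this single triple already provides the arrow required by
  \<open>malcev_span\<close>.\<close>

lemma malcev_spanI:
  assumes jm: "jointly_monic C f g" and H: "f \<in> hom C c a" "g \<in> hom C c b"
    and op: "\<And>X x y z. x \<in> hom C X c \<Longrightarrow> y \<in> hom C X c \<Longrightarrow> z \<in> hom C X c \<Longrightarrow> g \<cdot> x = g \<cdot> y \<Longrightarrow>
      f \<cdot> y = f \<cdot> z \<Longrightarrow> \<exists>w \<in> hom C X c. f \<cdot> w = f \<cdot> x \<and> g \<cdot> w = g \<cdot> z"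
  shows "malcev_span C f g"
proof -
  obtain P p1 p2 p3 where tp: "is_triple_product C f g P p1 p2 p3"
    by (rule triple_product_ex[OF H])
  show ?thesis
    using jm tp op[OF triple_productE[OF tp H(1)]] homD[OF H(1)] unfolding malcev_span_def by blast
qed

lemma equivalence_relationI:
  assumes jm: "jointly_monic C s t" and H: "s \<in> hom C r a" "t \<in> hom C r a"
    and \<rho>: "\<rho> \<in> hom C a r" "s \<cdot> \<rho> = Ide C a" "t \<cdot> \<rho> = Ide C a"
    and \<sigma>: "\<sigma> \<in> hom C r r" "s \<cdot> \<sigma> = t" "t \<cdot> \<sigma> = s"
    and trans: "\<And>X x y. x \<in> hom C X r \<Longrightarrow> y \<in> hom C X r \<Longrightarrow> t \<cdot> x = s \<cdot> y \<Longrightarrow>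
      \<exists>z \<in> hom C X r. s \<cdot> z = s \<cdot> x \<and> t \<cdot> z = t \<cdot> y"
  shows "equivalence_relation C s t"
proof -
  obtain u v p where pb: "is_pullback C u v t s" and uv: "u \<in> hom C p r" "v \<in> hom C p r" "t \<cdot> u = s \<cdot> v"
    by (rule obtain_pullback[OF H(2,1)])
  have ty: "Dom C s = r" "Cod C s = a" "Cod C t = a"
    using H by (simp_all add: hom_iff)
  have "\<exists>\<tau> \<in> hom C (Dom C u) r. s \<cdot> \<tau> = s \<cdot> u \<and> t \<cdot> \<tau> = t \<cdot> v"
    using trans[OF uv] homD[OF uv(1)] by simp
  then show ?thesis
    unfolding equivalence_relation_def ty using jm \<rho> \<sigma> pb by blast
qed

lemma kernel_pair_equivalence_relation:
  assumes pb: "is_pullback C u v h h"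
  shows "equivalence_relation C u v"
proof -
  obtain r a d where H: "u \<in> hom C r a" "v \<in> hom C r a" "h \<in> hom C a d" "h \<cdot> u = h \<cdot> v"
    using pb unfolding is_pullback_def commuting_square_def span_def by (auto simp: hom_iff)
  note [simp] = H(1-3)[THEN homD]
  have id: "Ide C a \<in> hom C a a" using Ide_hom hom_obj[OF H(3)] by blast
  obtain \<rho> where \<rho>: "\<rho> \<in> hom C a r" "u \<cdot> \<rho> = Ide C a" "v \<cdot> \<rho> = Ide C a"
    by (rule pullback_lift[OF pb H(1,2) id id refl])
  obtain \<sigma> where \<sigma>: "\<sigma> \<in> hom C r r" "u \<cdot> \<sigma> = v" "v \<cdot> \<sigma> = u"
    by (rule pullback_lift[OF pb H(1,2,2,1) H(4)[symmetric]])
  show ?thesis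
  proof (rule equivalence_relationI[OF pullback_jointly_monic[OF pb] H(1,2) \<rho> \<sigma>])
    fix X x y assume xy: "x \<in> hom C X r" "y \<in> hom C X r" and e: "v \<cdot> x = u \<cdot> y"
    note [simp] = xy[THEN homD]
    have ty: "u \<cdot> x \<in> hom C X a" "v \<cdot> y \<in> hom C X a" by (simp_all add: hom_iff)
    have "h \<cdot> (u \<cdot> x) = h \<cdot> (v \<cdot> x)" by (simp add: comp_extend[OF H(4)])
    also have "\<dots> = h \<cdot> (v \<cdot> y)" by (simp add: e comp_extend[OF H(4)])
    finally show "\<exists>z \<in> hom C X r. u \<cdot> z = u \<cdot> x \<and> v \<cdot> z = v \<cdot> y"
      using pullback_lift[OF pb H(1,2) ty] by blast
  qed
qed

text \<open>Reading an element as an arrow from its image under \<open>s\<close> to its image under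
  \<open>t\<close>, the operation composes \<open>x\<close>, the inverse of \<open>y\<close>, and
  \<open>z\<close>.\<close>

lemma equivalence_relation_malcev:
  assumes eq: "equivalence_relation C s t"
  shows "malcev_span C s t"
proof -
  have jm: "jointly_monic C s t" and "Cod C s = Cod C t"
    using eq unfolding equivalence_relation_def by simp_all
  then obtain r a where H: "s \<in> hom C r a" "t \<in> hom C r a"
    unfolding jointly_monic_def span_def by (auto simp: hom_iff)
  obtain \<sigma> where \<sigma>: "\<sigma> \<in> hom C r r" "s \<cdot> \<sigma> = t" "t \<cdot> \<sigma> = s"
    using eq homD[OF H(1)] unfolding equivalence_relation_def by auto
  note [simp] = H[THEN homD] \<sigma>(1)[THEN homD]
  show ?thesis
  proof (rule malcev_spanI[OF jm H])
    fix X x y z assume xyz: "x \<in> hom C X r" "y \<in> hom C X r" "z \<in> hom C X r" "t \<cdot> x = t \<cdot> y" "s \<cdot> y = s \<cdot> z"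
    note [simp] = xyz(1-3)[THEN homD]
    have sy: "\<sigma> \<cdot> y \<in> hom C X r" by (simp add: hom_iff)
    have "t \<cdot> x = s \<cdot> (\<sigma> \<cdot> y)" by (simp add: comp_extend[OF \<sigma>(2)] xyz)
    then obtain w where w: "w \<in> hom C X r" "s \<cdot> w = s \<cdot> x" "t \<cdot> w = t \<cdot> (\<sigma> \<cdot> y)"
      by (rule equivalence_relation_trans[OF eq H xyz(1) sy])
    have "t \<cdot> w = s \<cdot> z" by (simp add: w comp_extend[OF \<sigma>(3)] xyz)
    then obtain w' where "w' \<in> hom C X r" "s \<cdot> w' = s \<cdot> w" "t \<cdot> w' = t \<cdot> z"
      by (rule equivalence_relation_trans[OF eq H w(1) xyz(3)])
    then show "\<exists>w \<in> hom C X r. s \<cdot> w = s \<cdot> x \<and> t \<cdot> w = t \<cdot> z" using w by auto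
  qed
qed

end

section \<open>Quotients by Mal'cev spans of regular epimorphisms\<close>

locale Barr_exact_category = regular_category +
  assumes effective: "equivalence_relation C s t \<Longrightarrow> \<exists>h. is_pullback C s t h h"
begin

lemma obtain_quotient:
  assumes eq: "equivalence_relation C s t" and H: "s \<in> hom C r a" "t \<in> hom C r a"
  obtains e d where "e \<in> hom C a d" "is_pullback C s t e e" "is_coequalizer C s t e" "regular_epi C e"
proof -
  obtain h where h: "is_pullback C s t h h" using effective[OF eq] by blast
  obtain e where co: "is_coequalizer C s t e" using kernel_pair_ex_coequalizer[OF h] by blast
  obtain d where "e \<in> hom C a d"
    using co homD[OF H(1)] unfolding is_coequalizer_def by (auto simp: hom_iff)
  then show ?thesis
    using that co kernel_pair_coequalizer[OF h co] unfolding regular_epi_def by blast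
qed

text \<open>Elements \<open>x\<close>, \<open>z\<close> are related when a middle element
  \<open>y\<close> satisfies \<open>d \<cdot> x = d \<cdot> y\<close> and
  \<open>e \<cdot> y = e \<cdot> z\<close>. The middle element is determined by the outer ones since
  \<open>e\<close>, \<open>d\<close> are jointly monic, which makes \<open>p1\<close>,
  \<open>p3\<close> jointly monic. The Mal'cev operation supplies the middle elements for symmetry
  and transitivity.\<close>

lemma malcev_equivalence_relation:
  assumes mal: "malcev_span C e d" and H: "e \<in> hom C c i" "d \<in> hom C c j"
    and tp: "is_triple_product C e d P p1 p2 p3"
  shows "equivalence_relation C p1 p3"
proof -
  note p = triple_productE[OF tp H(1)]
  note [simp] = H[THEN homD] p(1-3)[THEN homD]
  note E = comp_extend[OF p(4)] comp_extend[OF p(5)]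
  note jm = malcev_span_jointly_monic[OF mal]
  have id: "Ide C c \<in> hom C c c" using Ide_hom hom_obj[OF H(1)] by blast
  obtain \<rho> where \<rho>: "\<rho> \<in> hom C c P" "p1 \<cdot> \<rho> = Ide C c" "p3 \<cdot> \<rho> = Ide C c"
    by (rule triple_product_lift[OF tp H(1) id id id refl refl])
  obtain m where m: "m \<in> hom C P c" "e \<cdot> m = e \<cdot> p1" "d \<cdot> m = d \<cdot> p3"
    by (rule malcev_spanE[OF mal H p])
  \<comment> \<open>For the universal triple the operation gives \<open>m\<close> that agrees with
    \<open>p1\<close> under \<open>e\<close> and with \<open>p3\<close> under \<open>d\<close>, so
    \<open>p3\<close>, \<open>m\<close>, \<open>p1\<close> is again a triple; this is the
    reversal.\<close>
  obtain \<sigma> where \<sigma>: "\<sigma> \<in> hom C P P" "p1 \<cdot> \<sigma> = p3" "p3 \<cdot> \<sigma> = p1"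
    by (rule triple_product_lift[OF tp H(1) p(3) m(1) p(1) m(3)[symmetric] m(2)])
  have "jointly_monic C p1 p3"
  proof (rule jointly_monicI[OF p(1,3)])
    fix X x y assume xy: "x \<in> hom C X P" "y \<in> hom C X P" and e13: "p1 \<cdot> x = p1 \<cdot> y" "p3 \<cdot> x = p3 \<cdot> y"
    note [simp] = xy[THEN homD]
    have "p2 \<cdot> x = p2 \<cdot> y"
    proof (rule jointly_monicD[OF jm H(1), of _ X])
      show "e \<cdot> (p2 \<cdot> x) = e \<cdot> (p2 \<cdot> y)" by (simp add: E e13)
      have "d \<cdot> (p2 \<cdot> x) = d \<cdot> (p1 \<cdot> x)" "d \<cdot> (p2 \<cdot> y) = d \<cdot> (p1 \<cdot> y)" by (simp_all add: E)
      then show "d \<cdot> (p2 \<cdot> x) = d \<cdot> (p2 \<cdot> y)" by (simp add: e13)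
    qed (simp_all add: hom_iff)
    then show "x = y" using triple_product_eq[OF tp H xy] e13 by blast
  qed
  then show ?thesis
  proof (rule equivalence_relationI[OF _ p(1,3) \<rho> \<sigma>])
    fix X x y assume xy: "x \<in> hom C X P" "y \<in> hom C X P" and e31: "p3 \<cdot> x = p1 \<cdot> y"
    note [simp] = xy[THEN homD]
    have ty: "p2 \<cdot> y \<in> hom C X c" "p1 \<cdot> y \<in> hom C X c" "p2 \<cdot> x \<in> hom C X c" "p1 \<cdot> x \<in> hom C X c"
      "p3 \<cdot> y \<in> hom C X c" by (simp_all add: hom_iff)
    \<comment> \<open>The zigzag from \<open>p1 \<cdot> x\<close> to \<open>p3 \<cdot> y\<close> has
      two middle elements, \<open>p2 \<cdot> x\<close> and \<open>p2 \<cdot> y\<close>. The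
      operation applied to \<open>p2 \<cdot> y\<close>, \<open>p1 \<cdot> y\<close>,
      \<open>p2 \<cdot> x\<close> contracts them to one.\<close>
    have "d \<cdot> (p2 \<cdot> y) = d \<cdot> (p1 \<cdot> y)" by (simp add: E)
    moreover have "e \<cdot> (p1 \<cdot> y) = e \<cdot> (p2 \<cdot> x)" by (simp add: E e31)
    ultimately obtain w where w: "w \<in> hom C X c" "e \<cdot> w = e \<cdot> (p2 \<cdot> y)" "d \<cdot> w = d \<cdot> (p2 \<cdot> x)"
      by (rule malcev_spanE[OF mal H ty(1-3)])
    have "d \<cdot> (p1 \<cdot> x) = d \<cdot> w" "e \<cdot> w = e \<cdot> (p3 \<cdot> y)" by (simp_all add: w E)
    then obtain t where "t \<in> hom C X P" "p1 \<cdot> t = p1 \<cdot> x" "p3 \<cdot> t = p3 \<cdot> y"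
      by (rule triple_product_lift[OF tp H(1) ty(4) w(1) ty(5)])
    then show "\<exists>t \<in> hom C X P. p1 \<cdot> t = p1 \<cdot> x \<and> p3 \<cdot> t = p3 \<cdot> y" by blast
  qed
qed

text \<open>Elements equal under \<open>e\<close> or under \<open>d\<close> are identified by the
  quotient \<open>q\<close>: one of the two serves as the middle element. Hence \<open>q\<close>
  factors through both \<open>e\<close> and \<open>d\<close>, and the two factors form the
  cospan.\<close>

lemma malcev_regular_epi_square:
  assumes mal: "malcev_span C e d" and H: "e \<in> hom C c i" "d \<in> hom C c j"
    and re: "regular_epi C e" and rd: "regular_epi C d"
  obtains q1 q2 k where "quotient_square e d q1 q2" "q1 \<in> hom C i k" "q2 \<in> hom C j k"
    "regular_epi C q1" "regular_epi C q2"
proof -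
  obtain P p1 p2 p3 where tp: "is_triple_product C e d P p1 p2 p3"
    by (rule triple_product_ex[OF H])
  note p = triple_productE[OF tp H(1)]
  note jm = malcev_span_jointly_monic[OF mal]
  obtain q k where q: "q \<in> hom C c k" and pq: "is_pullback C p1 p3 q q"
    and "is_coequalizer C p1 p3 q" and rq: "regular_epi C q"
    by (rule obtain_quotient[OF malcev_equivalence_relation[OF mal H tp] p(1,3)])
  have epq: "q \<cdot> p1 = q \<cdot> p3" using pq by (rule pullbackE)
  note [simp] = H[THEN homD] p(1-3)[THEN homD] q[THEN homD]
  note E = comp_extend[OF p(4)] comp_extend[OF p(5)]
  have q_eqI: "q \<cdot> x = q \<cdot> z" if xyz: "x \<in> hom C X c" "y \<in> hom C X c" "z \<in> hom C X c"
    "d \<cdot> x = d \<cdot> y" "e \<cdot> y = e \<cdot> z" for X x y z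
  proof -
    obtain t where t: "t \<in> hom C X P" "p1 \<cdot> t = x" "p2 \<cdot> t = y" "p3 \<cdot> t = z"
      by (rule triple_product_lift[OF tp H(1) xyz])
    then show ?thesis
      using comp_extend[OF epq, of t] homD[OF t(1)] by simp
  qed
  have q_eqD: "\<exists>y \<in> hom C X c. d \<cdot> x = d \<cdot> y \<and> e \<cdot> y = e \<cdot> z"
    if xz: "x \<in> hom C X c" "z \<in> hom C X c" "q \<cdot> x = q \<cdot> z" for X x z
  proof -
    obtain t where t: "t \<in> hom C X P" "p1 \<cdot> t = x" "p3 \<cdot> t = z"
      by (rule pullback_lift[OF pq p(1,3) xz])
    note [simp] = t(1)[THEN homD]
    show ?thesis
      using E(1)[of t] E(2)[of t] t by (intro bexI[of _ "p2 \<cdot> t"]) (simp_all add: hom_iff)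
  qed
  have fac: "\<exists>t \<in> hom C b k. t \<cdot> f = q" if f: "f \<in> hom C c b" and rf: "regular_epi C f"
    and *: "\<And>X x y. x \<in> hom C X c \<Longrightarrow> y \<in> hom C X c \<Longrightarrow> f \<cdot> x = f \<cdot> y \<Longrightarrow> q \<cdot> x = q \<cdot> y" for f b
  proof -
    obtain u v r where kp: "is_pullback C u v f f" and uv: "u \<in> hom C r c" "v \<in> hom C r c" "f \<cdot> u = f \<cdot> v"
      by (rule obtain_kernel_pair[OF f])
    show ?thesis
      by (rule coequalizer_desc[OF regular_epi_coequalizer[OF rf kp] f q *[OF uv]]) blast
  qed
  obtain q1 where q1: "q1 \<in> hom C i k" "q1 \<cdot> e = q"
    using fac[OF H(1) re] q_eqI by blast
  obtain q2 where q2: "q2 \<in> hom C j k" "q2 \<cdot> d = q"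
    using fac[OF H(2) rd] q_eqI by blast
  note [simp] = q1(1)[THEN homD] q2(1)[THEN homD]
  note Q = q1(2) q2(2) q1(2)[THEN comp_extend] q2(2)[THEN comp_extend]
  have rq1: "regular_epi C q1" using regular_epi_factor[OF _ re H(1) q1(1)] rq q1(2) by simp
  have rq2: "regular_epi C q2" using regular_epi_factor[OF _ rd H(2) q2(1)] rq q2(2) by simp
  have pb: "is_pullback C e d q1 q2"
  proof (rule pullbackI[OF H q1(1) q2(1) _ jm])
    show "q1 \<cdot> e = q2 \<cdot> d" by (simp add: Q)
    fix X x y assume xy: "x \<in> hom C X i" "y \<in> hom C X j" and e3: "q1 \<cdot> x = q2 \<cdot> y"
    obtain l x' L where l: "cover l l" "l \<in> hom C L X" and x': "x' \<in> hom C L c" "x \<cdot> l = e \<cdot> x'"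
      by (rule regular_epi_local[OF re H(1) xy(1)])
    have "y \<cdot> l \<in> hom C L j" using xy(2) l(2) by (rule comp_hom)
    then obtain m y' M where m: "cover m m" "m \<in> hom C M L" and y': "y' \<in> hom C M c" "y \<cdot> l \<cdot> m = d \<cdot> y'"
      by (rule regular_epi_local[OF rd H(2)])
    note [simp] = xy[THEN homD] l(2)[THEN homD] x'(1)[THEN homD] m(2)[THEN homD] y'(1)[THEN homD]
    have ty: "x' \<cdot> m \<in> hom C M c" "x \<cdot> l \<in> hom C L i" "y \<cdot> l \<in> hom C L j" by (simp_all add: hom_iff)
    have "q \<cdot> (x' \<cdot> m) = q1 \<cdot> (x \<cdot> l \<cdot> m)" unfolding x'(2) by (simp add: Q)
    also have "\<dots> = q2 \<cdot> (y \<cdot> l \<cdot> m)" using comp_extend[OF e3, of "l \<cdot> m"] by simp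
    also have "\<dots> = q \<cdot> y'" unfolding y'(2) by (simp add: Q)
    \<comment> \<open>The lifts \<open>y'\<close> and \<open>x' \<cdot> m\<close> are identified by
      \<open>q\<close>. Their middle element \<open>w\<close> lies over \<open>x\<close> and over
      \<open>y\<close> at once, and descends because \<open>e\<close>, \<open>d\<close> are jointly
      monic.\<close>
    finally obtain w where w: "w \<in> hom C M c" "d \<cdot> y' = d \<cdot> w" "e \<cdot> w = e \<cdot> (x' \<cdot> m)"
      using q_eqD[OF y'(1) ty(1)] by auto
    have w': "e \<cdot> w = x \<cdot> l \<cdot> m" "d \<cdot> w = y \<cdot> l \<cdot> m"
      using w(2,3) y'(2) unfolding x'(2) by simp_all
    obtain v where v: "v \<in> hom C L c" "e \<cdot> v = x \<cdot> l" "d \<cdot> v = y \<cdot> l"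
      by (rule cover_descent[OF m(1,2,2) jm H ty(2,3) w(1) w' w(1) w'])
    show "\<exists>t \<in> hom C X c. e \<cdot> t = x \<and> d \<cdot> t = y"
      by (rule cover_descent[OF l(1,2,2) jm H xy v v]) blast
  qed
  have "quotient_square e d q1 q2"
    unfolding quotient_square_def
  proof (intro conjI allI ballI impI pb rq1)
    fix X x y assume "x \<in> hom C X (Dom C q1)" "y \<in> hom C X (Dom C q1)" and e3: "q1 \<cdot> x = q1 \<cdot> y"
    then have xy: "x \<in> hom C X i" "y \<in> hom C X i" by simp_all
    obtain l x' L where l: "cover l l" "l \<in> hom C L X" and x': "x' \<in> hom C L c" "x \<cdot> l = e \<cdot> x'"
      by (rule regular_epi_local[OF re H(1) xy(1)])
    note [simp] = xy[THEN homD] l(2)[THEN homD] x'(1)[THEN homD]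
    have ty: "y \<cdot> l \<in> hom C L i" "d \<cdot> x' \<in> hom C L j" by (simp_all add: hom_iff)
    \<comment> \<open>One link suffices: given a local lift \<open>x'\<close> of \<open>x\<close>,
      the pullback property yields \<open>w\<close> over \<open>y\<close> with the same image under
      \<open>d\<close>.\<close>
    have "q1 \<cdot> (y \<cdot> l) = q1 \<cdot> (x \<cdot> l)" using comp_extend[OF e3, of l] by simp
    also have "\<dots> = q2 \<cdot> (d \<cdot> x')" unfolding x'(2) by (simp add: Q)
    finally obtain w where w: "w \<in> hom C L c" "e \<cdot> w = y \<cdot> l" "d \<cdot> w = d \<cdot> x'"
      by (rule pullback_lift[OF pb H ty])
    have "linked e d (x \<cdot> l) (y \<cdot> l)"
      by (rule linkedI[OF H(1) x'(1) w(1) x'(2)[symmetric] w(2) w(3)[symmetric]])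
    then show "locally_linked e d x y" by (rule locally_linkedI[OF l xy(1)]) fact
  qed
  then show ?thesis by (rule that[OF _ q1(1) q2(1) rq1 rq2])
qed

end

section \<open>Pushouts in amalgamable Barr-exact categories\<close>

context category
begin

section \<open>Links along a monomorphism\<close>

lemma linked_comp:
  assumes "linked f g x y" "x \<in> hom C X a" "f \<in> hom C c a" "g \<in> hom C c b" "k \<in> hom C K X"
  shows "linked f g (x \<cdot> k) (y \<cdot> k)"
  using assms(1-3)
proof (cases rule: linked_cases)
  case (2 z w)
  note [simp] = assms(2-5)[THEN homD] 2(1,2)[THEN homD]
  show ?thesis
    by (rule linkedI[OF assms(3), of "z \<cdot> k" K "w \<cdot> k"])
      (simp_all add: hom_iff comp_extend[OF 2(3)] comp_extend[OF 2(4)] comp_extend[OF 2(5)])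
qed (simp add: linked_def)

text \<open>Two links through \<open>y\<close> use preimages \<open>v\<close> and \<open>v'\<close>
  of \<open>y\<close>, which coincide as \<open>m\<close> is monic. The equalities under
  \<open>q\<close> then compose, giving one link from \<open>x\<close> to \<open>z\<close>.\<close>

lemma linked_trans:
  assumes m: "monic C m" "m \<in> hom C c a" and xy: "x \<in> hom C X a" "y \<in> hom C X a"
    and lk: "linked m q x y" "linked m q y z"
  shows "linked m q x z"
  using lk(1) xy(1) m(2)
proof (cases rule: linked_cases)
  case 1
  then show ?thesis using lk(2) by simp
next
  case (2 u v)
  show ?thesis
    using lk(2) xy(2) m(2)
  proof (cases rule: linked_cases)
    case 1
    then show ?thesis using lk(1) by simp
  next
    case (2 v' w)
    have "v = v'" using monicD[OF m] \<open>v \<in> hom C X c\<close> 2 \<open>m \<cdot> v = y\<close> by simp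
    then show ?thesis
      using linkedI[OF m(2) \<open>u \<in> hom C X c\<close> 2(2) \<open>m \<cdot> u = x\<close> 2(4)] 2(5) \<open>q \<cdot> u = q \<cdot> v\<close> by simp
  qed
qed

text \<open>As \<open>m\<close> is monic, the witnesses of a link between \<open>m \<cdot> x\<close>
  and \<open>m \<cdot> y\<close> can only be \<open>x\<close> and \<open>y\<close>. The relation on
  \<open>a\<close> therefore adds no identifications on \<open>i\<close> beyond those of
  \<open>q\<close>.\<close>

lemma linked_eq:
  assumes "monic C m" "m \<in> hom C c a" "x \<in> hom C X c" "y \<in> hom C X c" "linked m q (m \<cdot> x) (m \<cdot> y)"
  shows "q \<cdot> x = q \<cdot> y"
  using assms(5) comp_hom[OF assms(2,3)] assms(2)
proof (cases rule: linked_cases)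
  case 1
  then show ?thesis using monicD[OF assms(1-4)] by simp
next
  case (2 z w)
  have "z = x" "w = y"
    using monicD[OF assms(1,2) 2(1) assms(3)] monicD[OF assms(1,2) 2(2) assms(4)] 2 by simp_all
  then show ?thesis using 2 by simp
qed

end

locale Barr_exact_amalgamable_category = Barr_exact_category +
  assumes amalgam: "span C f g \<Longrightarrow> monic C f \<Longrightarrow> monic C g \<Longrightarrow>
    \<exists>p q. stable_pushout C f g p q \<and> is_pullback C f g p q"
begin

text \<open>The relation is the union of the diagonal of \<open>a\<close> and the image under \<open>m\<close> of the kernel pair
  of \<open>q\<close>, constructed as a pushout of monomorphisms.\<close>

lemma equivalence_relation_extending_kernel_pair:
  assumes m: "monic C m" "m \<in> hom C i a" and q: "q \<in> hom C i b"
  obtains s t E where "equivalence_relation C s t" "s \<in> hom C E a" "t \<in> hom C E a"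
    "\<forall>X. \<forall>h \<in> hom C X E. locally_linked m q (s \<cdot> h) (t \<cdot> h)"
    "\<forall>X. \<forall>x \<in> hom C X a. \<forall>y \<in> hom C X a. linked m q x y \<longrightarrow>
      (\<exists>h \<in> hom C X E. s \<cdot> h = x \<and> t \<cdot> h = y)"
proof -
  obtain u v R where kp: "is_pullback C u v q q" and uv: "u \<in> hom C R i" "v \<in> hom C R i" "q \<cdot> u = q \<cdot> v"
    by (rule obtain_kernel_pair[OF q])
  note jm_uv = pullback_jointly_monic[OF kp]
  have idi: "Ide C i \<in> hom C i i" and ida: "Ide C a \<in> hom C a a"
    using Ide_hom hom_obj[OF m(2)] by blast+
  obtain \<delta> where \<delta>: "\<delta> \<in> hom C i R" "u \<cdot> \<delta> = Ide C i" "v \<cdot> \<delta> = Ide C i"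
    by (rule pullback_lift[OF kp uv(1,2) idi idi refl])
  note [simp] = m(2)[THEN homD] q[THEN homD] uv(1,2)[THEN homD] \<delta>(1)[THEN homD]
    idi[THEN homD] ida[THEN homD]
  note D = comp_extend[OF \<delta>(2)] comp_extend[OF \<delta>(3)]
  have "monic C \<delta>"
  proof (rule monicI[OF \<delta>(1)])
    fix X x y assume xy: "x \<in> hom C X i" "y \<in> hom C X i" "\<delta> \<cdot> x = \<delta> \<cdot> y"
    note [simp] = xy(1,2)[THEN homD]
    have "u \<cdot> (\<delta> \<cdot> x) = u \<cdot> (\<delta> \<cdot> y)" using xy(3) by simp
    then show "x = y" by (simp add: D)
  qed
  moreover have "span C \<delta> m" unfolding span_def by simp
  \<comment> \<open>The kernel pair and the diagonal of \<open>a\<close> have the diagonal of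
    \<open>i\<close> in common, so they are glued along the span \<open>\<delta>\<close>,
    \<open>m\<close>.\<close>
  ultimately obtain \<alpha> \<beta> where st: "stable_pushout C \<delta> m \<alpha> \<beta>"
    using amalgam m(1) by blast
  note po = stable_pushoutD[OF st]
  obtain E where AB: "\<alpha> \<in> hom C R E" "\<beta> \<in> hom C a E" "\<alpha> \<cdot> \<delta> = \<beta> \<cdot> m"
    using po \<delta>(1) m(2) by (rule pushoutE_span)
  note [simp] = AB(1,2)[THEN homD]
  obtain s where s: "s \<in> hom C E a" "s \<cdot> \<alpha> = m \<cdot> u" "s \<cdot> \<beta> = Ide C a"
    by (rule pushout_desc[OF po AB(1,2), of "m \<cdot> u" a "Ide C a"]) (simp_all add: hom_iff \<delta>)
  obtain t where t: "t \<in> hom C E a" "t \<cdot> \<alpha> = m \<cdot> v" "t \<cdot> \<beta> = Ide C a"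
    by (rule pushout_desc[OF po AB(1,2), of "m \<cdot> v" a "Ide C a"]) (simp_all add: hom_iff \<delta>)
  note [simp] = s(1)[THEN homD] t(1)[THEN homD]
  note ST = s(2,3) t(2,3) s(2,3)[THEN comp_extend] t(2,3)[THEN comp_extend]
  \<comment> \<open>This describes elements of \<open>E\<close> lying entirely in one of the two
    pieces. By \<open>stable_pushout_local\<close> every element does so on each arrow of some
    cover, where the following case distinctions are made.\<close>
  let ?inE = "\<lambda>X x. (\<exists>z \<in> hom C X R. x = \<alpha> \<cdot> z) \<or> (\<exists>z \<in> hom C X a. x = \<beta> \<cdot> z)"
  \<comment> \<open>In the piece \<open>R\<close>, agreement of \<open>s\<close> and
    \<open>t\<close> gives \<open>u \<cdot> z = v \<cdot> z\<close> since \<open>m\<close> is monic.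
    Hence \<open>z\<close> comes from \<open>i\<close> along \<open>\<delta>\<close>, and its image
    also lies in the piece \<open>a\<close>.\<close>
  have diag: "x = \<beta> \<cdot> (s \<cdot> x)" if "?inE X x" "s \<cdot> x = t \<cdot> x" for X x
    using that(1)
  proof (elim disjE bexE)
    fix z assume z: "z \<in> hom C X R" "x = \<alpha> \<cdot> z"
    note [simp] = z(1)[THEN homD]
    have "m \<cdot> (u \<cdot> z) = m \<cdot> (v \<cdot> z)" using that(2) z(2) by (simp add: ST)
    then have uz: "u \<cdot> z = v \<cdot> z"
      using monicD[OF m, of "u \<cdot> z" X "v \<cdot> z"] by (simp add: hom_iff)
    have "z = \<delta> \<cdot> (u \<cdot> z)"
      by (rule jointly_monicD[OF jm_uv uv(1), of _ X]) (simp_all add: hom_iff D uz)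
    then have "\<alpha> \<cdot> z = \<alpha> \<cdot> (\<delta> \<cdot> (u \<cdot> z))" by simp
    also have "\<dots> = \<beta> \<cdot> (s \<cdot> x)" by (simp add: comp_extend[OF AB(3)] z(2) ST)
    finally show ?thesis using z(2) by simp
  next
    fix z assume z: "z \<in> hom C X a" "x = \<beta> \<cdot> z"
    note [simp] = z(1)[THEN homD]
    show ?thesis by (simp add: z(2) ST)
  qed
  \<comment> \<open>If \<open>s\<close> and \<open>t\<close> agree on the elements, both are
    determined by \<open>diag\<close>. Otherwise neither can come from \<open>a\<close>, so both
    come from \<open>R\<close>, where \<open>u\<close>, \<open>v\<close> are jointly monic.\<close>
  have inE_eq: "x = y" if xy: "?inE X x" "?inE X y" and e: "s \<cdot> x = s \<cdot> y" "t \<cdot> x = t \<cdot> y" for X x y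
  proof (cases "s \<cdot> x = t \<cdot> x")
    case True
    then show ?thesis using diag[OF xy(1)] diag[OF xy(2)] e by simp
  next
    case False
    have *: "\<exists>z \<in> hom C X R. x = \<alpha> \<cdot> z" if "?inE X x" "s \<cdot> x \<noteq> t \<cdot> x" for x
      using that(1)
    proof (elim disjE)
      assume "\<exists>z \<in> hom C X a. x = \<beta> \<cdot> z"
      then obtain z where z: "z \<in> hom C X a" "x = \<beta> \<cdot> z" by blast
      then have "s \<cdot> x = t \<cdot> x" using homD[OF z(1)] by (simp add: ST)
      then show ?thesis using that(2) by simp
    qed
    obtain z where z: "z \<in> hom C X R" "x = \<alpha> \<cdot> z" using *[OF xy(1) False] by blast
    obtain w where w: "w \<in> hom C X R" "y = \<alpha> \<cdot> w" using *[OF xy(2)] False e by auto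
    note [simp] = z(1)[THEN homD] w(1)[THEN homD]
    have "m \<cdot> (u \<cdot> z) = m \<cdot> (u \<cdot> w)" "m \<cdot> (v \<cdot> z) = m \<cdot> (v \<cdot> w)"
      using e unfolding z(2) w(2) by (simp_all add: ST)
    then have "u \<cdot> z = u \<cdot> w" "v \<cdot> z = v \<cdot> w"
      using monicD[OF m, of "u \<cdot> z" X "u \<cdot> w"] monicD[OF m, of "v \<cdot> z" X "v \<cdot> w"]
      by (simp_all add: hom_iff)
    then show ?thesis using jointly_monicD[OF jm_uv uv(1) z(1) w(1)] z(2) w(2) by simp
  qed
  have inE_comp: "?inE K (x \<cdot> k)" if "?inE X x" "k \<in> hom C K X" for x k X K
    using that(1)
  proof (elim disjE bexE)
    fix z assume z: "z \<in> hom C X R" "x = \<alpha> \<cdot> z"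
    then show ?thesis
      using comp_hom[OF z(1) that(2)] homD[OF z(1)] homD[OF that(2)] by auto
  next
    fix z assume z: "z \<in> hom C X a" "x = \<beta> \<cdot> z"
    then show ?thesis
      using comp_hom[OF z(1) that(2)] homD[OF z(1)] homD[OF that(2)] by auto
  qed
  have inE_local: thesis' if h: "h \<in> hom C X E" and
    *: "\<And>k l K L. cover k l \<Longrightarrow> k \<in> hom C K X \<Longrightarrow> l \<in> hom C L X \<Longrightarrow> ?inE K (h \<cdot> k) \<Longrightarrow> ?inE L (h \<cdot> l) \<Longrightarrow> thesis'"
    for X h thesis'
  proof -
    obtain k l x y K L where kl: "cover k l" "k \<in> hom C K X" "l \<in> hom C L X" and
      "x \<in> hom C K R" "y \<in> hom C L a" "h \<cdot> k = \<alpha> \<cdot> x" "h \<cdot> l = \<beta> \<cdot> y"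
      by (rule stable_pushout_local[OF st AB(1,2) h])
    then show thesis' using *[OF kl] by blast
  qed
  \<comment> \<open>Joint monicity takes two passes because \<open>x\<close> and \<open>y\<close>
    reach the pieces over different covers. Here \<open>x\<close> already lies in a piece and only
    \<open>y\<close> is localized; \<open>jm\<close> then localizes \<open>x\<close>.\<close>
  have half: "x = y" if x: "x \<in> hom C X E" "?inE X x" and y: "y \<in> hom C X E"
    and e: "s \<cdot> x = s \<cdot> y" "t \<cdot> x = t \<cdot> y" for X x y
  proof (rule inE_local[OF y])
    fix k l K L assume kl: "cover k l" "k \<in> hom C K X" "l \<in> hom C L X"
      and yk: "?inE K (y \<cdot> k)" "?inE L (y \<cdot> l)"
    note [simp] = kl(2,3)[THEN homD] x(1)[THEN homD] y[THEN homD]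
    note e' = e[THEN comp_extend]
    have "x \<cdot> k = y \<cdot> k" by (rule inE_eq[OF inE_comp[OF x(2) kl(2)] yk(1)]) (simp_all add: e')
    moreover have "x \<cdot> l = y \<cdot> l"
      by (rule inE_eq[OF inE_comp[OF x(2) kl(3)] yk(2)]) (simp_all add: e')
    ultimately show "x = y" by (rule cover_epi[OF kl(1,2) x(1) y])
  qed
  have jm: "jointly_monic C s t"
  proof (rule jointly_monicI[OF s(1) t(1)])
    fix X x y assume x: "x \<in> hom C X E" and y: "y \<in> hom C X E" and e: "s \<cdot> x = s \<cdot> y" "t \<cdot> x = t \<cdot> y"
    show "x = y"
    proof (rule inE_local[OF x])
      fix k l K L assume kl: "cover k l" "k \<in> hom C K X" "l \<in> hom C L X"
        and xk: "?inE K (x \<cdot> k)" "?inE L (x \<cdot> l)"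
      note [simp] = kl(2,3)[THEN homD] x[THEN homD] y[THEN homD]
      note e' = e[THEN comp_extend]
      have "x \<cdot> k = y \<cdot> k" by (rule half[OF _ xk(1)]) (simp_all add: e' hom_iff)
      moreover have "x \<cdot> l = y \<cdot> l" by (rule half[OF _ xk(2)]) (simp_all add: e' hom_iff)
      ultimately show "x = y" by (rule cover_epi[OF kl(1,2) x y])
    qed
  qed
  have linked_if: "linked m q (s \<cdot> x) (t \<cdot> x)" if "?inE X x" for X x
    using that
  proof (elim disjE bexE)
    fix z assume z: "z \<in> hom C X R" "x = \<alpha> \<cdot> z"
    note [simp] = z(1)[THEN homD]
    show ?thesis
      by (rule linkedI[OF m(2), of "u \<cdot> z" X "v \<cdot> z"])
        (simp_all add: hom_iff z(2) ST comp_extend[OF uv(3)])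
  next
    fix z assume z: "z \<in> hom C X a" "x = \<beta> \<cdot> z"
    note [simp] = z(1)[THEN homD]
    show ?thesis by (simp add: z(2) ST linked_def)
  qed
  have loc: "locally_linked m q (s \<cdot> h) (t \<cdot> h)" if h: "h \<in> hom C X E" for X h
  proof (rule inE_local[OF h])
    fix k l K L assume kl: "cover k l" "k \<in> hom C K X" "l \<in> hom C L X"
      and hk: "?inE K (h \<cdot> k)" "?inE L (h \<cdot> l)"
    note [simp] = kl(2,3)[THEN homD] h[THEN homD]
    show ?thesis
      by (rule locally_linkedI[OF kl(1,2) comp_hom[OF s(1) h]])
        (use linked_if[OF hk(1)] linked_if[OF hk(2)] in simp_all)
  qed
  have mem: "\<exists>h \<in> hom C X E. s \<cdot> h = x \<and> t \<cdot> h = y"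
    if xy: "x \<in> hom C X a" "y \<in> hom C X a" and lk: "linked m q x y" for X x y
    using lk xy(1) m(2)
  proof (cases rule: linked_cases)
    case 1
    note [simp] = xy[THEN homD]
    show ?thesis by (intro bexI[of _ "\<beta> \<cdot> x"]) (simp_all add: hom_iff ST 1)
  next
    case (2 z w)
    obtain r where r: "r \<in> hom C X R" "u \<cdot> r = z" "v \<cdot> r = w"
      by (rule pullback_lift[OF kp uv(1,2) 2(1,2,5)])
    note [simp] = r(1)[THEN homD]
    show ?thesis by (intro bexI[of _ "\<alpha> \<cdot> r"]) (simp_all add: hom_iff ST r 2)
  qed
  \<comment> \<open>A link is composed with an element \<open>z\<close> of \<open>E\<close>.
    Localizing \<open>z\<close> yields a second link to which \<open>linked_trans\<close> applies.
    In \<open>trans\<close> the first element is localized to such a link, and joint monicity lets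
    the local composites descend.\<close>
  have trans1: "\<exists>w \<in> hom C X E. s \<cdot> w = x \<and> t \<cdot> w = t \<cdot> z"
    if z: "z \<in> hom C X E" and x: "x \<in> hom C X a" and lk: "linked m q x (s \<cdot> z)" for X x z
  proof -
    have sz: "s \<cdot> z \<in> hom C X a" and tz: "t \<cdot> z \<in> hom C X a"
      using comp_hom s(1) t(1) z by blast+
    obtain k l K L where kl: "cover k l" "k \<in> hom C K X" "l \<in> hom C L X"
      and lk2: "linked m q (s \<cdot> z \<cdot> k) (t \<cdot> z \<cdot> k)" "linked m q (s \<cdot> z \<cdot> l) (t \<cdot> z \<cdot> l)"
      by (rule locally_linkedE[OF loc[OF z] sz])
    have *: "\<exists>w \<in> hom C K E. s \<cdot> w = x \<cdot> k \<and> t \<cdot> w = t \<cdot> z \<cdot> k"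
      if k: "k \<in> hom C K X" and lk2: "linked m q (s \<cdot> z \<cdot> k) (t \<cdot> z \<cdot> k)" for k K
      by (rule mem[OF comp_hom[OF x k] comp_hom[OF tz k]], rule linked_trans[OF m _ _ _ lk2])
        (use comp_hom[OF x k] comp_hom[OF sz k] linked_comp[OF lk x m(2) q k] in blast)+
    obtain w1 w2 where w: "w1 \<in> hom C K E" "s \<cdot> w1 = x \<cdot> k" "t \<cdot> w1 = t \<cdot> z \<cdot> k"
      "w2 \<in> hom C L E" "s \<cdot> w2 = x \<cdot> l" "t \<cdot> w2 = t \<cdot> z \<cdot> l"
      using *[OF kl(2) lk2(1)] *[OF kl(3) lk2(2)] by blast
    show ?thesis
      by (rule cover_descent[OF kl jm s(1) t(1) x tz w]) blast
  qed
  have trans: "\<exists>z \<in> hom C X E. s \<cdot> z = s \<cdot> x \<and> t \<cdot> z = t \<cdot> y"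
    if x: "x \<in> hom C X E" and y: "y \<in> hom C X E" and e: "t \<cdot> x = s \<cdot> y" for X x y
  proof -
    have sx: "s \<cdot> x \<in> hom C X a" and ty: "t \<cdot> y \<in> hom C X a"
      using comp_hom s(1) t(1) x y by blast+
    obtain k l K L where kl: "cover k l" "k \<in> hom C K X" "l \<in> hom C L X"
      and lk: "linked m q (s \<cdot> x \<cdot> k) (t \<cdot> x \<cdot> k)" "linked m q (s \<cdot> x \<cdot> l) (t \<cdot> x \<cdot> l)"
      by (rule locally_linkedE[OF loc[OF x] sx])
    note [simp] = x[THEN homD] y[THEN homD] kl(2,3)[THEN homD]
    have "linked m q (s \<cdot> x \<cdot> k) (s \<cdot> (y \<cdot> k))" "linked m q (s \<cdot> x \<cdot> l) (s \<cdot> (y \<cdot> l))"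
      using lk unfolding e by simp_all
    then obtain w1 w2 where w: "w1 \<in> hom C K E" "s \<cdot> w1 = s \<cdot> x \<cdot> k" "t \<cdot> w1 = t \<cdot> (y \<cdot> k)"
      "w2 \<in> hom C L E" "s \<cdot> w2 = s \<cdot> x \<cdot> l" "t \<cdot> w2 = t \<cdot> (y \<cdot> l)"
      using trans1[OF comp_hom[OF y kl(2)] comp_hom[OF sx kl(2)]]
        trans1[OF comp_hom[OF y kl(3)] comp_hom[OF sx kl(3)]] by blast
    have w': "t \<cdot> w1 = t \<cdot> y \<cdot> k" "t \<cdot> w2 = t \<cdot> y \<cdot> l" using w by simp_all
    show ?thesis
      by (rule cover_descent[OF kl jm s(1) t(1) sx ty w(1,2) w'(1) w(4,5) w'(2)]) blast
  qed
  obtain swap where swap: "swap \<in> hom C R R" "u \<cdot> swap = v" "v \<cdot> swap = u"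
    by (rule pullback_lift[OF kp uv(1,2,2,1) uv(3)[symmetric]])
  note [simp] = swap(1)[THEN homD]
  \<comment> \<open>Symmetry is defined piecewise, by \<open>swap\<close> on the kernel pair and by
    the identity on the diagonal, and glued by descent along the pushout cover
    \<open>\<alpha>\<close>, \<open>\<beta>\<close>.\<close>
  obtain \<sigma> where \<sigma>: "\<sigma> \<in> hom C E E" "s \<cdot> \<sigma> = t" "t \<cdot> \<sigma> = s"
    by (rule cover_descent[OF pushout_cover[OF po] AB(1,2) jm s(1) t(1) t(1) s(1),
          of "\<alpha> \<cdot> swap" \<beta>]) (simp_all add: hom_iff ST swap)
  have "equivalence_relation C s t"
    by (rule equivalence_relationI[OF jm s(1) t(1) AB(2) s(3) t(3) \<sigma> trans])
  then show ?thesis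
    by (rule that[OF _ s(1) t(1)]) (use loc mem in blast)+
qed

text \<open>The quotient \<open>p\<close> of \<open>a\<close> by the relation just built identifies
  only locally linked elements. On the image of \<open>m\<close> a link amounts to equality under
  \<open>q\<close>, which makes \<open>t\<close> monic. An element linked to one in the image of
  \<open>m\<close> is itself in the image, which makes the square a pullback.\<close>

lemma monic_regular_epi_square:
  assumes m: "monic C m" "m \<in> hom C i a" and q: "regular_epi C q" "q \<in> hom C i b"
  obtains p t d where "quotient_square m q p t" "monic C t" "p \<in> hom C a d" "t \<in> hom C b d"
proof -
  obtain e1 e2 E where eq: "equivalence_relation C e1 e2" and e: "e1 \<in> hom C E a" "e2 \<in> hom C E a"
    and loc: "\<forall>X. \<forall>h \<in> hom C X E. locally_linked m q (e1 \<cdot> h) (e2 \<cdot> h)"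
    and mem: "\<forall>X. \<forall>x \<in> hom C X a. \<forall>y \<in> hom C X a. linked m q x y \<longrightarrow>
      (\<exists>h \<in> hom C X E. e1 \<cdot> h = x \<and> e2 \<cdot> h = y)"
    by (rule equivalence_relation_extending_kernel_pair[OF m q(2)])
  obtain p d where p: "p \<in> hom C a d" and kp: "is_pullback C e1 e2 p p" and rp: "regular_epi C p"
    by (rule obtain_quotient[OF eq e])
  have ep: "p \<cdot> e1 = p \<cdot> e2" using kp by (rule pullbackE)
  note [simp] = m(2)[THEN homD] q(2)[THEN homD] e[THEN homD] p[THEN homD]
  have p_eqD: "locally_linked m q x y"
    if xy: "x \<in> hom C X a" "y \<in> hom C X a" "p \<cdot> x = p \<cdot> y" for X x y
  proof -
    obtain h where "h \<in> hom C X E" "e1 \<cdot> h = x" "e2 \<cdot> h = y"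
      by (rule pullback_lift[OF kp e xy])
    then show ?thesis using loc by blast
  qed
  obtain u v R where kq: "is_pullback C u v q q" and uv: "u \<in> hom C R i" "v \<in> hom C R i" "q \<cdot> u = q \<cdot> v"
    by (rule obtain_kernel_pair[OF q(2)])
  note [simp] = uv(1,2)[THEN homD]
  have muv: "m \<cdot> u \<in> hom C R a" "m \<cdot> v \<in> hom C R a" by (simp_all add: hom_iff)
  \<comment> \<open>The arrow \<open>m\<close> carries the kernel pair of \<open>q\<close> into the
    relation, so \<open>p \<cdot> m\<close> factors through \<open>q\<close>.\<close>
  obtain h where h: "h \<in> hom C R E" "e1 \<cdot> h = m \<cdot> u" "e2 \<cdot> h = m \<cdot> v"
    using mem muv linkedI[OF m(2) uv(1,2) refl refl uv(3)] by blast
  have pm: "p \<cdot> m \<in> hom C i d" by (simp add: hom_iff)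
  have "p \<cdot> (m \<cdot> u) = p \<cdot> (m \<cdot> v)"
    using comp_extend[OF ep, of h] homD[OF h(1)] by (simp add: h)
  then have "p \<cdot> m \<cdot> u = p \<cdot> m \<cdot> v" by simp
  then obtain t where t: "t \<in> hom C b d" "t \<cdot> q = p \<cdot> m"
    by (rule coequalizer_desc[OF regular_epi_coequalizer[OF q(1) kq] q(2) pm])
  note [simp] = t(1)[THEN homD]
  note T = t(2) comp_extend[OF t(2)]
  have mt: "monic C t"
  proof (rule monicI[OF t(1)])
    fix X x y assume xy: "x \<in> hom C X b" "y \<in> hom C X b" and e3: "t \<cdot> x = t \<cdot> y"
    obtain k x' K where k: "cover k k" "k \<in> hom C K X" and x': "x' \<in> hom C K i" "x \<cdot> k = q \<cdot> x'"
      by (rule regular_epi_local[OF q xy(1)])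
    have "y \<cdot> k \<in> hom C K b" using xy(2) k(2) by (rule comp_hom)
    then obtain l y' L where l: "cover l l" "l \<in> hom C L K" and y': "y' \<in> hom C L i" "y \<cdot> k \<cdot> l = q \<cdot> y'"
      by (rule regular_epi_local[OF q])
    note [simp] = xy[THEN homD] k(2)[THEN homD] x'(1)[THEN homD] l(2)[THEN homD] y'(1)[THEN homD]
    have xl: "x' \<cdot> l \<in> hom C L i" by (simp add: hom_iff)
    have "p \<cdot> (m \<cdot> (x' \<cdot> l)) = t \<cdot> (x \<cdot> k \<cdot> l)" unfolding x'(2) by (simp add: T)
    also have "\<dots> = t \<cdot> (y \<cdot> k \<cdot> l)" using comp_extend[OF e3, of "k \<cdot> l"] by simp
    also have "\<dots> = p \<cdot> (m \<cdot> y')" unfolding y'(2) by (simp add: T)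
    finally have "locally_linked m q (m \<cdot> (x' \<cdot> l)) (m \<cdot> y')"
      by (rule p_eqD[OF comp_hom[OF m(2) xl] comp_hom[OF m(2) y'(1)]])
    then obtain k1 k2 K1 K2 where k12: "cover k1 k2" "k1 \<in> hom C K1 L" "k2 \<in> hom C K2 L"
      and lk: "linked m q (m \<cdot> (x' \<cdot> l) \<cdot> k1) (m \<cdot> y' \<cdot> k1)" "linked m q (m \<cdot> (x' \<cdot> l) \<cdot> k2) (m \<cdot> y' \<cdot> k2)"
      by (rule locally_linkedE[OF _ comp_hom[OF m(2) xl]])
    note [simp] = k12(2,3)[THEN homD]
    have "q \<cdot> (x' \<cdot> l \<cdot> k1) = q \<cdot> (y' \<cdot> k1)"
      by (rule linked_eq[OF m comp_hom[OF xl k12(2)] comp_hom[OF y'(1) k12(2)]]) (use lk(1) in simp)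
    moreover have "q \<cdot> (x' \<cdot> l \<cdot> k2) = q \<cdot> (y' \<cdot> k2)"
      by (rule linked_eq[OF m comp_hom[OF xl k12(3)] comp_hom[OF y'(1) k12(3)]]) (use lk(2) in simp)
    ultimately have "q \<cdot> (x' \<cdot> l) = q \<cdot> y'"
      using cover_epi[OF k12(1,2), of "q \<cdot> (x' \<cdot> l)" b "q \<cdot> y'"] by (simp add: hom_iff)
    then have "x \<cdot> k \<cdot> l = y \<cdot> k \<cdot> l" unfolding x'(2) y'(2) by simp
    then have "x \<cdot> k = y \<cdot> k"
      using cover_epi[OF l comp_hom[OF xy(1) k(2)] comp_hom[OF xy(2) k(2)]] by blast
    then show "x = y" using cover_epi[OF k xy] by blast
  qed
  have pb: "is_pullback C m q p t"
  proof (rule pullbackI[OF m(2) q(2) p t(1) t(2)[symmetric]])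
    show "jointly_monic C m q"
      by (rule jointly_monicI[OF m(2) q(2)]) (rule monicD[OF m])
    fix X x y assume xy: "x \<in> hom C X a" "y \<in> hom C X b" and e3: "p \<cdot> x = t \<cdot> y"
    obtain k y' K where k: "cover k k" "k \<in> hom C K X" and y': "y' \<in> hom C K i" "y \<cdot> k = q \<cdot> y'"
      by (rule regular_epi_local[OF q xy(2)])
    note [simp] = xy[THEN homD] k(2)[THEN homD] y'(1)[THEN homD]
    have xk: "x \<cdot> k \<in> hom C K a" by (simp add: hom_iff)
    have "p \<cdot> (x \<cdot> k) = t \<cdot> (y \<cdot> k)" using comp_extend[OF e3, of k] by simp
    also have "\<dots> = p \<cdot> (m \<cdot> y')" unfolding y'(2) by (simp add: T)
    finally have "locally_linked m q (x \<cdot> k) (m \<cdot> y')"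
      by (rule p_eqD[OF xk comp_hom[OF m(2) y'(1)]])
    then obtain k1 k2 K1 K2 where k12: "cover k1 k2" "k1 \<in> hom C K1 K" "k2 \<in> hom C K2 K"
      and lk: "linked m q (x \<cdot> k \<cdot> k1) (m \<cdot> y' \<cdot> k1)" "linked m q (x \<cdot> k \<cdot> k2) (m \<cdot> y' \<cdot> k2)"
      by (rule locally_linkedE[OF _ xk])
    \<comment> \<open>Both alternatives of \<open>linked\<close> put the first element into the
      image of \<open>m\<close>: it equals the second element, or it has a preimage as
      witness.\<close>
    have mem_m: "\<exists>w \<in> hom C L i. m \<cdot> w = x \<cdot> k \<cdot> l"
      if l: "l \<in> hom C L K" and lk: "linked m q (x \<cdot> k \<cdot> l) (m \<cdot> y' \<cdot> l)" for l L
      using lk comp_hom[OF xk l] m(2)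
    proof (cases rule: linked_cases)
      case 1
      then show ?thesis
        using comp_hom[OF y'(1) l] homD[OF l] by (intro bexI[of _ "y' \<cdot> l"]) simp_all
    qed blast
    obtain w1 w2 where w: "w1 \<in> hom C K1 i" "m \<cdot> w1 = x \<cdot> k \<cdot> k1" "w2 \<in> hom C K2 i" "m \<cdot> w2 = x \<cdot> k \<cdot> k2"
      using mem_m[OF k12(2) lk(1)] mem_m[OF k12(3) lk(2)] by blast
    \<comment> \<open>With \<open>m\<close>, \<open>m\<close> as the jointly monic pair,
      factorizations through \<open>m\<close> descend along the pair \<open>k1\<close>,
      \<open>k2\<close> and then along \<open>k\<close>.\<close>
    note jmm = monic_jointly_monic[OF m(1)]
    obtain w where w: "w \<in> hom C K i" "m \<cdot> w = x \<cdot> k"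
      by (rule cover_descent[OF k12 jmm m(2,2) xk xk w(1,2,2,3,4,4)])
    obtain z where z: "z \<in> hom C X i" "m \<cdot> z = x"
      by (rule cover_descent[OF k(1,2,2) jmm m(2,2) xy(1,1) w(1,2,2,1,2,2)])
    note [simp] = z(1)[THEN homD]
    have "t \<cdot> (q \<cdot> z) = t \<cdot> y" by (simp add: T z(2) e3)
    then have "q \<cdot> z = y" using monicD[OF mt t(1) comp_hom[OF q(2) z(1)] xy(2)] by blast
    then show "\<exists>z \<in> hom C X i. m \<cdot> z = x \<and> q \<cdot> z = y" using z by blast
  qed
  have "quotient_square m q p t"
    unfolding quotient_square_def
  proof (intro conjI allI ballI impI pb rp)
    fix X x y assume "x \<in> hom C X (Dom C p)" "y \<in> hom C X (Dom C p)" "p \<cdot> x = p \<cdot> y"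
    then show "locally_linked m q x y" using p_eqD[of x X y] by simp
  qed
  then show ?thesis by (rule that[OF _ mt p t(1)])
qed

lemma malcev_span_stable_pushout:
  assumes mal: "malcev_span C f g"
  obtains p q where "stable_pushout C f g p q" "is_pullback C f g p q"
proof -
  note jm = malcev_span_jointly_monic[OF mal]
  obtain c a b where H: "f \<in> hom C c a" "g \<in> hom C c b" using jm by (rule jointly_monicE)
  obtain e m i where e: "e \<in> hom C c i" "regular_epi C e" and m: "m \<in> hom C i a" "monic C m"
    and f: "m \<cdot> e = f"
    by (rule image_factorization[OF H(1)])
  obtain d n j where d: "d \<in> hom C c j" "regular_epi C d" and n: "n \<in> hom C j b" "monic C n"
    and g: "n \<cdot> d = g"
    by (rule image_factorization[OF H(2)])
  note [simp] = H[THEN homD] e(1)[THEN homD] m(1)[THEN homD] d(1)[THEN homD] n(1)[THEN homD]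
  note F = comp_extend[OF f, symmetric] comp_extend[OF g, symmetric]
  \<comment> \<open>As \<open>m\<close> and \<open>n\<close> are monic, equality under
    \<open>e\<close> and \<open>d\<close> is the same as equality under \<open>f\<close> and
    \<open>g\<close>, so the operation carries over.\<close>
  have "malcev_span C e d"
  proof (rule malcev_spanI[OF _ e(1) d(1)])
    show "jointly_monic C e d"
    proof (rule jointly_monicI[OF e(1) d(1)])
      fix X x y assume xy: "x \<in> hom C X c" "y \<in> hom C X c" "e \<cdot> x = e \<cdot> y" "d \<cdot> x = d \<cdot> y"
      show "x = y"
        by (rule jointly_monicD[OF jm H(1) xy(1,2)]) (use xy(3,4) homD[OF xy(1)] homD[OF xy(2)] in \<open>simp_all add: F\<close>)
    qed
    fix X x y z assume xyz: "x \<in> hom C X c" "y \<in> hom C X c" "z \<in> hom C X c" "d \<cdot> x = d \<cdot> y" "e \<cdot> y = e \<cdot> z"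
    note [simp] = xyz(1-3)[THEN homD]
    have "g \<cdot> x = g \<cdot> y" "f \<cdot> y = f \<cdot> z" by (simp_all add: F xyz(4,5))
    then obtain w where w: "w \<in> hom C X c" "f \<cdot> w = f \<cdot> x" "g \<cdot> w = g \<cdot> z"
      by (rule malcev_spanE[OF mal H xyz(1-3)])
    note [simp] = w(1)[THEN homD]
    have "e \<cdot> w = e \<cdot> x" "d \<cdot> w = d \<cdot> z"
      using w(2,3) monicD[OF m(2,1), of "e \<cdot> w" X "e \<cdot> x"] monicD[OF n(2,1), of "d \<cdot> w" X "d \<cdot> z"]
      by (simp_all add: hom_iff F)
    then show "\<exists>w \<in> hom C X c. e \<cdot> w = e \<cdot> x \<and> d \<cdot> w = d \<cdot> z" using w(1) by blast
  qed
  then obtain q1 q2 k where Q: "quotient_square e d q1 q2" "q1 \<in> hom C i k" "q2 \<in> hom C j k"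
    "regular_epi C q1" "regular_epi C q2"
    by (rule malcev_regular_epi_square[OF _ e(1) d(1) e(2) d(2)])
  obtain p1 t1 a' where P1: "quotient_square m q1 p1 t1" "monic C t1" "p1 \<in> hom C a a'" "t1 \<in> hom C k a'"
    by (rule monic_regular_epi_square[OF m(2,1) Q(4,2)])
  obtain p2 t2 b' where P2: "quotient_square n q2 p2 t2" "monic C t2" "p2 \<in> hom C b b'" "t2 \<in> hom C k b'"
    by (rule monic_regular_epi_square[OF n(2,1) Q(5,3)])
  have "span C t1 t2" unfolding span_def using P1(4) P2(4) by (simp add: hom_iff)
  then obtain s1 s2 where S: "stable_pushout C t1 t2 s1 s2" "is_pullback C t1 t2 s1 s2"
    using amalgam P1(2) P2(2) by blast
  \<comment> \<open>The squares form a grid: below the square of \<open>e\<close>, \<open>d\<close>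
    lies that of \<open>m\<close>, to its right that of \<open>n\<close>, and the amalgam of
    \<open>t1\<close>, \<open>t2\<close> fills the remaining corner. The two columns are pasted
    first and then joined along \<open>t1 \<cdot> q2\<close>; this exchanges the legs, which is
    undone at the end.\<close>
  have "stable_pushout C (m \<cdot> e) d p1 (t1 \<cdot> q2)"
    by (rule stable_paste[OF Q(1)[THEN quotient_square_stable] P1(1)[THEN quotient_square_stable]])
  moreover have "stable_pushout C (t1 \<cdot> q2) n s1 (s2 \<cdot> p2)"
    by (rule stable_paste[OF P2(1)[THEN quotient_square_stable, THEN stable_pushout_sym] S(1)])
  ultimately have st: "stable_pushout C (n \<cdot> d) (m \<cdot> e) (s2 \<cdot> p2) (s1 \<cdot> p1)"
    using stable_paste stable_pushout_sym by blast
  have "is_pullback C (m \<cdot> e) d p1 (t1 \<cdot> q2)"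
    by (rule pullback_paste[OF quotient_squareD(1)[OF Q(1)] quotient_squareD(1)[OF P1(1)]])
  moreover have "is_pullback C (t1 \<cdot> q2) n s1 (s2 \<cdot> p2)"
    by (rule pullback_paste[OF pullback_sym[OF quotient_squareD(1)[OF P2(1)]] S(2)])
  ultimately have "is_pullback C (n \<cdot> d) (m \<cdot> e) (s2 \<cdot> p2) (s1 \<cdot> p1)"
    using pullback_paste pullback_sym by blast
  then show ?thesis
    using that stable_pushout_sym[OF st] pullback_sym unfolding f g by blast
qed

end

section \<open>Diexact categories\<close>

context category
begin

section \<open>Passing between pushouts of the same span\<close>

lemma pullback_postcomp:
  assumes pb: "is_pullback C x y u v" and u: "u \<in> hom C a b" and j: "j \<in> hom C b d" "monic C j"
  shows "is_pullback C x y (j \<cdot> u) (j \<cdot> v)"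
proof -
  obtain c e where H: "x \<in> hom C c a" "y \<in> hom C c e" "v \<in> hom C e b" and uv: "u \<cdot> x = v \<cdot> y"
    using pb u by (rule pullbackE_left)
  note [simp] = u[THEN homD] j(1)[THEN homD] H[THEN homD]
  show ?thesis
  proof (rule pullbackI[OF H(1,2) comp_hom[OF j(1) u] comp_hom[OF j(1) H(3)] _ pullback_jointly_monic[OF pb]])
    show "j \<cdot> u \<cdot> x = j \<cdot> v \<cdot> y" by (simp add: uv)
    fix X r s assume rs: "r \<in> hom C X a" "s \<in> hom C X e" "j \<cdot> u \<cdot> r = j \<cdot> v \<cdot> s"
    note [simp] = rs(1,2)[THEN homD]
    have "u \<cdot> r = v \<cdot> s"
      using monicD[OF j(2,1), of "u \<cdot> r" X "v \<cdot> s"] rs(3) by (simp add: hom_iff)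
    then show "\<exists>t \<in> hom C X c. x \<cdot> t = r \<and> y \<cdot> t = s"
      using pullback_lift[OF pb H(1,2) rs(1,2)] by blast
  qed
qed

lemma split_monic:
  assumes "i \<in> hom C a b" "j \<in> hom C b a" "j \<cdot> i = Ide C a"
  shows "monic C i"
proof (rule monicI[OF assms(1)])
  fix X x y assume xy: "x \<in> hom C X a" "y \<in> hom C X a" "i \<cdot> x = i \<cdot> y"
  note [simp] = xy(1,2)[THEN homD] assms(1,2)[THEN homD]
  have "j \<cdot> (i \<cdot> x) = j \<cdot> (i \<cdot> y)" by (simp add: xy(3))
  then show "x = y" by (simp add: comp_extend[OF assms(3)])
qed

text \<open>The comparison arrows \<open>i\<close>, \<open>j\<close> between the two vertices are
  mutually inverse, in particular monic, and composing a cospan with a monomorphism does not change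
  its pullback. Stability at an arrow \<open>h\<close> into the new vertex is stability of the old
  square at \<open>j \<cdot> h\<close>.\<close>

lemma stable_pullback_pushout_transport:
  assumes st: "stable_pushout C f g p q" and pb: "is_pullback C f g p q" and po: "is_pushout C f g r s"
  shows "stable_pushout C f g r s" "is_pullback C f g r s"
proof -
  note po' = stable_pushoutD[OF st]
  obtain a b c d where H: "f \<in> hom C c a" "g \<in> hom C c b" "p \<in> hom C a d" "q \<in> hom C b d" "p \<cdot> f = q \<cdot> g"
    using po' by (rule pushoutE)
  obtain d' where K: "r \<in> hom C a d'" "s \<in> hom C b d'" "r \<cdot> f = s \<cdot> g"
    using po H(1,2) by (rule pushoutE_span)
  obtain i where i: "i \<in> hom C d d'" "i \<cdot> p = r" "i \<cdot> q = s"
    by (rule pushout_desc[OF po' H(3,4) K])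
  obtain j where j: "j \<in> hom C d' d" "j \<cdot> r = p" "j \<cdot> s = q"
    by (rule pushout_desc[OF po K(1,2) H(3-5)])
  note [simp] = H(1-4)[THEN homD] K(1,2)[THEN homD] i(1)[THEN homD] j(1)[THEN homD]
  have id: "Ide C d \<in> hom C d d" "Ide C d' \<in> hom C d' d'"
    using Ide_hom hom_obj[OF i(1)] by blast+
  have "j \<cdot> i = Ide C d"
    by (rule pushout_eq[OF po' H(3) _ id(1)]) (simp_all add: hom_iff i j)
  then have mi: "monic C i" by (rule split_monic[OF i(1) j(1)])
  have "i \<cdot> j = Ide C d'"
    by (rule pushout_eq[OF po K(1) _ id(2)]) (simp_all add: hom_iff i j)
  then have mj: "monic C j" by (rule split_monic[OF j(1) i(1)])
  show "is_pullback C f g r s"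
    using pullback_postcomp[OF pb H(3) i(1) mi] i by simp
  show "stable_pushout C f g r s"
    unfolding stable_pushout_def
  proof (intro conjI allI impI po; (elim conjE)?)
    fix h a b c p' q' t f' g'
    assume pbs: "is_pullback C a p' r h" "is_pullback C b q' s h" "is_pullback C c t (r \<cdot> f) h"
      and rest: "f' \<in> hom C (Dom C c) (Dom C a)" "a \<cdot> f' = f \<cdot> c" "p' \<cdot> f' = t"
        "g' \<in> hom C (Dom C c) (Dom C b)" "b \<cdot> g' = g \<cdot> c" "q' \<cdot> g' = t"
    have "is_pullback C a p' p (j \<cdot> h)" "is_pullback C b q' q (j \<cdot> h)"
      using pullback_postcomp[OF pbs(1) K(1) j(1) mj] pullback_postcomp[OF pbs(2) K(2) j(1) mj] j
      by simp_all
    moreover have "is_pullback C c t (p \<cdot> f) (j \<cdot> h)"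
      using pullback_postcomp[OF pbs(3) comp_hom[OF K(1) H(1)] j(1) mj] comp_extend[OF j(2), of f] by simp
    ultimately show "is_pushout C f' g' p' q'"
      using st rest unfolding stable_pushout_def by blast
  qed
qed

text \<open>Precomposing \<open>x \<cdot> s = y \<cdot> t\<close> with the common section
  \<open>\<rho>\<close> gives \<open>x = y\<close>, so a cocone on the span is the same as one arrow
  coequalizing the pair.\<close>

lemma reflexive_coequalizer_iff_pushout:
  assumes H: "s \<in> hom C r a" "t \<in> hom C r a" and \<rho>: "\<rho> \<in> hom C a r" "s \<cdot> \<rho> = Ide C a" "t \<cdot> \<rho> = Ide C a"
  shows "is_coequalizer C s t e \<longleftrightarrow> is_pushout C s t e e"
    and "is_pushout C s t p q \<Longrightarrow> p = q"
proof -
  note [simp] = H[THEN homD] \<rho>(1)[THEN homD]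
  have same: "x = y" if xy: "x \<in> hom C a X" "y \<in> hom C a X" "x \<cdot> s = y \<cdot> t" for X x y
  proof -
    note [simp] = xy(1,2)[THEN homD]
    show ?thesis using comp_extend[OF xy(3), of \<rho>] by (simp add: \<rho>)
  qed
  show "p = q" if po: "is_pushout C s t p q"
    by (rule pushoutE_span[OF po H]) (rule same)
  show "is_coequalizer C s t e \<longleftrightarrow> is_pushout C s t e e"
  proof
    assume co: "is_coequalizer C s t e"
    obtain d where e: "e \<in> hom C a d"
      using co homD[OF H(1)] unfolding is_coequalizer_def by (auto simp: hom_iff)
    obtain r' where "e \<cdot> s = e \<cdot> t" using co e by (rule coequalizerE_dom)
    then show "is_pushout C s t e e"
    proof (rule pushoutI[OF H e e])
      fix X x y assume "x \<in> hom C d X" "y \<in> hom C d X" "x \<cdot> e = y \<cdot> e"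
      then show "x = y" by (rule coequalizer_epi[OF co e])
    next
      fix X x y assume xy: "x \<in> hom C a X" "y \<in> hom C a X" "x \<cdot> s = y \<cdot> t"
      have "x = y" by (rule same[OF xy])
      then show "\<exists>w \<in> hom C d X. w \<cdot> e = x \<and> w \<cdot> e = y"
        using coequalizer_desc[OF co e xy(1)] xy(3) by blast
    qed
  next
    assume po: "is_pushout C s t e e"
    obtain d where e: "e \<in> hom C a d" "e \<cdot> s = e \<cdot> t"
      using po H by (rule pushoutE_span)
    show "is_coequalizer C s t e"
    proof (rule coequalizerI[OF H e])
      fix X x y assume "x \<in> hom C d X" "y \<in> hom C d X" "x \<cdot> e = y \<cdot> e"
      then show "x = y" using pushout_eq[OF po e(1)] by blast
    next
      fix X x assume "x \<in> hom C a X" "x \<cdot> s = x \<cdot> t"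
      then show "\<exists>w \<in> hom C d X. w \<cdot> e = x"
        using pushout_desc[OF po e(1,1)] by blast
    qed
  qed
qed

lemma equivalence_relation_reflexive:
  assumes "equivalence_relation C s t"
  obtains r a \<rho> where "s \<in> hom C r a" "t \<in> hom C r a"
    "\<rho> \<in> hom C a r" "s \<cdot> \<rho> = Ide C a" "t \<cdot> \<rho> = Ide C a"
proof -
  have "jointly_monic C s t" and cod: "Cod C s = Cod C t"
    using assms unfolding equivalence_relation_def by simp_all
  then obtain r a where H: "s \<in> hom C r a" "t \<in> hom C r a"
    unfolding jointly_monic_def span_def by (auto simp: hom_iff)
  have ty: "Dom C s = r" "Cod C s = a"
    using H by (simp_all add: hom_iff)
  show ?thesis
    using assms that[OF H] unfolding equivalence_relation_def ty by blast
qed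

text \<open>This is the clause of \<open>diexact\<close> besides finite completeness, named so that
  it can be a standing assumption.\<close>

definition malcev_pushouts :: bool where
  "malcev_pushouts \<longleftrightarrow> (\<forall>f g. malcev_span C f g \<longrightarrow>
     (\<exists>p q. is_pushout C f g p q) \<and>
     (\<forall>p q. is_pushout C f g p q \<longrightarrow> stable_pushout C f g p q \<and> is_pullback C f g p q))"

end

section \<open>Exactness from pushouts of Mal'cev spans\<close>

context pullback_category
begin

text \<open>For a composable triple \<open>x\<close>, \<open>y\<close>, \<open>z\<close>, a monic
  \<open>f\<close> forces \<open>y = z\<close> and the operation returns \<open>x\<close>; a monic
  \<open>g\<close> forces \<open>x = y\<close> and it returns \<open>z\<close>.\<close>

lemma monic_leg_malcev_span:
  assumes sp: "span C f g" and m: "monic C f \<or> monic C g"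
  shows "malcev_span C f g"
proof -
  obtain c a b where H: "f \<in> hom C c a" "g \<in> hom C c b"
    using sp unfolding span_def by (auto simp: hom_iff)
  have jm: "jointly_monic C f g"
    using m monicD[OF _ H(1)] monicD[OF _ H(2)] by (intro jointly_monicI[OF H]) blast
  show ?thesis
  proof (rule malcev_spanI[OF jm H])
    fix X x y z
    assume xyz: "x \<in> hom C X c" "y \<in> hom C X c" "z \<in> hom C X c" "g \<cdot> x = g \<cdot> y" "f \<cdot> y = f \<cdot> z"
    show "\<exists>w \<in> hom C X c. f \<cdot> w = f \<cdot> x \<and> g \<cdot> w = g \<cdot> z"
      using m
    proof
      assume "monic C f"
      then have "y = z" using monicD[OF _ H(1) xyz(2,3,5)] by blast
      then show ?thesis using xyz by blast
    next
      assume "monic C g"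
      then have "x = y" using monicD[OF _ H(2) xyz(1,2,4)] by blast
      then show ?thesis using xyz by (intro bexI[of _ z]) simp_all
    qed
  qed
qed

context
  assumes mp: malcev_pushouts
begin

lemma equivalence_relation_quotient:
  assumes eq: "equivalence_relation C s t"
  shows "\<exists>e. is_coequalizer C s t e" "is_coequalizer C s t e \<Longrightarrow> is_pullback C s t e e"
    "is_coequalizer C s t e \<Longrightarrow> stable_pushout C s t e e"
proof -
  obtain r a \<rho> where R: "s \<in> hom C r a" "t \<in> hom C r a"
    "\<rho> \<in> hom C a r" "s \<cdot> \<rho> = Ide C a" "t \<cdot> \<rho> = Ide C a"
    using eq by (rule equivalence_relation_reflexive)
  note refl = reflexive_coequalizer_iff_pushout[OF R]
  have mal: "malcev_span C s t" using eq by (rule equivalence_relation_malcev)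
  then show "\<exists>e. is_coequalizer C s t e"
    using mp refl unfolding malcev_pushouts_def by blast
  show "is_pullback C s t e e" "stable_pushout C s t e e" if "is_coequalizer C s t e"
    using mp mal that refl(1) unfolding malcev_pushouts_def by blast+
qed

text \<open>The kernel pair of \<open>e\<close> is an equivalence relation, so the square with both
  legs of the cospan equal to \<open>e\<close> is a stable pushout. Pulling both legs back along
  \<open>h\<close> by the same \<open>k\<close>, \<open>e'\<close> gives a pushout with legs
  \<open>e'\<close>, \<open>e'\<close>, which exhibits \<open>e'\<close> as the coequalizer of the
  pulled-back pair.\<close>

lemma malcev_pushouts_regular_epi_stable:
  assumes re: "regular_epi C e" and pb: "is_pullback C k e' e h"
  shows "regular_epi C e'"
proof -
  obtain A' A X D where H: "k \<in> hom C A' A" "e' \<in> hom C A' X" "e \<in> hom C A D" "h \<in> hom C X D"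
    and ek: "e \<cdot> k = h \<cdot> e'"
    using pb by (rule pullbackE)
  obtain u v R where kp: "is_pullback C u v e e" and uv: "u \<in> hom C R A" "v \<in> hom C R A" "e \<cdot> u = e \<cdot> v"
    by (rule obtain_kernel_pair[OF H(3)])
  have st: "stable_pushout C u v e e"
    using equivalence_relation_quotient(3)[OF kernel_pair_equivalence_relation[OF kp]]
      regular_epi_coequalizer[OF re kp] by blast
  obtain c r R' where pc: "is_pullback C c r (e \<cdot> u) h"
    and K: "c \<in> hom C R' R" "r \<in> hom C R' X" "e \<cdot> u \<cdot> c = h \<cdot> r"
    by (rule obtain_pullback[OF comp_hom[OF H(3) uv(1)] H(4)])
  note [simp] = H[THEN homD] uv(1,2)[THEN homD] K(1,2)[THEN homD]
  have uc: "e \<cdot> (u \<cdot> c) = h \<cdot> r" using K(3) by simp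
  then have vc: "e \<cdot> (v \<cdot> c) = h \<cdot> r" using comp_extend[OF uv(3), of c] by simp
  obtain f where f: "f \<in> hom C R' A'" "k \<cdot> f = u \<cdot> c" "e' \<cdot> f = r"
    by (rule pullback_lift[OF pb H(1,2) comp_hom[OF uv(1) K(1)] K(2) uc])
  obtain g where g: "g \<in> hom C R' A'" "k \<cdot> g = v \<cdot> c" "e' \<cdot> g = r"
    by (rule pullback_lift[OF pb H(1,2) comp_hom[OF uv(2) K(1)] K(2) vc])
  have po: "is_pushout C f g e' e'"
    by (rule st[unfolded stable_pushout_def, THEN conjunct2, rule_format, of k e' h k e' c r])
      (use pb pc f g in simp)
  have "is_coequalizer C f g e'"
  proof (rule coequalizerI[OF f(1) g(1) H(2)])
    show "e' \<cdot> f = e' \<cdot> g" by (simp add: f g)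
    show "x = y" if "x \<in> hom C X Y" "y \<in> hom C X Y" "x \<cdot> e' = y \<cdot> e'" for x y Y
      using pushout_eq[OF po H(2) that(1,2)] that(3) by blast
    show "\<exists>w \<in> hom C X Y. w \<cdot> e' = x" if "x \<in> hom C A' Y" "x \<cdot> f = x \<cdot> g" for x Y
      using pushout_desc[OF po H(2,2) that(1,1,2)] by blast
  qed
  then show ?thesis unfolding regular_epi_def by blast
qed

end

end

text \<open>Arrows 0, 1, 2 are the identities, 3 goes from 0 to 2 and 4 from 1 to 2. A composable
  pair always contains an identity, so its composite is \<open>u\<close> when \<open>v\<close> is an
  identity and \<open>v\<close> otherwise; values at other pairs are immaterial.\<close>

definition cospan_shape :: "(nat, nat) cat" where
  "cospan_shape = \<lparr>Obj = {0, 1, 2}, Arr = {0, 1, 2, 3, 4},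
    Dom = (\<lambda>u. if u = 3 then 0 else if u = 4 then 1 else u), Cod = (\<lambda>u. if u \<le> 2 then u else 2),
    Ide = (\<lambda>i. i), Comp = (\<lambda>v u. if v \<le> 2 then u else v)\<rparr>"

lemma cospan_shape_category: "category cospan_shape"
  by unfold_locales (auto simp: cospan_shape_def hom_def split: if_splits)

context category
begin

lemma finitely_complete_pullback:
  assumes fc: "finitely_complete C" and p: "p \<in> hom C a d" and q: "q \<in> hom C b d"
  shows "\<exists>f g. is_pullback C f g p q"
proof -
  define Fo where "Fo = (\<lambda>i::nat. if i = 0 then a else if i = 1 then b else d)"
  define Fa where "Fa = (\<lambda>u::nat. if u = 3 then p else if u = 4 then q else Ide C (Fo u))"
  note [simp] = p[THEN homD] q[THEN homD]
  have obj [simp]: "a \<in> Obj C" "b \<in> Obj C" "d \<in> Obj C"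
    using hom_obj[OF p] hom_obj[OF q] by simp_all
  have cone_iff: "is_cone cospan_shape C Fo Fa X x \<longleftrightarrow>
      x 0 \<in> hom C X a \<and> x 1 \<in> hom C X b \<and> x 2 \<in> hom C X d \<and> p \<cdot> x 0 = x 2 \<and> q \<cdot> x 1 = x 2" for X x
    unfolding is_cone_def by (auto simp: cospan_shape_def Fo_def Fa_def hom_iff)
  have "is_functor cospan_shape C Fo Fa"
    unfolding is_functor_def by (auto simp: cospan_shape_def Fo_def Fa_def hom_iff)
  moreover have "finite (Obj cospan_shape)" "finite (Arr cospan_shape)"
    by (simp_all add: cospan_shape_def)
  ultimately obtain L l where lim: "is_limit cospan_shape C Fo Fa L l"
    using fc cospan_shape_category unfolding finitely_complete_def by blast
  then have l: "l 0 \<in> hom C L a" "l 1 \<in> hom C L b" "l 2 \<in> hom C L d" "p \<cdot> l 0 = l 2" "q \<cdot> l 1 = l 2"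
    unfolding is_limit_def cone_iff by simp_all
  have uni: "\<exists>!t. t \<in> hom C X L \<and> l 0 \<cdot> t = x \<and> l 1 \<cdot> t = y"
    if xy: "x \<in> hom C X a" "y \<in> hom C X b" "p \<cdot> x = q \<cdot> y" for X x y
  proof -
    note [simp] = xy(1,2)[THEN homD] l(1-3)[THEN homD]
    \<comment> \<open>The component at the vertex 2 is forced by the other two, so a commuting
      square carries the same data as a cone.\<close>
    let ?x = "\<lambda>i::nat. if i = 0 then x else if i = 1 then y else p \<cdot> x"
    have "is_cone cospan_shape C Fo Fa X ?x"
      unfolding cone_iff using xy by (simp add: hom_iff)
    then have "\<exists>!t. t \<in> hom C X L \<and> (\<forall>i \<in> Obj cospan_shape. l i \<cdot> t = ?x i)"
      using lim unfolding is_limit_def by blast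
    moreover have "(\<forall>i \<in> Obj cospan_shape. l i \<cdot> t = ?x i) \<longleftrightarrow> l 0 \<cdot> t = x \<and> l 1 \<cdot> t = y"
      if t: "t \<in> hom C X L" for t
      using comp_extend[OF l(4), of t] homD[OF t] by (auto simp: cospan_shape_def)
    ultimately show ?thesis by (metis (no_types, lifting))
  qed
  have "is_pullback C (l 0) (l 1) p q"
  proof (rule pullbackI[OF l(1,2) p q])
    show "p \<cdot> l 0 = q \<cdot> l 1" using l by simp
    show "jointly_monic C (l 0) (l 1)"
    proof (rule jointly_monicI[OF l(1,2)])
      fix X x y assume xy: "x \<in> hom C X L" "y \<in> hom C X L" "l 0 \<cdot> x = l 0 \<cdot> y" "l 1 \<cdot> x = l 1 \<cdot> y"
      note [simp] = xy(1,2)[THEN homD] l(1-3)[THEN homD]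
      have "\<exists>!t. t \<in> hom C X L \<and> l 0 \<cdot> t = l 0 \<cdot> x \<and> l 1 \<cdot> t = l 1 \<cdot> x"
        by (rule uni) (simp_all add: hom_iff comp_extend[OF l(4)] comp_extend[OF l(5)] del: One_nat_def)
      then show "x = y" using xy by metis
    qed
    show "\<exists>t \<in> hom C X L. l 0 \<cdot> t = x \<and> l 1 \<cdot> t = y"
      if "x \<in> hom C X a" "y \<in> hom C X b" "p \<cdot> x = q \<cdot> y" for X x y
      using uni[OF that] by blast
  qed
  then show ?thesis by blast
qed

end

theorem theorem2:
  fixes C :: "('o, 'a) cat"
  assumes "category C" and "finitely_complete C"
  shows "(diexact C \<longleftrightarrow> Barr_exact C \<and> adhesive C) \<and>
         (Barr_exact C \<and> adhesive C \<longleftrightarrow> Barr_exact C \<and> amalgamable C)"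
proof -
  interpret category C by fact
  interpret pullback_category C
    by unfold_locales (rule finitely_complete_pullback[OF assms(2)])
  have diexact_iff: "diexact C \<longleftrightarrow> malcev_pushouts"
    using assms(2) unfolding diexact_def malcev_pushouts_def by simp
  have "Barr_exact C" if mp: malcev_pushouts
    unfolding Barr_exact_def regular_def is_kernel_pair_def
  proof (intro conjI allI impI assms(2); (elim conjE)?)
    show "\<exists>e. is_coequalizer C u v e" if "is_pullback C u v h h" for h u v
      using equivalence_relation_quotient(1)[OF mp kernel_pair_equivalence_relation[OF that]] .
    show "regular_epi C e'" if "regular_epi C e" "is_pullback C k e' e h" for e h k e'
      using malcev_pushouts_regular_epi_stable[OF mp that] .
    show "\<exists>h. is_pullback C s t h h" if "equivalence_relation C s t" for s t
      using equivalence_relation_quotient(1,2)[OF mp that] by blast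
  qed
  moreover have "adhesive C" if malcev_pushouts
    using that assms(2) monic_leg_malcev_span unfolding malcev_pushouts_def adhesive_def by blast
  moreover have "amalgamable C" if "adhesive C"
    using that unfolding adhesive_def amalgamable_def by blast
  moreover have malcev_pushouts if "Barr_exact C" "amalgamable C"
  proof -
    interpret Barr_exact_amalgamable_category C
      using that unfolding Barr_exact_def regular_def amalgamable_def is_kernel_pair_def
      by unfold_locales blast+
    show ?thesis
      unfolding malcev_pushouts_def
    proof (intro allI impI)
      fix f g assume "malcev_span C f g"
      then obtain p q where pq: "stable_pushout C f g p q" "is_pullback C f g p q"
        by (rule malcev_span_stable_pushout)
      show "(\<exists>p q. is_pushout C f g p q) \<and>
          (\<forall>p q. is_pushout C f g p q \<longrightarrow> stable_pushout C f g p q \<and> is_pullback C f g p q)"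
        \<comment> \<open>The construction yields one good pushout; every other pushout of the span
          inherits its properties through the comparison isomorphism.\<close>
        using stable_pushoutD[OF pq(1)] stable_pullback_pushout_transport[OF pq] by blast
    qed
  qed
  ultimately show ?thesis
    unfolding diexact_iff by blast
qed

end
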